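(* Let $U$ be a $\mathcal{V}$-module which admits a $\mathbb{Z}$-gradation $$U=\bigoplus_{j\in\mathbb{Z}}U^{j},\qquad \mathcal{V}^{i}\cdot U^{j}\subset U^{i+j}\quad(i,j\in\mathbb{Z}).$$ Then $$U\otimes F_{-1}=\bigoplus_{s\in\mathbb{Z}}\mathcal{L}_s(U),\qquad \mathcal{L}_s(U):=\bigoplus_{i\in\mathbb{Z}}U^{i}\otimes F_{-1}^{-s+i},$$ where each $\mathcal{L}_s(U)$ is a $W(0)$-module. If $U$ is irreducible (as a $\mathcal{V}$-module), then for every $s\in\mathbb{Z}$, $\mathcal{L}_s(U)$ is an irreducible $V$-module.
   Context: $F$: the Clifford algebra $CL$ is generated by $\Psi^{\pm}(r)$, $r\in\frac12+\mathbb{Z}$, with $\{\Psi^{\pm}(r),\Psi^{\mp}(s)\}=\delta_{r+s,0}$, $\{\Psi^{\pm}(r),\Psi^{\pm}(s)\}=0$; $F$ is its irreducible module generated by $\mathbf 1$ with $\Psi^{\pm}(r)\mathbf 1=0$ for $r>0$, a vertex superalgebra generated by $\Psi^{\pm}(z)=\sum_{n}\Psi^{\pm}(n+\frac12)z^{-n-1}$. $M(0)=\mathbb{C}[\gamma^{+}(n),\gamma^{-}(n)\mid n<0]$ is the commutative vertex algebra generated by $\gamma^{\pm}(z)=\sum_{n<0}\gamma^{\pm}(n)z^{-n-1}$. $\mathcal{V}$ is the vertex subalgebra of $F\otimes M(0)$ generated by $\tau^{\pm}=(\Psi^{\pm}(-\frac32)+\gamma^{\pm}(-1)\Psi^{\pm}(-\frac12))\mathbf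 1$, $j=\frac12(\gamma^+(-1)-\gamma^-(-1))\mathbf 1$, $\nu=\frac14(2\gamma^+(-1)\gamma^-(-1)+\gamma^+(-2)+\gamma^-(-2))\mathbf 1$. Let $J^{f}(0)$ be the charge operator on $F\otimes M(0)$: $J^f(0)\mathbf 1=0$, $[J^f(0),\Psi^\pm(r)]=\pm\Psi^\pm(r)$, $[J^f(0),\gamma^\pm(n)]=0$ (it is the zero mode of $\Psi^+(-\frac12)\Psi^-(-\frac12)\mathbf 1$). Then $\mathcal{V}=\bigoplus_{m\in\mathbb{Z}}\mathcal{V}^m$ with $\mathcal{V}^m=\{v\in\mathcal{V}\mid J^f(0)v=mv\}$; $\mathcal{V}^i\cdot U^j$ denotes the span of all $v_nu$, $v\in\mathcal{V}^i$, $u\in U^j$, $n\in\mathbb{Z}$. $F_{-1}=V_{\mathbb{Z}\beta}$ is the lattice vertex superalgebra of the lattice $\mathbb{Z}\beta$, $\langle\beta,\beta\rangle=-1$; $F_{-1}=\bigoplus_m F_{-1}^m$, where $F_{-1}^m$ is the irreducible module over the Heisenberg vertex algebra $M_\beta(1)$ generated by $e^{m\beta}$. Sign convention: with the usual super sign rule in tensor products, the cocycle is $\varepsilon(m\beta,n\beta)=(-1)^{mn}$. In $\mathcal{V}\otimes F_{-1}$ put $e=\tau^+\otimes e^{\beta}$, $f=\tau^-\otimes e^{-\beta}$, $h=-2(\mathbf 1\otimes\beta(-1)\mathbf 1-j\otimes\mathbf 1)$. The modes of $Y(e,z),Y(f,z),Y(h,z)$ (with $Y(x,z)=\sum x(n)z^{-n-1}$)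 satisfy the relations of the affine Lie algebra $\widehat{sl}_2$ at the critical level $-2$. $V$ is the vertex subalgebra of $\mathcal{V}\otimes F_{-1}$ generated by $e,f,h$. $W(0)=\{v\in\mathcal{V}\otimes F_{-1}\mid H(0)v=0\}=\bigoplus_m\mathcal{V}^m\otimes F_{-1}^m$, where $H(0)=J^f(0)\otimes 1+1\otimes\beta(0)$; one has $V\subset W(0)$. $W(0)$ acts on $U\otimes F_{-1}$ by restriction of the $\mathcal{V}\otimes F_{-1}$-module structure. *)

theory Defs
  imports Complex_Main "HOL-Library.Poly_Mapping" "HOL-Library.Multiset"
begin

section \<open>Vertex superalgebras and their modules\<close>

text \<open>
  The field of a vector \<open>a\<close> is \<open>Y(a,z) = (\<Sum>n. a\<^sub>n z^(-n-1))\<close>; it is represented by its modes,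
  \<open>vmode V a n = a\<^sub>n\<close>.  The superspace structure is given by the parity automorphism \<open>vparity V\<close>,
  whose \<open>+1\<close>- and \<open>-1\<close>-eigenspaces are the even and the odd part.
\<close>

record 'v vsa =
  vscale :: "complex \<Rightarrow> 'v \<Rightarrow> 'v"
  vparity :: "'v \<Rightarrow> 'v"
  vvac :: 'v
  vmode :: "'v \<Rightarrow> int \<Rightarrow> 'v \<Rightarrow> 'v"

definition homogeneous :: "'v::ab_group_add vsa \<Rightarrow> bool \<Rightarrow> 'v \<Rightarrow> bool" where
  "homogeneous V odd_part a \<longleftrightarrow> vparity V a = (if odd_part then - a else a)"

text \<open>
  \<open>vertex_module V A sM YM M\<close>: the subspace \<open>M\<close> of the vector space with scalar multiplication
  \<open>sM\<close> is a module, via the modes \<open>YM a n\<close>, over the vertex subalgebra \<open>A\<close> of \<open>V\<close>.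
  The last clause is the Borcherds identity (equivalent to the Jacobi identity); all its sums
  have finite support by the truncation condition.
\<close>

definition vertex_module ::
  "'v::ab_group_add vsa \<Rightarrow> 'v set \<Rightarrow> (complex \<Rightarrow> 'm::ab_group_add \<Rightarrow> 'm) \<Rightarrow>
    ('v \<Rightarrow> int \<Rightarrow> 'm \<Rightarrow> 'm) \<Rightarrow> 'm set \<Rightarrow> bool" where
  "vertex_module V A sM YM M \<longleftrightarrow>
     vector_space sM \<and> module.subspace sM M \<and>
     (\<forall>a\<in>A. \<forall>n. \<forall>u\<in>M. YM a n u \<in> M) \<and>
     (\<forall>a\<in>A. \<forall>n. \<forall>u\<in>M. \<forall>w\<in>M. YM a n (u + w) = YM a n u + YM a n w) \<and>
     (\<forall>a\<in>A. \<forall>n. \<forall>c. \<forall>u\<in>M. YM a n (sM c u) = sM c (YM a n u)) \<and>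
     (\<forall>a\<in>A. \<forall>b\<in>A. \<forall>n. \<forall>u\<in>M. YM (a + b) n u = YM a n u + YM b n u) \<and>
     (\<forall>a\<in>A. \<forall>n. \<forall>c. \<forall>u\<in>M. YM (vscale V c a) n u = sM c (YM a n u)) \<and>
     (\<forall>a\<in>A. \<forall>u\<in>M. \<exists>N. \<forall>n\<ge>N. YM a n u = 0) \<and>
     (\<forall>n. \<forall>u\<in>M. YM (vvac V) n u = (if n = -1 then u else 0)) \<and>
     (\<forall>a\<in>A. \<forall>b\<in>A. \<forall>p q. homogeneous V p a \<longrightarrow> homogeneous V q b \<longrightarrow>
       (\<forall>m n r. \<forall>u\<in>M.
         Sum_any (\<lambda>i::nat. sM (of_int m gchoose i)
             (YM (vmode V a (r + int i) b) (m + n - int i) u)) =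
         Sum_any (\<lambda>i::nat. sM ((-1) ^ i * (of_int r gchoose i))
             (YM a (m + r - int i) (YM b (n + int i) u)
              - sM ((-1) powi r * (if p \<and> q then -1 else 1))
                  (YM b (n + r - int i) (YM a (m + int i) u))))))"

definition vertex_superalgebra :: "'v::ab_group_add vsa \<Rightarrow> bool" where
  "vertex_superalgebra V \<longleftrightarrow>
     vertex_module V UNIV (vscale V) (vmode V) UNIV \<and>
     Vector_Spaces.linear (vscale V) (vscale V) (vparity V) \<and>
     (\<forall>a. vparity V (vparity V a) = a) \<and>
     (\<forall>a b n. vparity V (vmode V a n b) = vmode V (vparity V a) n (vparity V b)) \<and>
     vparity V (vvac V) = vvac V \<and>
     (\<forall>a. vmode V a (-1) (vvac V) = a) \<and>
     (\<forall>a. \<forall>n\<ge>0. vmode V a n (vvac V) = 0)"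

definition irreducible_vertex_module ::
  "'v::ab_group_add vsa \<Rightarrow> 'v set \<Rightarrow> (complex \<Rightarrow> 'm::ab_group_add \<Rightarrow> 'm) \<Rightarrow>
    ('v \<Rightarrow> int \<Rightarrow> 'm \<Rightarrow> 'm) \<Rightarrow> 'm set \<Rightarrow> bool" where
  "irreducible_vertex_module V A sM YM M \<longleftrightarrow>
     vertex_module V A sM YM M \<and> M \<noteq> {0} \<and>
     (\<forall>N. module.subspace sM N \<and> N \<subseteq> M \<and> (\<forall>a\<in>A. \<forall>n. \<forall>u\<in>N. YM a n u \<in> N)
        \<longrightarrow> N = {0} \<or> N = M)"

definition generated_subalgebra :: "'v::ab_group_add vsa \<Rightarrow> 'v set \<Rightarrow> 'v set" where
  "generated_subalgebra V S =
     \<Inter> {A. module.subspace (vscale V) A \<and> vvac V \<in> A \<and> S \<subseteq> A \<and>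
           (\<forall>a\<in>A. \<forall>b\<in>A. \<forall>n. vmode V a n b \<in> A)}"

definition mode_span ::
  "(complex \<Rightarrow> 'm::ab_group_add \<Rightarrow> 'm) \<Rightarrow> ('v \<Rightarrow> int \<Rightarrow> 'm \<Rightarrow> 'm) \<Rightarrow> 'v set \<Rightarrow> 'm set \<Rightarrow> 'm set" where
  "mode_span sM YM A B = module.span sM {YM a n u | a n u. a \<in> A \<and> u \<in> B}"


section \<open>Direct sums and tensor products\<close>

definition decomposes :: "('k \<Rightarrow> 'm::ab_group_add set) \<Rightarrow> 'm \<Rightarrow> ('k \<Rightarrow> 'm) \<Rightarrow> bool" where
  "decomposes G v f \<longleftrightarrow> (\<forall>k. f k \<in> G k) \<and> finite {k. f k \<noteq> 0} \<and> v = Sum_any f"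

definition direct_sum ::
  "(complex \<Rightarrow> 'm::ab_group_add \<Rightarrow> 'm) \<Rightarrow> 'm set \<Rightarrow> ('k \<Rightarrow> 'm set) \<Rightarrow> bool" where
  "direct_sum s S G \<longleftrightarrow>
     module.subspace s S \<and> (\<forall>k. module.subspace s (G k) \<and> G k \<subseteq> S) \<and>
     (\<forall>v\<in>S. \<exists>!f. decomposes G v f)"

text \<open>The operator acting as \<open>(-1)^j\<close> on the component \<open>G j\<close> of a \<open>\<int>\<close>-gradation \<open>G\<close>.\<close>

definition grade_sign ::
  "(complex \<Rightarrow> 'm::ab_group_add \<Rightarrow> 'm) \<Rightarrow> (int \<Rightarrow> 'm set) \<Rightarrow> 'm \<Rightarrow> 'm" where
  "grade_sign s G v = Sum_any (\<lambda>j. s ((-1) powi j) ((THE f. decomposes G v f) j))"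

text \<open>
  The tensor product of a space \<open>'m\<close> with the space \<open>'i \<Rightarrow>\<^sub>0 complex\<close> with basis
  \<open>(single i 1)\<close>, \<open>i :: 'i\<close>, is realised as \<open>'i \<Rightarrow>\<^sub>0 'm\<close>: the element \<open>x\<close> stands for
  \<open>(\<Sum>i. lookup x i \<otimes> single i 1)\<close>.
\<close>

definition fscale ::
  "(complex \<Rightarrow> 'm::zero \<Rightarrow> 'm) \<Rightarrow> complex \<Rightarrow> ('i \<Rightarrow>\<^sub>0 'm) \<Rightarrow> ('i \<Rightarrow>\<^sub>0 'm)" where
  "fscale s c x = Poly_Mapping.map (s c) x"

abbreviation cscale :: "complex \<Rightarrow> ('i \<Rightarrow>\<^sub>0 complex) \<Rightarrow> ('i \<Rightarrow>\<^sub>0 complex)" where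
  "cscale \<equiv> fscale (*)"

definition tens ::
  "(complex \<Rightarrow> 'm::zero \<Rightarrow> 'm) \<Rightarrow> 'm \<Rightarrow> ('i \<Rightarrow>\<^sub>0 complex) \<Rightarrow> ('i \<Rightarrow>\<^sub>0 'm)" where
  "tens s a b = Poly_Mapping.map (\<lambda>c. s c a) b"

definition tensor_subspace ::
  "(complex \<Rightarrow> 'm::ab_group_add \<Rightarrow> 'm) \<Rightarrow> 'm set \<Rightarrow> ('i \<Rightarrow>\<^sub>0 complex) set \<Rightarrow> ('i \<Rightarrow>\<^sub>0 'm) set" where
  "tensor_subspace s A B = module.span (fscale s) {tens s a b | a b. a \<in> A \<and> b \<in> B}"

definition tensor_op ::
  "(complex \<Rightarrow> 'm::ab_group_add \<Rightarrow> 'm) \<Rightarrow> ('m \<Rightarrow> 'm) \<Rightarrow> (('i \<Rightarrow>\<^sub>0 complex) \<Rightarrow> ('i \<Rightarrow>\<^sub>0 complex)) \<Rightarrow>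
    ('i \<Rightarrow>\<^sub>0 'm) \<Rightarrow> ('i \<Rightarrow>\<^sub>0 'm)" where
  "tensor_op s f g x =
     (\<Sum>i\<in>Poly_Mapping.keys x. tens s (f (Poly_Mapping.lookup x i)) (g (Poly_Mapping.single i 1)))"

text \<open>
  \<open>Y(a \<otimes> b, z)(u \<otimes> w) = (-1)^(|b||u|) Y(a,z)u \<otimes> Y(b,z)w\<close>, i.e.
  \<open>(a \<otimes> b)\<^sub>n (u \<otimes> w) = (\<Sum>k. (-1)^(|b||u|) a\<^sub>k u \<otimes> b\<^bsub>n-k-1\<^esub> w)\<close>, extended bilinearly.
  The operator \<open>par\<close> is \<open>u \<mapsto> (-1)^|u| u\<close> on the left module factor; the basis vectors
  \<open>single i 1\<close> of the right factor \<open>B\<close> are supposed to be homogeneous.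
\<close>

definition tensor_mode ::
  "('a::zero \<Rightarrow> int \<Rightarrow> 'm::ab_group_add \<Rightarrow> 'm) \<Rightarrow> (complex \<Rightarrow> 'm \<Rightarrow> 'm) \<Rightarrow> ('m \<Rightarrow> 'm) \<Rightarrow>
    ('i \<Rightarrow>\<^sub>0 complex) vsa \<Rightarrow> ('i \<Rightarrow>\<^sub>0 'a) \<Rightarrow> int \<Rightarrow> ('i \<Rightarrow>\<^sub>0 'm) \<Rightarrow> ('i \<Rightarrow>\<^sub>0 'm)" where
  "tensor_mode YM sM par B x n y =
     (\<Sum>i\<in>Poly_Mapping.keys x. \<Sum>j\<in>Poly_Mapping.keys y. Sum_any (\<lambda>k::int.
        tens sM
          (YM (Poly_Mapping.lookup x i) k
            ((if homogeneous B True (Poly_Mapping.single i 1) then par else id)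
               (Poly_Mapping.lookup y j)))
          (vmode B (Poly_Mapping.single i 1) (n - k - 1) (Poly_Mapping.single j 1))))"

definition tensor_vsa ::
  "'a::ab_group_add vsa \<Rightarrow> ('i \<Rightarrow>\<^sub>0 complex) vsa \<Rightarrow> ('i \<Rightarrow>\<^sub>0 'a) vsa" where
  "tensor_vsa A B =
     \<lparr>vscale = fscale (vscale A),
      vparity = tensor_op (vscale A) (vparity A) (vparity B),
      vvac = tens (vscale A) (vvac A) (vvac B),
      vmode = tensor_mode (vmode A) (vscale A) (vparity A) B\<rparr>"


section \<open>The Clifford vertex superalgebra \<open>F\<close>\<close>

datatype pm = Plus | Minus

text \<open>
  \<open>Psi \<epsilon> n\<close> is the operator \<open>\<Psi>\<^sup>\<epsilon>(n + 1/2)\<close>, so that \<open>\<Psi>\<^sup>\<epsilon>(z) = (\<Sum>n. Psi \<epsilon> n z^(-n-1))\<close>;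
  \<open>\<Psi>\<^sup>\<epsilon>(r)\<close> with \<open>r > 0\<close> means \<open>n \<ge> 0\<close>, and \<open>r + s = 0\<close> becomes \<open>m + n = -1\<close>.
  \<open>F\<close> is the irreducible Clifford module generated by the vacuum, with the unique vertex
  superalgebra structure having the generating fields \<open>\<Psi>\<^sup>\<epsilon>(z)\<close>.
\<close>

definition clifford_vsa :: "'f::ab_group_add vsa \<Rightarrow> (pm \<Rightarrow> int \<Rightarrow> 'f \<Rightarrow> 'f) \<Rightarrow> bool" where
  "clifford_vsa F Psi \<longleftrightarrow>
     vertex_superalgebra F \<and>
     (\<forall>\<epsilon> n. Vector_Spaces.linear (vscale F) (vscale F) (Psi \<epsilon> n)) \<and>
     (\<forall>\<epsilon> \<delta> m n v. Psi \<epsilon> m (Psi \<delta> n v) + Psi \<delta> n (Psi \<epsilon> m v) =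
        (if \<epsilon> \<noteq> \<delta> \<and> m + n = -1 then v else 0)) \<and>
     vvac F \<noteq> 0 \<and> (\<forall>\<epsilon>. \<forall>n\<ge>0. Psi \<epsilon> n (vvac F) = 0) \<and>
     (\<forall>N. module.subspace (vscale F) N \<and> (\<forall>\<epsilon> n. \<forall>v\<in>N. Psi \<epsilon> n v \<in> N)
        \<longrightarrow> N = {0} \<or> N = UNIV) \<and>
     (\<forall>\<epsilon>. homogeneous F True (Psi \<epsilon> (-1) (vvac F))) \<and>
     (\<forall>\<epsilon> n. vmode F (Psi \<epsilon> (-1) (vvac F)) n = Psi \<epsilon> n)"


section \<open>The commutative vertex algebra \<open>M(0)\<close>\<close>

text \<open>
  \<open>M(0)\<close> is the polynomial ring in the variables \<open>(\<epsilon>, k)\<close>, standing for \<open>\<gamma>\<^sup>\<epsilon>(-k-1)\<close>; monomials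
  are multisets of variables and the product of \<open>\<Rightarrow>\<^sub>0\<close> is the product of polynomials.
\<close>

type_synonym m0 = "(pm \<times> nat) multiset \<Rightarrow>\<^sub>0 complex"

definition gam :: "pm \<Rightarrow> nat \<Rightarrow> m0" where
  "gam \<epsilon> k = Poly_Mapping.single {#(\<epsilon>, k)#} 1"

text \<open>The derivation with \<open>\<gamma>\<^sup>\<epsilon>(-k-1) \<mapsto> (k+1) \<gamma>\<^sup>\<epsilon>(-k-2)\<close>.\<close>

definition m0_deriv :: "m0 \<Rightarrow> m0" where
  "m0_deriv p = (\<Sum>\<mu>\<in>Poly_Mapping.keys p. \<Sum>(\<epsilon>, k)\<in>#\<mu>.
     Poly_Mapping.single (\<mu> - {#(\<epsilon>, k)#} + {#(\<epsilon>, k + 1)#})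
       (of_nat (k + 1) * Poly_Mapping.lookup p \<mu>))"

text \<open>\<open>Y(a,z)b = (exp(zD)a) b\<close>; in particular \<open>Y(\<gamma>\<^sup>\<epsilon>(-1),z) = (\<Sum>n<0. \<gamma>\<^sup>\<epsilon>(n) z^(-n-1))\<close>.\<close>

definition m0_vsa :: "m0 vsa" where
  "m0_vsa =
     \<lparr>vscale = cscale, vparity = id, vvac = 1,
      vmode = (\<lambda>a n b. if n < 0 then
         cscale (1 / fact (nat (- n - 1))) ((m0_deriv ^^ nat (- n - 1)) a) * b else 0)\<rparr>"


section \<open>The lattice vertex superalgebra \<open>F\<^sub>-\<^sub>1\<close>\<close>

text \<open>
  The basis vector \<open>(m, \<mu>)\<close> stands for \<open>(\<Prod>k\<in>#\<mu>. \<beta>(-k-1)) e^(m\<beta>)\<close>.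
\<close>

type_synonym lat = "int \<times> nat multiset \<Rightarrow>\<^sub>0 complex"

definition lat_exp :: "int \<Rightarrow> lat" where
  "lat_exp m = Poly_Mapping.single (m, {#}) 1"

definition lin_ext :: "('i \<Rightarrow> ('j \<Rightarrow>\<^sub>0 complex)) \<Rightarrow> ('i \<Rightarrow>\<^sub>0 complex) \<Rightarrow> ('j \<Rightarrow>\<^sub>0 complex)" where
  "lin_ext f x = (\<Sum>i\<in>Poly_Mapping.keys x. cscale (Poly_Mapping.lookup x i) (f i))"

text \<open>\<open>heis n = \<beta>(n)\<close>, with \<open>[\<beta>(m), \<beta>(n)] = - m \<delta>\<^bsub>m+n,0\<^esub>\<close> and \<open>\<beta>(0) e^(m\<beta>) = - m e^(m\<beta>)\<close>.\<close>

definition heis :: "int \<Rightarrow> lat \<Rightarrow> lat" where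
  "heis n = lin_ext (\<lambda>(m, \<mu>).
     if n < 0 then Poly_Mapping.single (m, add_mset (nat (- n - 1)) \<mu>) 1
     else if n = 0 then Poly_Mapping.single (m, \<mu>) (- of_int m)
     else Poly_Mapping.single (m, \<mu> - {#nat (n - 1)#})
            (- of_int n * of_nat (count \<mu> (nat (n - 1)))))"

text \<open>
  \<open>heis_exp c d N\<close> is the coefficient of \<open>x^N\<close> in \<open>exp(c (\<Sum>k\<ge>1. \<beta>(d k) x^k / k))\<close> for \<open>d = \<plusminus>1\<close>;
  the recursion comes from applying \<open>x d/dx\<close>.
\<close>

fun heis_exp :: "complex \<Rightarrow> int \<Rightarrow> nat \<Rightarrow> lat \<Rightarrow> lat" where
  "heis_exp c d 0 w = w"
| "heis_exp c d (Suc N) w =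
     cscale (c / of_nat (Suc N)) (\<Sum>k\<le>N. heis (d * int (Suc k)) (heis_exp c d (N - k) w))"

text \<open>
  \<open>lat_exp_mode m n\<close> is the coefficient of \<open>z^(-n-1)\<close> in
  \<open>Y(e^\<alpha>,z) = exp(\<Sum>k\<ge>1. \<alpha>(-k) z^k/k) exp(- (\<Sum>k\<ge>1. \<alpha>(k) z^(-k)/k)) e\<^sub>\<alpha> z^\<alpha>(0)\<close>, \<open>\<alpha> = m\<beta>\<close>,
  where \<open>z^\<alpha>(0) e^(q\<beta>) = z^(-mq) e^(q\<beta>)\<close> and \<open>e\<^sub>\<alpha> e^(q\<beta>) = (-1)^(mq) e^((m+q)\<beta>)\<close>.
\<close>

definition lat_exp_mode :: "int \<Rightarrow> int \<Rightarrow> lat \<Rightarrow> lat" where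
  "lat_exp_mode m n = lin_ext (\<lambda>(q, \<mu>). cscale ((-1) powi (m * q)) (Sum_any (\<lambda>M::nat.
     if n + 1 \<le> int M + m * q then
       heis_exp (of_int m) (-1) (nat (int M + m * q - n - 1))
         (heis_exp (- of_int m) 1 M (Poly_Mapping.single (m + q, \<mu>) 1))
     else 0)))"

text \<open>
  The space, the vacuum, the parity and the generating fields \<open>\<beta>(z)\<close>, \<open>Y(e^(m\<beta>),z)\<close> are
  explicit; they determine the vertex superalgebra structure uniquely.
\<close>

definition lattice_vsa :: "lat vsa \<Rightarrow> bool" where
  "lattice_vsa L \<longleftrightarrow>
     vertex_superalgebra L \<and>
     vscale L = cscale \<and> vvac L = lat_exp 0 \<and>
     vparity L = lin_ext (\<lambda>(m, \<mu>). Poly_Mapping.single (m, \<mu>) ((-1) powi m)) \<and>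
     (\<forall>n. vmode L (heis (-1) (lat_exp 0)) n = heis n) \<and>
     (\<forall>m n. vmode L (lat_exp m) n = lat_exp_mode m n)"

definition lat_sector :: "int \<Rightarrow> lat set" where
  "lat_sector m = {w. fst ` Poly_Mapping.keys w \<subseteq> {m}}"


section \<open>The vertex algebras \<open>\<V>\<close>, \<open>W(0)\<close> and \<open>V\<close>\<close>

type_synonym 'f fm = "(pm \<times> nat) multiset \<Rightarrow>\<^sub>0 'f"

abbreviation FM :: "'f::ab_group_add vsa \<Rightarrow> 'f fm vsa" where
  "FM F \<equiv> tensor_vsa F m0_vsa"

definition tau :: "'f::ab_group_add vsa \<Rightarrow> (pm \<Rightarrow> int \<Rightarrow> 'f \<Rightarrow> 'f) \<Rightarrow> pm \<Rightarrow> 'f fm" where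
  "tau F Psi \<epsilon> = tens (vscale F) (Psi \<epsilon> (-2) (vvac F)) 1
               + tens (vscale F) (Psi \<epsilon> (-1) (vvac F)) (gam \<epsilon> 0)"

definition jvec :: "'f::ab_group_add vsa \<Rightarrow> 'f fm" where
  "jvec F = tens (vscale F) (vvac F) (cscale (1/2) (gam Plus 0 - gam Minus 0))"

definition nuvec :: "'f::ab_group_add vsa \<Rightarrow> 'f fm" where
  "nuvec F = tens (vscale F) (vvac F)
     (cscale (1/4) (2 * gam Plus 0 * gam Minus 0 + gam Plus 1 + gam Minus 1))"

definition calV :: "'f::ab_group_add vsa \<Rightarrow> (pm \<Rightarrow> int \<Rightarrow> 'f \<Rightarrow> 'f) \<Rightarrow> 'f fm set" where
  "calV F Psi =
     generated_subalgebra (FM F) {tau F Psi Plus, tau F Psi Minus, jvec F, nuvec F}"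

definition Jf0 :: "'f::ab_group_add vsa \<Rightarrow> (pm \<Rightarrow> int \<Rightarrow> 'f \<Rightarrow> 'f) \<Rightarrow> 'f fm \<Rightarrow> 'f fm" where
  "Jf0 F Psi =
     vmode (FM F) (tens (vscale F) (Psi Plus (-1) (Psi Minus (-1) (vvac F))) 1) 0"

definition calV_charge ::
  "'f::ab_group_add vsa \<Rightarrow> (pm \<Rightarrow> int \<Rightarrow> 'f \<Rightarrow> 'f) \<Rightarrow> int \<Rightarrow> 'f fm set" where
  "calV_charge F Psi m = {v \<in> calV F Psi. Jf0 F Psi v = vscale (FM F) (of_int m) v}"

type_synonym 'f fml = "int \<times> nat multiset \<Rightarrow>\<^sub>0 'f fm"

definition evec :: "'f::ab_group_add vsa \<Rightarrow> (pm \<Rightarrow> int \<Rightarrow> 'f \<Rightarrow> 'f) \<Rightarrow> 'f fml" where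
  "evec F Psi = tens (vscale (FM F)) (tau F Psi Plus) (lat_exp 1)"

definition fvec :: "'f::ab_group_add vsa \<Rightarrow> (pm \<Rightarrow> int \<Rightarrow> 'f \<Rightarrow> 'f) \<Rightarrow> 'f fml" where
  "fvec F Psi = tens (vscale (FM F)) (tau F Psi Minus) (lat_exp (-1))"

definition hvec :: "'f::ab_group_add vsa \<Rightarrow> 'f fml" where
  "hvec F = fscale (vscale (FM F)) (-2)
     (tens (vscale (FM F)) (vvac (FM F)) (heis (-1) (lat_exp 0))
      - tens (vscale (FM F)) (jvec F) (lat_exp 0))"

definition Vsl2 ::
  "'f::ab_group_add vsa \<Rightarrow> (pm \<Rightarrow> int \<Rightarrow> 'f \<Rightarrow> 'f) \<Rightarrow> lat vsa \<Rightarrow> 'f fml set" where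
  "Vsl2 F Psi L =
     generated_subalgebra (tensor_vsa (FM F) L) {evec F Psi, fvec F Psi, hvec F}"

definition H0 :: "'f::ab_group_add vsa \<Rightarrow> (pm \<Rightarrow> int \<Rightarrow> 'f \<Rightarrow> 'f) \<Rightarrow> 'f fml \<Rightarrow> 'f fml" where
  "H0 F Psi v = tensor_op (vscale (FM F)) (Jf0 F Psi) id v
              + tensor_op (vscale (FM F)) id (heis 0) v"

definition W0 :: "'f::ab_group_add vsa \<Rightarrow> (pm \<Rightarrow> int \<Rightarrow> 'f \<Rightarrow> 'f) \<Rightarrow> 'f fml set" where
  "W0 F Psi = {v \<in> tensor_subspace (vscale (FM F)) (calV F Psi) UNIV. H0 F Psi v = 0}"


section \<open>The modules \<open>U \<otimes> F\<^sub>-\<^sub>1\<close> and \<open>\<L>\<^sub>s(U)\<close>\<close>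

text \<open>The sign rule on \<open>U \<otimes> F\<^sub>-\<^sub>1\<close> uses the parity \<open>j mod 2\<close> of \<open>U j\<close>.\<close>

definition UF_mode ::
  "(complex \<Rightarrow> 'u::ab_group_add \<Rightarrow> 'u) \<Rightarrow> ('f::ab_group_add fm \<Rightarrow> int \<Rightarrow> 'u \<Rightarrow> 'u) \<Rightarrow> (int \<Rightarrow> 'u set) \<Rightarrow>
    lat vsa \<Rightarrow> 'f fml \<Rightarrow> int \<Rightarrow> (int \<times> nat multiset \<Rightarrow>\<^sub>0 'u) \<Rightarrow> (int \<times> nat multiset \<Rightarrow>\<^sub>0 'u)" where
  "UF_mode sU YU U L = tensor_mode YU sU (grade_sign sU U) L"

definition Lsummand ::
  "(complex \<Rightarrow> 'u::ab_group_add \<Rightarrow> 'u) \<Rightarrow> (int \<Rightarrow> 'u set) \<Rightarrow> int \<Rightarrow> int \<Rightarrow>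
    (int \<times> nat multiset \<Rightarrow>\<^sub>0 'u) set" where
  "Lsummand sU U s i = tensor_subspace sU (U i) (lat_sector (- s + i))"

definition Lmod ::
  "(complex \<Rightarrow> 'u::ab_group_add \<Rightarrow> 'u) \<Rightarrow> (int \<Rightarrow> 'u set) \<Rightarrow> int \<Rightarrow>
    (int \<times> nat multiset \<Rightarrow>\<^sub>0 'u) set" where
  "Lmod sU U s = module.span (fscale sU) (\<Union>i. Lsummand sU U s i)"

end

theory Submission
  imports Defs
    "HOL-Computational_Algebra.Formal_Power_Series"
    "HOL-Computational_Algebra.Fundamental_Theorem_Algebra"
    "HOL-Analysis.Continuum_Not_Denumerable"
begin

text \<open>
  Locality and associativity together are equivalent to the Borcherds identity and are inherited by
  tensor products; so \<open>U \<otimes> F\<^sub>-\<^sub>1\<close> is a \<open>\<V> \<otimes> F\<^sub>-\<^sub>1\<close>-module, and \<open>W(0)\<close> preserves the subspaces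
  \<open>\<L>\<^sub>s(U)\<close> for degree reasons.  Let \<open>U\<close> be irreducible.  The modes of \<open>j\<close> and \<open>\<nu>\<close> commute with those
  of \<open>\<V>\<close>, hence act on \<open>U\<close> as scalars by Schur's lemma.  A submodule \<open>N\<close> of \<open>\<L>\<^sub>s(U)\<close> over the
  algebra generated by \<open>e\<close>, \<open>f\<close>, \<open>h\<close> is stable under the modes of \<open>h = -2(\<beta> - j)\<close>, and therefore under the
  Heisenberg algebra of \<open>\<beta>\<close>.  So \<open>N\<close> is determined by the vectors \<open>u \<otimes> e^(m\<beta>)\<close> that it contains, and
  the extremal terms of the modes of \<open>e\<close> and \<open>f\<close> show that these \<open>u\<close> span a \<open>\<V>\<close>-submodule of \<open>U\<close>.
\<close>

section \<open>Finitely supported sums\<close>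

text \<open>The generators of calV include \<nu>, while V is generated by e, f, h alone, so a
  V-submodule has no evident reason to be stable under the modes of j or \<nu>. Centrality removes
  this obstacle: the coordinates of j and \<nu> are multiples of the vacuum of F, and the fields of
  M(0) have no modes of index \<ge> 0. Hence the products z_i g with z = j or \<nu> and i \<ge> 0
  vanish, and only these enter the commutator formula. No grading of U by finite-dimensional pieces
  is available. Schur's lemma rests instead on the generators having countably many modes while the
  complex field is uncountable. Elements of U \<otimes> F_{-1} are functions of the lattice basis
  index k = (m, \<mu>). In these coordinates W(0) prescribes charge m and L_s(U) prescribes degree m
  + s, so the direct sums and the stability under W(0) become statements at each k. The signs cohere
  because a vector of charge m in calV has parity m mod 2, and it shifts the degree of U, whose
  parity is the degree mod 2, by m.\<close>

lemma Sum_any_flatten: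
  assumes "finite {p. case_prod f p \<noteq> 0}"
  shows "Sum_any (\<lambda>x. Sum_any (\<lambda>y. f x y)) = Sum_any (\<lambda>(x, y). f x y)"
proof (rule Sum_any.cartesian_product)
  have "{x. \<exists>y. f x y \<noteq> 0} = fst ` {p. case_prod f p \<noteq> 0}"
    "{y. \<exists>x. f x y \<noteq> 0} = snd ` {p. case_prod f p \<noteq> 0}"
    by (auto simp: image_iff)
  then show "finite ({x. \<exists>y. f x y \<noteq> 0} \<times> {y. \<exists>x. f x y \<noteq> 0})"
    using assms by simp
qed simp

lemma Sum_any_hom:
  assumes "\<And>x y. h (x + y) = h x + h y" "h 0 = 0" "finite {x. f x \<noteq> 0}"
  shows "h (Sum_any f) = Sum_any (\<lambda>x. h (f x))"
proof -
  have sum: "h (sum f S) = (\<Sum>x\<in>S. h (f x))" if "finite S" for S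
    using that by induction (simp_all add: assms)
  have "Sum_any f = sum f {x. f x \<noteq> 0}"
    by (rule Sum_any.expand_set)
  moreover have "Sum_any (\<lambda>x. h (f x)) = (\<Sum>x\<in>{x. f x \<noteq> 0}. h (f x))"
    using assms by (intro Sum_any.expand_superset) auto
  ultimately show ?thesis using sum assms by simp
qed

lemma Sum_any_reindex_bij:
  assumes "bij l"
  shows "Sum_any (\<lambda>x. f (l x)) = Sum_any f"
  by (rule Sum_any.reindex_cong[OF assms, symmetric]) auto

lemma Sum_any_flatten_swap:
  assumes "finite {p. case_prod f p \<noteq> 0}"
  shows "Sum_any (\<lambda>y. Sum_any (\<lambda>x. f x y)) = Sum_any (\<lambda>(x, y). f x y)"
proof -
  have "{(y, x). f x y \<noteq> 0} = prod.swap ` {(x, y). f x y \<noteq> 0}" by force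
  then have "finite {p. case_prod (\<lambda>y x. f x y) p \<noteq> 0}"
    using assms by (simp add: case_prod_unfold)
  then have "Sum_any (\<lambda>y. Sum_any (\<lambda>x. f x y)) = Sum_any (\<lambda>(y, x). f x y)"
    by (rule Sum_any_flatten)
  also have "\<dots> = Sum_any (\<lambda>p. (\<lambda>(y, x). f x y) (prod.swap p))"
    by (rule Sum_any_reindex_bij[symmetric]) simp
  also have "\<dots> = Sum_any (\<lambda>(x, y). f x y)"
    by (rule Sum_any.cong) auto
  finally show ?thesis .
qed

text \<open>Collects two expansion indices by their sum, as Vandermonde's identity requires. A
  common bound on i + j over the finite support reduces it to the finite triangle.\<close>

lemma Sum_any_antidiagonal:
  assumes "finite {p. case_prod f p \<noteq> 0}"
  shows "Sum_any (\<lambda>(i, j). f i j) = Sum_any (\<lambda>k::nat. \<Sum>i\<le>k. f i (k - i))"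
proof -
  define n where "n = Max (insert 0 ((\<lambda>(i, j). i + j) ` {p. case_prod f p \<noteq> 0}))"
  have n: "i + j \<le> n" if "f i j \<noteq> 0" for i j
    unfolding n_def using that assms by (intro Max_ge) force+
  have fin: "finite {(i, j). i + j \<le> n}"
    by (rule finite_subset[of _ "{..n} \<times> {..n}"]) auto
  have "Sum_any (\<lambda>(i, j). f i j) = (\<Sum>(i, j)\<in>{(i, j). i + j \<le> n}. f i j)"
    using n fin by (intro Sum_any.expand_superset) auto
  also have "\<dots> = (\<Sum>k\<le>n. \<Sum>i\<le>k. f i (k - i))"
    by (rule sum.triangle_reindex_eq)
  also have "\<dots> = Sum_any (\<lambda>k. \<Sum>i\<le>k. f i (k - i))"
  proof (rule Sum_any.expand_superset[symmetric])
    show "{k. (\<Sum>i\<le>k. f i (k - i)) \<noteq> 0} \<subseteq> {..n}"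
    proof (rule subsetI, rule ccontr)
      fix k assume "k \<in> {k. (\<Sum>i\<le>k. f i (k - i)) \<noteq> 0}" "k \<notin> {..n}"
      moreover from this obtain i where "i \<le> k" "f i (k - i) \<noteq> 0"
        by (auto elim: sum.not_neutral_contains_not_neutral)
      ultimately show False using n[of i "k - i"] by auto
    qed
  qed simp
  finally show ?thesis .
qed

lemma Sum_any_single:
  assumes "\<And>x. x \<noteq> a \<Longrightarrow> f x = 0"
  shows "Sum_any f = f a"
proof -
  have "Sum_any f = sum f {a}" using assms by (intro Sum_any.expand_superset) auto
  then show ?thesis by simp
qed

lemma Sum_any_uminus:
  fixes f :: "'i \<Rightarrow> 'm::ab_group_add"
  shows "Sum_any (\<lambda>i. - f i) = - Sum_any f"
  by (simp add: Sum_any.expand_set sum_negf)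

lemma Sum_any_diff:
  fixes f g :: "'i \<Rightarrow> 'm::ab_group_add"
  assumes "finite {i. f i \<noteq> 0}" "finite {i. g i \<noteq> 0}"
  shows "Sum_any (\<lambda>i. f i - g i) = Sum_any f - Sum_any g"
  using Sum_any.distrib[of f "\<lambda>i. - g i"] assms by (simp add: Sum_any_uminus)

text \<open>The typical finiteness of double sums of modes: truncation confines one index uniformly,
  and the other one only after the first is fixed.\<close>

lemma finite_support_slices:
  assumes I: "finite I" "\<And>i p. i \<notin> I \<Longrightarrow> f i p = 0" and slices: "\<And>i. finite {p. f i p \<noteq> 0}"
  shows "finite {q. case_prod f q \<noteq> 0}" "finite {q. case_prod (\<lambda>p i. f i p) q \<noteq> 0}"
proof -
  have "{q. case_prod f q \<noteq> 0} \<subseteq> (SIGMA i:I. {p. f i p \<noteq> 0})" using I(2) by auto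
  then show *: "finite {q. case_prod f q \<noteq> 0}"
    by (rule finite_subset) (intro finite_SigmaI I slices)
  have "{q. case_prod (\<lambda>p i. f i p) q \<noteq> 0} = prod.swap -` {q. case_prod f q \<noteq> 0}" by auto
  then show "finite {q. case_prod (\<lambda>p i. f i p) q \<noteq> 0}"
    using finite_vimageI[OF *, of prod.swap] by simp
qed

lemma finite_support_Sum_any:
  assumes "finite {p. case_prod f p \<noteq> 0}"
  shows "finite {x. Sum_any (f x) \<noteq> 0}" "finite {y. Sum_any (\<lambda>x. f x y) \<noteq> 0}"
proof -
  have "x \<in> fst ` {p. case_prod f p \<noteq> 0}" if nz: "Sum_any (f x) \<noteq> 0" for x
  proof -
    obtain y where "f x y \<noteq> 0" by (rule Sum_any.not_neutral_obtains_not_neutral[OF nz])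
    then show ?thesis by (intro image_eqI[of _ _ "(x, y)"]) auto
  qed
  then have "{x. Sum_any (f x) \<noteq> 0} \<subseteq> fst ` {p. case_prod f p \<noteq> 0}"
    by blast
  then show "finite {x. Sum_any (f x) \<noteq> 0}"
    by (rule finite_subset) (rule finite_imageI[OF assms])
  have "y \<in> snd ` {p. case_prod f p \<noteq> 0}" if nz: "Sum_any (\<lambda>x. f x y) \<noteq> 0" for y
  proof -
    obtain x where "f x y \<noteq> 0" by (rule Sum_any.not_neutral_obtains_not_neutral[OF nz])
    then show ?thesis by (intro image_eqI[of _ _ "(x, y)"]) auto
  qed
  then have "{y. Sum_any (\<lambda>x. f x y) \<noteq> 0} \<subseteq> snd ` {p. case_prod f p \<noteq> 0}"
    by blast
  then show "finite {y. Sum_any (\<lambda>x. f x y) \<noteq> 0}"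
    by (rule finite_subset) (rule finite_imageI[OF assms])
qed

lemma Sum_any_remove:
  assumes "finite {i. f i \<noteq> 0}"
  shows "Sum_any f = f k + Sum_any (f (k := 0))"
proof -
  have "finite {i. (f (k := 0)) i \<noteq> 0}" by (rule finite_subset[OF _ assms]) auto
  then have "Sum_any ((f (k := 0)) (k := f k)) = f k + Sum_any (f (k := 0))"
    by (rule Sum_any.update) simp
  then show ?thesis by simp
qed

lemma (in vector_space) scale_Sum_any:
  assumes "finite {i. f i \<noteq> 0}"
  shows "scale c (Sum_any f) = Sum_any (\<lambda>i. scale c (f i))"
  using assms by (intro Sum_any_hom) (auto simp: scale_right_distrib)

section \<open>The Borcherds identity and convolutions\<close>

text \<open>The asymmetry is that of \<open>a_m b_n u\<close>: \<open>b_n u\<close> vanishes for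
  large n whatever m is, but the bound beyond which \<open>a_m\<close> kills \<open>b_n u\<close>
  depends on n.\<close>

definition truncated :: "(int \<Rightarrow> int \<Rightarrow> 'm::zero) \<Rightarrow> bool" where
  "truncated f \<longleftrightarrow> (\<exists>N. \<forall>n\<ge>N. \<forall>m. f m n = 0) \<and> (\<forall>n. \<exists>M. \<forall>m\<ge>M. f m n = 0)"

text \<open>
  For \<open>f(z,w) = (Sum_any (\<lambda>m n. f m n z^(-m-1) w^(-n-1)))\<close> this is the coefficient
  \<open>Res\<^sub>z Res\<^sub>w z^m w^n (z + c w)^r f(z,w)\<close>, with \<open>(z + c w)^r\<close> expanded in powers of \<open>w\<close>.
\<close>

definition zwres ::
  "complex \<Rightarrow> (complex \<Rightarrow> 'm::ab_group_add \<Rightarrow> 'm) \<Rightarrow> (int \<Rightarrow> int \<Rightarrow> 'm) \<Rightarrow> int \<Rightarrow> int \<Rightarrow> int \<Rightarrow> 'm" where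
  "zwres c s f m n r =
     (Sum_any (\<lambda>i::nat. s (c ^ i * (of_int r gchoose i)) (f (m + r - int i) (n + int i))))"

abbreviation (input) swap2 :: "(int \<Rightarrow> int \<Rightarrow> 'm) \<Rightarrow> int \<Rightarrow> int \<Rightarrow> 'm" where
  "swap2 f m n \<equiv> f n m"

lemma truncatedD1: "truncated f \<Longrightarrow> \<exists>N. \<forall>n\<ge>N. \<forall>m. f m n = 0"
  by (simp add: truncated_def)

lemma truncatedD2: "truncated f \<Longrightarrow> \<exists>M. \<forall>m\<ge>M. f m n = 0"
  by (simp add: truncated_def)

lemma truncated_compose:
  assumes "\<exists>N. \<forall>n\<ge>N. g n = 0" "\<And>m. f m 0 = 0" "\<And>u. \<exists>M. \<forall>m\<ge>M. f m u = 0"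
  shows "truncated (\<lambda>m n. f m (g n))"
proof -
  obtain N where "\<forall>n\<ge>N. g n = 0" using assms(1) by blast
  then have "\<forall>n\<ge>N. \<forall>m. f m (g n) = 0" using assms(2) by simp
  then show ?thesis unfolding truncated_def using assms(3) by blast
qed

lemma truncated_zero: "truncated (\<lambda>m n. 0)"
  by (auto simp: truncated_def)

lemma truncated_add:
  fixes f g :: "int \<Rightarrow> int \<Rightarrow> 'm::ab_group_add"
  assumes "truncated f" "truncated g"
  shows "truncated (\<lambda>m n. f m n + g m n)"
proof -
  obtain N N' where N: "\<forall>n\<ge>N. \<forall>m. f m n = 0" "\<forall>n\<ge>N'. \<forall>m. g m n = 0"
    using truncatedD1[OF assms(1)] truncatedD1[OF assms(2)] by blast
  have "\<exists>M. \<forall>m\<ge>M. f m n + g m n = 0" for n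
  proof -
    obtain M M' where "\<forall>m\<ge>M. f m n = 0" "\<forall>m\<ge>M'. g m n = 0"
      using truncatedD2[OF assms(1)] truncatedD2[OF assms(2)] by blast
    then show ?thesis by (intro exI[of _ "max M M'"]) auto
  qed
  moreover have "\<forall>n\<ge>max N N'. \<forall>m. f m n + g m n = 0" using N by auto
  ultimately show ?thesis unfolding truncated_def by blast
qed

lemma truncated_hom:
  assumes "truncated f" "h 0 = 0"
  shows "truncated (\<lambda>m n. h (f m n))"
  using assms unfolding truncated_def by metis

lemma finite_nat_bound:
  assumes "\<And>i. P i \<Longrightarrow> int i < N"
  shows "finite {i::nat. P i}"
proof (rule finite_subset[of _ "{..nat N}"])
  show "{i. P i} \<subseteq> {..nat N}" using assms by fastforce
qed simp

locale complex_space = vector_space scale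
  for scale :: "complex \<Rightarrow> 'm::ab_group_add \<Rightarrow> 'm"
begin

lemma finite_zwres:
  assumes "truncated f"
  shows "finite {i::nat. scale (a i) (f (m' i) (n + int i)) \<noteq> 0}"
proof -
  obtain N where N: "\<forall>n\<ge>N. \<forall>m. f m n = 0" using truncatedD1[OF assms] by blast
  show ?thesis
  proof (rule finite_nat_bound[of _ "N - n"])
    fix i :: nat assume "scale (a i) (f (m' i) (n + int i)) \<noteq> 0"
    then have "\<not> N \<le> n + int i" using N by (metis scale_zero_right)
    then show "int i < N - n" by simp
  qed
qed

lemma zwres_0: "zwres c scale f m n 0 = f m n"
  unfolding zwres_def by (subst Sum_any_single[of 0]) (auto simp: gbinomial_0_left)

text \<open>Multiplication of (z + c w)^r by z + c w; on coefficients this is Pascal's rule, which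
  holds for binomials with any upper argument, so r may be negative.\<close>

lemma zwres_pascal:
  assumes "truncated f"
  shows "zwres c scale f m n (r + 1) = zwres c scale f (m + 1) n r + scale c (zwres c scale f m (n + 1) r)"
proof -
  obtain N where N: "\<forall>n\<ge>N. \<forall>m. f m n = 0" using truncatedD1[OF assms] by blast
  define K where "K = nat (N - n) + 1"
  \<comment> \<open>Cutting off at \<open>K'\<close> is allowed once n + \<open>K'\<close> \<ge> N -
    1: the first omitted index is \<open>K'\<close> + 1, where the second argument of f has reached
    N.\<close>
  have ex: "zwres c scale f m n r = (\<Sum>i\<le>K'. scale (c ^ i * (of_int r gchoose i)) (f (m + r - int i) (n + int i)))"
    if "n + int K' \<ge> N - 1" for m n r K'
    unfolding zwres_def
  proof (rule Sum_any.expand_superset)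
    show "{i. scale (c ^ i * (of_int r gchoose i)) (f (m + r - int i) (n + int i)) \<noteq> 0} \<subseteq> {..K'}"
    proof (rule subsetI, rule ccontr)
      fix i assume i: "i \<in> {i. scale (c ^ i * (of_int r gchoose i)) (f (m + r - int i) (n + int i)) \<noteq> 0}" "i \<notin> {..K'}"
      then have "n + int i \<ge> N" using that by auto
      then show False using i N by simp
    qed
  qed simp
  let ?t = "\<lambda>i. f (m + 1 + r - int i) (n + int i)"
  have "zwres c scale f m n (r + 1)
      = (\<Sum>i\<le>Suc K. scale (c ^ i * (of_int r + 1 gchoose i)) (?t i))"
    by (subst ex[of _ "Suc K"]) (auto simp: K_def algebra_simps)
  also have "\<dots> = ?t 0 + (\<Sum>i\<le>K. scale (c ^ Suc i * (of_int r + 1 gchoose Suc i)) (?t (Suc i)))"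
    by (subst sum.atMost_Suc_shift) simp
  also have "(\<Sum>i\<le>K. scale (c ^ Suc i * (of_int r + 1 gchoose Suc i)) (?t (Suc i)))
      = (\<Sum>i\<le>K. scale (c ^ Suc i * (of_int r gchoose Suc i)) (?t (Suc i)))
      + (\<Sum>i\<le>K. scale (c ^ Suc i * (of_int r gchoose i)) (?t (Suc i)))"
    by (simp only: gbinomial_Suc_Suc distrib_left scale_left_distrib sum.distrib) (rule add.commute)
  also have "?t 0 + \<dots> = (\<Sum>i\<le>Suc K. scale (c ^ i * (of_int r gchoose i)) (?t i))
      + (\<Sum>i\<le>K. scale (c ^ Suc i * (of_int r gchoose i)) (?t (Suc i)))"
    by (subst sum.atMost_Suc_shift) simp
  also have "(\<Sum>i\<le>Suc K. scale (c ^ i * (of_int r gchoose i)) (?t i)) = zwres c scale f (m + 1) n r"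
    by (subst ex[of _ "Suc K"]) (auto simp: K_def)
  also have "(\<Sum>i\<le>K. scale (c ^ Suc i * (of_int r gchoose i)) (?t (Suc i)))
      = scale c (zwres c scale f m (n + 1) r)"
    by (subst ex[of _ K]) (auto simp: K_def scale_sum_right algebra_simps)
  finally show ?thesis .
qed

text \<open>For fixed n only finitely many i contribute, so a single bound on m + r forces the
  residue to vanish. The two claims read it as a bound on m and as a bound on r.\<close>

lemma truncated_zwres:
  assumes "truncated f"
  shows "truncated (\<lambda>m n. zwres c scale f m n r)" "truncated (\<lambda>r n. zwres c scale f m n r)"
proof -
  obtain N where N: "\<forall>n\<ge>N. \<forall>m. f m n = 0" using truncatedD1[OF assms] by blast
  have *: "\<exists>M. \<forall>m i. m \<ge> M \<longrightarrow> f (m - int i) (n + int i) = 0" for n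
  proof -
    obtain M where M: "\<forall>m\<ge>M n. f m n = 0" for n
      using truncatedD2[OF assms] by metis
    let ?M = "Max (insert 0 ((\<lambda>i. M (n + int i) + int i) ` {..nat (N - n)}))"
    have "f (m - int i) (n + int i) = 0" if "m \<ge> ?M" for m i
    proof (cases "int i \<le> N - n")
      case True
      then have "M (n + int i) + int i \<le> ?M"
        by (intro Max_ge) (auto simp: nat_le_iff le_nat_iff)
      then have "m - int i \<ge> M (n + int i)" using that by linarith
      then show ?thesis using M by blast
    next
      case False
      then show ?thesis using N by auto
    qed
    then show ?thesis by blast
  qed
  have 1: "zwres c scale f m n r = 0" if "n \<ge> N" for m n r
    unfolding zwres_def using N that by auto
  have 2: "\<exists>M. \<forall>m r. m + r \<ge> M \<longrightarrow> zwres c scale f m n r = 0" for n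
  proof -
    obtain M where "\<forall>m i. m \<ge> M \<longrightarrow> f (m - int i) (n + int i) = 0" using * by blast
    then have "zwres c scale f m n r = 0" if "m + r \<ge> M" for m r
      unfolding zwres_def using that by simp
    then show ?thesis by blast
  qed
  have "\<exists>M. \<forall>m\<ge>M. zwres c scale f m n r = 0" for n
  proof -
    obtain M where "\<forall>m r. m + r \<ge> M \<longrightarrow> zwres c scale f m n r = 0" using 2 by blast
    then show ?thesis by (intro exI[of _ "M - r"]) auto
  qed
  then show "truncated (\<lambda>m n. zwres c scale f m n r)" unfolding truncated_def using 1 by blast
  have "\<exists>M. \<forall>r\<ge>M. zwres c scale f m n r = 0" for n
  proof -
    obtain M where "\<forall>m r. m + r \<ge> M \<longrightarrow> zwres c scale f m n r = 0" using 2 by blast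
    then show ?thesis by (intro exI[of _ "M - m"]) auto
  qed
  then show "truncated (\<lambda>r n. zwres c scale f m n r)" unfolding truncated_def using 1 by blast
qed

lemma subspace_Sum_any:
  assumes "subspace S" "\<And>i. f i \<in> S"
  shows "Sum_any f \<in> S"
  using assms by (auto simp: Sum_any.expand_set intro: subspace_sum)

lemma subspace_summand:
  assumes N: "subspace N" and fin: "finite {i. f i \<noteq> 0}" and sum: "Sum_any f \<in> N"
    and other: "\<And>i. i \<noteq> k \<Longrightarrow> f i \<in> N"
  shows "f k \<in> N"
proof -
  have "Sum_any (f (k := 0)) \<in> N"
    by (rule subspace_Sum_any[OF N]) (use other subspace_0[OF N] in auto)
  then have "Sum_any f - Sum_any (f (k := 0)) \<in> N" by (rule subspace_diff[OF N sum])
  then show ?thesis by (simp add: Sum_any_remove[OF fin, of k])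
qed

end

section \<open>Products of two-variable series along a bilinear map\<close>

locale pairing = A: complex_space sA + B: complex_space sB + C: complex_space sC
  for sA :: "complex \<Rightarrow> 'a::ab_group_add \<Rightarrow> 'a"
    and sB :: "complex \<Rightarrow> 'b::ab_group_add \<Rightarrow> 'b"
    and sC :: "complex \<Rightarrow> 'c::ab_group_add \<Rightarrow> 'c" +
  fixes T :: "'a \<Rightarrow> 'b \<Rightarrow> 'c"
  assumes T_add_left: "T (x + x') y = T x y + T x' y"
    and T_add_right: "T x (y + y') = T x y + T x y'"
    and T_scale_left: "T (sA c x) y = sC c (T x y)"
    and T_scale_right: "T x (sB c y) = sC c (T x y)"
begin

lemma T_zero_left [simp]: "T 0 y = 0"
  using T_add_left[of 0 0 y] by simp

lemma T_zero_right [simp]: "T x 0 = 0"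
  using T_add_right[of x 0 0] by simp

lemma T_Sum_any:
  assumes "finite {i. f i \<noteq> 0}" "finite {j. g j \<noteq> 0}"
  shows "T (Sum_any f) (Sum_any g) = Sum_any (\<lambda>(i, j). T (f i) (g j))"
proof -
  have fin: "finite {p. case_prod (\<lambda>i j. T (f i) (g j)) p \<noteq> 0}"
    by (rule finite_subset[of _ "{i. f i \<noteq> 0} \<times> {j. g j \<noteq> 0}"]) (use assms in auto)
  have "T (Sum_any f) (Sum_any g) = Sum_any (\<lambda>i. T (f i) (Sum_any g))"
    using assms by (intro Sum_any_hom[where h = "\<lambda>x. T x (Sum_any g)"]) (auto simp: T_add_left)
  also have "\<dots> = Sum_any (\<lambda>i. Sum_any (\<lambda>j. T (f i) (g j)))"
    using assms by (intro Sum_any.cong Sum_any_hom) (auto simp: T_add_right)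
  also have "\<dots> = Sum_any (\<lambda>(i, j). T (f i) (g j))"
    by (rule Sum_any_flatten[OF fin])
  finally show ?thesis .
qed

text \<open>The coefficient of z^(-m-1) w^(-n-1) in the product of the two series. The shifts by 1
  come from the convention that the index k belongs to z^(-k-1).\<close>

definition conv :: "(int \<Rightarrow> int \<Rightarrow> 'a) \<Rightarrow> (int \<Rightarrow> int \<Rightarrow> 'b) \<Rightarrow> int \<Rightarrow> int \<Rightarrow> 'c" where
  "conv f g m n = Sum_any (\<lambda>(k, l). T (f k l) (g (m - k - 1) (n - l - 1)))"

lemma finite_conv:
  assumes "truncated f" "truncated g"
  shows "finite {p. (case p of (k, l) \<Rightarrow> T (f k l) (g (m - k - 1) (n - l - 1))) \<noteq> 0}"
proof -
  obtain N N' where N: "\<forall>n\<ge>N. \<forall>m. f m n = 0" "\<forall>n\<ge>N'. \<forall>m. g m n = 0"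
    using truncatedD1[OF assms(1)] truncatedD1[OF assms(2)] by blast
  obtain M M' where M: "\<forall>m\<ge>M n. f m n = 0" "\<forall>m\<ge>M' n. g m n = 0" for n
    using truncatedD2[OF assms(1)] truncatedD2[OF assms(2)] by metis
  show ?thesis
  proof (rule finite_support_slices(2))
    show "T (f k l) (g (m - k - 1) (n - l - 1)) = 0" if "l \<notin> {n - 1 - N'..N}" for l k
    proof (cases "l \<ge> N")
      case False
      then have "n - l - 1 \<ge> N'" using that by auto
      then show ?thesis using N by simp
    qed (use N in simp)
    show "finite {k. T (f k l) (g (m - k - 1) (n - l - 1)) \<noteq> 0}" for l
    proof (rule finite_subset)
      show "{k. T (f k l) (g (m - k - 1) (n - l - 1)) \<noteq> 0} \<subseteq> {m - 1 - M' (n - l - 1)..M l}"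
      proof
        fix k assume "k \<in> {k. T (f k l) (g (m - k - 1) (n - l - 1)) \<noteq> 0}"
        then have "f k l \<noteq> 0" "g (m - k - 1) (n - l - 1) \<noteq> 0" by auto
        then have "\<not> k \<ge> M l" "\<not> m - k - 1 \<ge> M' (n - l - 1)" using M by blast+
        then show "k \<in> {m - 1 - M' (n - l - 1)..M l}" by simp
      qed
    qed simp
  qed simp
qed

lemma truncated_conv:
  assumes "truncated f" "truncated g"
  shows "truncated (conv f g)"
proof -
  obtain N N' where N: "\<forall>n\<ge>N. \<forall>m. f m n = 0" "\<forall>n\<ge>N'. \<forall>m. g m n = 0"
    using truncatedD1[OF assms(1)] truncatedD1[OF assms(2)] by blast
  obtain M M' where M: "\<forall>m\<ge>M n. f m n = 0" "\<forall>m\<ge>M' n. g m n = 0" for n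
    using truncatedD2[OF assms(1)] truncatedD2[OF assms(2)] by metis
  have 0: "conv f g m n = 0" if "\<And>k l. f k l \<noteq> 0 \<Longrightarrow> g (m - k - 1) (n - l - 1) \<noteq> 0 \<Longrightarrow> False" for m n
  proof -
    have "T (f k l) (g (m - k - 1) (n - l - 1)) = 0" for k l
      using that[of k l] by (cases "f k l = 0"; cases "g (m - k - 1) (n - l - 1) = 0") auto
    then show ?thesis unfolding conv_def by simp
  qed
  have "conv f g m n = 0" if "n \<ge> N + N'" for m n
  proof (rule 0)
    fix k l assume "f k l \<noteq> 0" "g (m - k - 1) (n - l - 1) \<noteq> 0"
    then have "\<not> l \<ge> N" "\<not> n - l - 1 \<ge> N'" using N by blast+
    then show False using that by linarith
  qed
  moreover have "\<exists>K. \<forall>m\<ge>K. conv f g m n = 0" for n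
  proof -
    \<comment> \<open>Uniform truncation leaves finitely many l; for each of them nonzero factors
      force m < M l + M' (n - l - 1).\<close>
    define K where "K = Max (insert 0 ((\<lambda>l. M l + M' (n - l - 1)) ` {n - 1 - N'..N}))"
    have "conv f g m n = 0" if "m \<ge> K" for m
    proof (rule 0)
      fix k l assume "f k l \<noteq> 0" "g (m - k - 1) (n - l - 1) \<noteq> 0"
      then have *: "\<not> l \<ge> N" "\<not> n - l - 1 \<ge> N'" "\<not> k \<ge> M l" "\<not> m - k - 1 \<ge> M' (n - l - 1)"
        using N M by blast+
      then have "M l + M' (n - l - 1) \<le> K" unfolding K_def by (intro Max_ge) auto
      then show False using * that by linarith
    qed
    then show ?thesis by blast
  qed
  ultimately show ?thesis unfolding truncated_def by blast
qed

lemma conv_add_left: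
  assumes "truncated f" "truncated f'" "truncated g"
  shows "conv (\<lambda>k l. f k l + f' k l) g m n = conv f g m n + conv f' g m n"
  unfolding conv_def
  by (subst Sum_any.distrib[symmetric])
    (use assms in \<open>auto intro!: Sum_any.cong finite_conv simp: T_add_left\<close>)

lemma conv_scale_left:
  assumes "truncated f" "truncated g"
  shows "conv (\<lambda>k l. sA c (f k l)) g m n = sC c (conv f g m n)"
  unfolding conv_def
  by (subst C.scale_Sum_any)
    (use assms in \<open>auto intro!: Sum_any.cong finite_conv simp: T_scale_left\<close>)

lemma conv_add_right:
  assumes "truncated f" "truncated g" "truncated g'"
  shows "conv f (\<lambda>k l. g k l + g' k l) m n = conv f g m n + conv f g' m n"
  unfolding conv_def
  by (subst Sum_any.distrib[symmetric])
    (use assms in \<open>auto intro!: Sum_any.cong finite_conv simp: T_add_right\<close>)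

lemma conv_scale_right:
  assumes "truncated f" "truncated g"
  shows "conv f (\<lambda>k l. sB c (g k l)) m n = sC c (conv f g m n)"
  unfolding conv_def
  by (subst C.scale_Sum_any)
    (use assms in \<open>auto intro!: Sum_any.cong finite_conv simp: T_scale_right\<close>)

lemma conv_swap: "conv (swap2 f) (swap2 g) m n = conv f g n m"
proof -
  have "conv (swap2 f) (swap2 g) m n
      = Sum_any (\<lambda>p. (\<lambda>(k, l). T (f k l) (g (n - k - 1) (m - l - 1))) (prod.swap p))"
    unfolding conv_def by (rule Sum_any.cong) auto
  also have "\<dots> = conv f g n m"
    unfolding conv_def by (rule Sum_any_reindex_bij) simp
  finally show ?thesis .
qed

lemma conv_shift:
  "conv (\<lambda>k l. f (k + a) (l + b)) g m n = conv f g (m + a) (n + b)"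
proof -
  have bij: "bij (\<lambda>(k::int, l::int). (k + a, l + b))"
    by (rule bij_betw_byWitness[where f' = "\<lambda>(k, l). (k - a, l - b)"]) auto
  have "conv (\<lambda>k l. f (k + a) (l + b)) g m n
      = Sum_any (\<lambda>p. (\<lambda>(k, l). T (f k l) (g (m + a - k - 1) (n + b - l - 1))) ((\<lambda>(k, l). (k + a, l + b)) p))"
    unfolding conv_def by (rule Sum_any.cong) (auto simp: algebra_simps)
  also have "\<dots> = conv f g (m + a) (n + b)"
    unfolding conv_def by (rule Sum_any_reindex_bij[OF bij])
  finally show ?thesis .
qed

lemma conv_shift_right:
  "conv f (\<lambda>k l. g (k + a) (l + b)) m n = conv f g (m + a) (n + b)"
  unfolding conv_def by (rule Sum_any.cong) (auto simp: algebra_simps)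

lemma truncated_shift: "truncated f \<Longrightarrow> truncated (\<lambda>k l. f (k + a) (l + b))"
proof -
  assume f: "truncated f"
  obtain N where "\<forall>n\<ge>N. \<forall>m. f m n = 0" using truncatedD1[OF f] by blast
  then have "\<forall>n\<ge>N - b. \<forall>m. f (m + a) (n + b) = 0" by auto
  moreover have "\<exists>M. \<forall>m\<ge>M. f (m + a) (n + b) = 0" for n
  proof -
    obtain M where "\<forall>m\<ge>M. f m (n + b) = 0" using truncatedD2[OF f] by blast
    then show ?thesis by (intro exI[of _ "M - a"]) auto
  qed
  ultimately show ?thesis unfolding truncated_def by blast
qed

lemma conv_lincomb_left:
  assumes "truncated f" "truncated f'" "truncated g"
  shows "conv (\<lambda>k l. f k l + sA c (f' k l)) g m n = conv f g m n + sC c (conv f' g m n)"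
  using conv_add_left[OF assms(1) truncated_hom[OF assms(2)] assms(3), of "sA c" m n]
    conv_scale_left[OF assms(2,3), of c m n] by simp

lemma conv_lincomb_right:
  assumes "truncated f" "truncated g" "truncated g'"
  shows "conv f (\<lambda>k l. g k l + sB c (g' k l)) m n = conv f g m n + sC c (conv f g' m n)"
  using conv_add_right[OF assms(1,2) truncated_hom[OF assms(3)], of "sB c" m n]
    conv_scale_right[OF assms(1,3), of c m n] by simp

text \<open>For exponents \<ge> 0 both factors are multiplied by polynomials in z and w, so the
  exponents add. \<open>zwres_pascal\<close> reduces each induction step to index shifts, which pass
  through \<open>conv\<close>.\<close>

lemma conv_zwres_nat:
  assumes f: "truncated f" and g: "truncated g"
  shows "conv (\<lambda>k l. zwres c sA f k l (int r)) (\<lambda>k l. zwres c sB g k l (int r')) m n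
    = zwres c sC (conv f g) m n (int r + int r')"
proof (induction r arbitrary: m n)
  case 0
  show ?case
  proof (induction r' arbitrary: m n)
    case 0
    show ?case by (simp add: A.zwres_0 B.zwres_0 C.zwres_0)
  next
    case (Suc r')
    let ?f = "\<lambda>k l. zwres c sA f k l (int 0)" and ?g = "\<lambda>k l. zwres c sB g k l (int r')"
    note tr = A.truncated_zwres(1)[OF f, of c "int 0"] B.truncated_zwres(1)[OF g, of c "int r'"]
    have "zwres c sB g k l (int (Suc r')) = ?g (k + 1) l + sB c (?g k (l + 1))" for k l
      using B.zwres_pascal[OF g, of c k l "int r'"] by (simp add: add.commute)
    then have "conv ?f (\<lambda>k l. zwres c sB g k l (int (Suc r'))) m n
      = conv ?f (\<lambda>k l. ?g (k + 1) l + sB c (?g k (l + 1))) m n"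
      by simp
    also have "\<dots> = conv ?f (\<lambda>k l. ?g (k + 1) l) m n + sC c (conv ?f (\<lambda>k l. ?g k (l + 1)) m n)"
      using truncated_shift[OF tr(2), of 1 0] truncated_shift[OF tr(2), of 0 1]
      by (intro conv_lincomb_right[OF tr(1)]) simp_all
    also have "\<dots> = conv ?f ?g (m + 1) n + sC c (conv ?f ?g m (n + 1))"
      using conv_shift_right[of ?f ?g 1 0 m n] conv_shift_right[of ?f ?g 0 1 m n] by simp
    also have "\<dots> = zwres c sC (conv f g) m n (int 0 + int (Suc r'))"
      using Suc[of "m + 1" n] Suc[of m "n + 1"]
        C.zwres_pascal[OF truncated_conv[OF f g], of c m n "int r'"]
      by (simp add: add.commute)
    finally show ?case .
  qed
next
  case (Suc r)
  let ?f = "\<lambda>k l. zwres c sA f k l (int r)" and ?g = "\<lambda>k l. zwres c sB g k l (int r')"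
  note tr = A.truncated_zwres(1)[OF f, of c "int r"] B.truncated_zwres(1)[OF g, of c "int r'"]
  have "zwres c sA f k l (int (Suc r)) = ?f (k + 1) l + sA c (?f k (l + 1))" for k l
    using A.zwres_pascal[OF f, of c k l "int r"] by (simp add: add.commute)
  then have "conv (\<lambda>k l. zwres c sA f k l (int (Suc r))) ?g m n
    = conv (\<lambda>k l. ?f (k + 1) l + sA c (?f k (l + 1))) ?g m n"
    by simp
  also have "\<dots> = conv (\<lambda>k l. ?f (k + 1) l) ?g m n + sC c (conv (\<lambda>k l. ?f k (l + 1)) ?g m n)"
    using truncated_shift[OF tr(1), of 1 0] truncated_shift[OF tr(1), of 0 1] tr(2)
    by (intro conv_lincomb_left) simp_all
  also have "\<dots> = conv ?f ?g (m + 1) n + sC c (conv ?f ?g m (n + 1))"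
    using conv_shift[of ?f 1 0 ?g m n] conv_shift[of ?f 0 1 ?g m n] by simp
  also have "\<dots> = zwres c sC (conv f g) m n (int (Suc r) + int r')"
    using Suc[of "m + 1" n] Suc[of m "n + 1"]
      C.zwres_pascal[OF truncated_conv[OF f g], of c m n "int r + int r'"]
    by (simp add: add.commute add.assoc add.left_commute)
  finally show ?case .
qed

text \<open>
  Expansion of \<open>(z + c w)^r\<close> for all \<open>r\<close> at once is the substitution \<open>z \<mapsto> z + c w\<close>, hence
  multiplicative; on coefficients this is Vandermonde's identity.
\<close>

lemma conv_zwres_first:
  assumes f: "truncated f" and g: "truncated g"
  shows "conv (\<lambda>r n. zwres c sA f m n r) (\<lambda>r n. zwres c sB g m' n r) r n
    = zwres c sC (conv f g) (m + m') n r"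
proof -
  obtain N N' where N: "\<forall>n\<ge>N. \<forall>m. f m n = 0" "\<forall>n\<ge>N'. \<forall>m. g m n = 0"
    using truncatedD1[OF f] truncatedD1[OF g] by blast
  define S where "S = (\<lambda>I (x, y). T (f x y) (g (m + m' + r - int I - x - 1) (n + int I - y - 1)))"
  define a where "a = (\<lambda>i j x. c ^ (i + j) * ((of_int (x - m + int i) gchoose i)
    * (of_int (r - 1 - x + m - int i) gchoose j)))"
  define t where "t = (\<lambda>(p::int \<times> int) (i::nat, j::nat). sC (a i j (fst p)) (S (i + j) p))"
  have finS: "finite {p. S I p \<noteq> 0}" for I
    unfolding S_def using finite_conv[OF f g, of "m + m' + r - int I" "n + int I"]
    by (simp add: algebra_simps)
  have S0: "S I p = 0" if "int I \<ge> N + N' - n" for I p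
  proof (cases p)
    case (Pair x y)
    have "y \<ge> N \<or> n + int I - y - 1 \<ge> N'" using that by linarith
    then show ?thesis using N by (auto simp: S_def Pair)
  qed
  let ?K = "{..nat (N + N' - n)}"
  have fint: "finite {q. case_prod t q \<noteq> 0}"
  proof (rule finite_support_slices(2)[of "?K \<times> ?K"])
    show "t p q = 0" if "q \<notin> ?K \<times> ?K" for q p
    proof -
      obtain i j where q: "q = (i, j)" by (cases q)
      have "int (i + j) \<ge> N + N' - n" using that unfolding q by auto
      then show ?thesis using S0 by (simp add: t_def q)
    qed
    show "finite {p. t p q \<noteq> 0}" for q
      by (rule finite_subset[OF _ finS[of "fst q + snd q"]]) (auto simp: t_def split_beta)
  qed simp
  \<comment> \<open>The sum is reindexed by the arguments (x, y) = (m + k - i, l + i) of f. The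
    arguments of g then depend on i and j only through i + j, so that summing over i with i + j = I
    fixed touches nothing but the coefficients \<open>a\<close>.\<close>
  define \<phi> where "\<phi> = (\<lambda>((k::int, l::int), (i::nat, j::nat)). ((m + k - int i, l + int i), (i, j)))"
  have bij: "bij \<phi>" unfolding \<phi>_def
    by (rule bij_betw_byWitness[where f' = "\<lambda>((x, y), (i, j)). ((x - m + int i, y - int i), (i, j))"]) auto
  let ?t' = "\<lambda>p q. case_prod t (\<phi> (p, q))"
  have fint': "finite {q. case_prod ?t' q \<noteq> 0}"
  proof -
    have "{q. case_prod ?t' q \<noteq> 0} = \<phi> -` {q. case_prod t q \<noteq> 0}"
      by (rule set_eqI) (simp only: vimage_def mem_Collect_eq case_prod_unfold prod.collapse)
    then show ?thesis using finite_vimageI[OF fint bij_is_inj[OF bij]] by simp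
  qed
  have 1: "T (zwres c sA f m l k) (zwres c sB g m' (n - l - 1) (r - k - 1)) = Sum_any (\<lambda>q. ?t' (k, l) q)" for k l
  proof -
    have "T (zwres c sA f m l k) (zwres c sB g m' (n - l - 1) (r - k - 1))
      = Sum_any (\<lambda>(i, j). T (sA (c ^ i * (of_int k gchoose i)) (f (m + k - int i) (l + int i)))
          (sB (c ^ j * (of_int (r - k - 1) gchoose j)) (g (m' + (r - k - 1) - int j) (n - l - 1 + int j))))"
      unfolding zwres_def
      by (rule T_Sum_any) (rule A.finite_zwres[OF f], rule B.finite_zwres[OF g])
    also have "\<dots> = Sum_any (\<lambda>q. ?t' (k, l) q)"
      by (rule Sum_any.cong)
        (auto simp: \<phi>_def t_def S_def a_def T_scale_left T_scale_right power_add algebra_simps)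
    finally show ?thesis .
  qed
  have "conv (\<lambda>r n. zwres c sA f m n r) (\<lambda>r n. zwres c sB g m' n r) r n
      = Sum_any (\<lambda>(k, l). T (zwres c sA f m l k) (zwres c sB g m' (n - l - 1) (r - k - 1)))"
    by (simp add: conv_def)
  also have "\<dots> = Sum_any (\<lambda>p. Sum_any (\<lambda>q. ?t' p q))"
    by (rule Sum_any.cong) (use 1 in auto)
  also have "\<dots> = Sum_any (\<lambda>(p, q). ?t' p q)"
    by (rule Sum_any_flatten[OF fint'])
  also have "\<dots> = Sum_any (\<lambda>u. case_prod t (\<phi> u))"
    by (rule Sum_any.cong) auto
  also have "\<dots> = Sum_any (\<lambda>(p, q). t p q)"
    by (rule Sum_any_reindex_bij[OF bij])
  also have "\<dots> = Sum_any (\<lambda>p. Sum_any (\<lambda>q. t p q))"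
    by (rule Sum_any_flatten[OF fint, symmetric])
  also have "\<dots> = Sum_any (\<lambda>p. Sum_any (\<lambda>I. \<Sum>i\<le>I. t p (i, I - i)))"
  proof (rule Sum_any.cong)
    fix p
    have "{q. t p q \<noteq> 0} = Pair p -` {q. case_prod t q \<noteq> 0}" by auto
    then have "finite {q. t p q \<noteq> 0}" using finite_vimageI[OF fint, of "Pair p"] by (simp add: inj_def)
    then have "finite {q. case_prod (\<lambda>i j. t p (i, j)) q \<noteq> 0}" by simp
    from Sum_any_antidiagonal[OF this] show "Sum_any (t p) = Sum_any (\<lambda>I. \<Sum>i\<le>I. t p (i, I - i))"
      by simp
  qed
  also have "\<dots> = Sum_any (\<lambda>p. Sum_any (\<lambda>I. sC (c ^ I * (of_int r gchoose I)) (S I p)))"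
  proof (intro Sum_any.cong)
    fix p :: "int \<times> int" and I :: nat
    have "(\<Sum>i\<le>I. t p (i, I - i)) = sC (\<Sum>i\<le>I. a i (I - i) (fst p)) (S I p)"
      unfolding C.scale_sum_left by (rule sum.cong) (auto simp: t_def)
    also have "(\<Sum>i\<le>I. a i (I - i) (fst p)) = c ^ I * (of_int r gchoose I)"
    proof -
      \<comment> \<open>The sum of binomials (X + i choose i) (r - 1 - X - i choose I - i) has i in
        its upper arguments. Negating them gives -X - 1 and I + X - r, both free of i, and the
        ordinary Vandermonde identity applies.\<close>
      define X :: complex where "X = of_int (fst p - m)"
      have 1: "(X + of_nat i gchoose i) = (- 1) ^ i * (- X - 1 gchoose i)" for i
        using gbinomial_negated_upper[of "X + of_nat i" i] by simp
      have 2: "(of_int r - 1 - X - of_nat i gchoose (I - i))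
        = (- 1) ^ (I - i) * (of_nat I + (X - of_int r) gchoose (I - i))" if "i \<le> I" for i
        using gbinomial_negated_upper[of "of_int r - 1 - X - of_nat i" "I - i"] that
        by (simp add: of_nat_diff)
      have "(\<Sum>i\<le>I. a i (I - i) (fst p))
        = (\<Sum>i\<le>I. c ^ I * ((- 1) ^ I * ((- X - 1 gchoose i) * (of_nat I + (X - of_int r) gchoose (I - i)))))"
      proof (rule sum.cong)
        fix i assume "i \<in> {..I}"
        then have i: "i \<le> I" by simp
        have s: "(- 1 :: complex) ^ i * (- 1) ^ (I - i) = (- 1) ^ I"
          using i by (simp flip: power_add)
        have "a i (I - i) (fst p) = c ^ I * ((X + of_nat i gchoose i) * (of_int r - 1 - X - of_nat i gchoose (I - i)))"
          using i by (simp add: a_def X_def algebra_simps)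
        also have "\<dots> = c ^ I * ((- 1) ^ i * (- 1) ^ (I - i) * ((- X - 1 gchoose i) * (of_nat I + (X - of_int r) gchoose (I - i))))"
          unfolding 1 2[OF i] by (simp add: mult_ac)
        finally show "a i (I - i) (fst p) = c ^ I * ((- 1) ^ I * ((- X - 1 gchoose i) * (of_nat I + (X - of_int r) gchoose (I - i))))"
          unfolding s .
      qed simp
      also have "\<dots> = c ^ I * ((- 1) ^ I * (\<Sum>i=0..I. (- X - 1 gchoose i) * (of_nat I + (X - of_int r) gchoose (I - i))))"
        by (simp add: sum_distrib_left atLeast0AtMost)
      also have "\<dots> = c ^ I * ((- 1) ^ I * (of_nat I - of_int r - 1 gchoose I))"
        by (subst gbinomial_Vandermonde) (simp add: algebra_simps)
      also have "\<dots> = c ^ I * (of_int r gchoose I)"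
        by (subst (2) gbinomial_negated_upper) (simp flip: power_add mult.assoc)
      finally show ?thesis .
    qed
    finally show "(\<Sum>i\<le>I. t p (i, I - i)) = sC (c ^ I * (of_int r gchoose I)) (S I p)" .
  qed
  also have "\<dots> = Sum_any (\<lambda>I. Sum_any (\<lambda>p. sC (c ^ I * (of_int r gchoose I)) (S I p)))"
  proof -
    let ?u = "\<lambda>p I. sC (c ^ I * (of_int r gchoose I)) (S I p)"
    have "finite {q. case_prod ?u q \<noteq> 0}"
    proof (rule finite_support_slices(2)[of "?K"])
      show "?u p I = 0" if "I \<notin> ?K" for I p
        using that S0[of I p] by (simp add: nat_le_iff)
      show "finite {p. ?u p I \<noteq> 0}" for I
        by (rule finite_subset[OF _ finS[of I]]) auto
    qed simp
    from Sum_any_flatten[OF this] Sum_any_flatten_swap[OF this] show ?thesis by simp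
  qed
  also have "\<dots> = zwres c sC (conv f g) (m + m') n r"
    unfolding zwres_def
  proof (rule Sum_any.cong)
    fix I
    have "Sum_any (\<lambda>p. S I p) = conv f g (m + m' + r - int I) (n + int I)"
      by (simp add: conv_def S_def)
    then show "Sum_any (\<lambda>p. sC (c ^ I * (of_int r gchoose I)) (S I p))
      = sC (c ^ I * (of_int r gchoose I)) (conv f g (m + m' + r - int I) (n + int I))"
      by (simp only: C.scale_Sum_any[OF finS, symmetric])
  qed
  finally show ?thesis .
qed

end

text \<open>
  \<open>p m n\<close>, \<open>q m n\<close> and \<open>h r n\<close> stand for \<open>a\<^sub>m b\<^sub>n u\<close>, \<open>\<plusminus> b\<^sub>n a\<^sub>m u\<close> and \<open>(a\<^sub>r b)\<^sub>n u\<close>; the equation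
  is the Borcherds identity.
\<close>

definition borcherds_triple ::
  "(complex \<Rightarrow> 'm::ab_group_add \<Rightarrow> 'm) \<Rightarrow> (int \<Rightarrow> int \<Rightarrow> 'm) \<Rightarrow> (int \<Rightarrow> int \<Rightarrow> 'm) \<Rightarrow> (int \<Rightarrow> int \<Rightarrow> 'm) \<Rightarrow> bool"
  where
  "borcherds_triple s p q h \<longleftrightarrow>
     truncated p \<and> truncated (swap2 q) \<and> truncated (swap2 h) \<and>
     (\<forall>m n r. zwres 1 s (swap2 h) n r m =
        zwres (-1) s p m n r - s ((-1) powi r) (zwres (-1) s (swap2 q) n m r))"

context pairing
begin

text \<open>
  All three terms \<open>X(m,n,r)\<close> of the identity satisfy \<open>X(m+1,n,r) = X(m,n+1,r) + X(m,n,r+1)\<close>, so the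
  identity follows from its cases \<open>r \<ge> R\<close> (locality) and \<open>m \<ge> M\<close> (associativity), where one of the
  three terms vanishes and the other two are multiplicative.
\<close>

theorem borcherds_triple_conv:
  assumes bA: "borcherds_triple sA p q h" and bB: "borcherds_triple sB p' q' h'"
  shows "borcherds_triple sC (conv p p') (conv q q') (conv h h')"
proof -
  note tA = bA[unfolded borcherds_triple_def, THEN conjunct1]
    bA[unfolded borcherds_triple_def, THEN conjunct2, THEN conjunct1]
    bA[unfolded borcherds_triple_def, THEN conjunct2, THEN conjunct2, THEN conjunct1]
  note tB = bB[unfolded borcherds_triple_def, THEN conjunct1]
    bB[unfolded borcherds_triple_def, THEN conjunct2, THEN conjunct1]
    bB[unfolded borcherds_triple_def, THEN conjunct2, THEN conjunct2, THEN conjunct1]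
  have eqA: "zwres 1 sA (swap2 h) n r m =
      zwres (-1) sA p m n r - sA ((-1) powi r) (zwres (-1) sA (swap2 q) n m r)" for m n r
    using bA unfolding borcherds_triple_def by blast
  have eqB: "zwres 1 sB (swap2 h') n r m =
      zwres (-1) sB p' m n r - sB ((-1) powi r) (zwres (-1) sB (swap2 q') n m r)" for m n r
    using bB unfolding borcherds_triple_def by blast
  have swap: "swap2 (conv f f') = conv (swap2 f) (swap2 f')" for f f'
    by (intro ext) (rule conv_swap[symmetric])
  have tp: "truncated (conv p p')" by (rule truncated_conv[OF tA(1) tB(1)])
  have tq: "truncated (swap2 (conv q q'))"
    unfolding swap by (rule truncated_conv[OF tA(2) tB(2)])
  have th: "truncated (swap2 (conv h h'))"
    unfolding swap by (rule truncated_conv[OF tA(3) tB(3)])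
  define D where "D m n r = zwres 1 sC (swap2 (conv h h')) n r m - zwres (-1) sC (conv p p') m n r
    + sC ((-1) powi r) (zwres (-1) sC (swap2 (conv q q')) n m r)" for m n r
  have rec: "D (m + 1) n r = D m (n + 1) r + D m n (r + 1)" for m n r
  proof -
    have sgn: "(-1 :: complex) powi (r + 1) = - ((-1) powi r)"
      by (simp add: power_int_add)
    have h: "zwres 1 sC (swap2 (conv h h')) n r (m + 1)
      = zwres 1 sC (swap2 (conv h h')) (n + 1) r m + zwres 1 sC (swap2 (conv h h')) n (r + 1) m"
      using C.zwres_pascal[OF th, of 1 n r m] by simp
    have p: "zwres (-1) sC (conv p p') (m + 1) n r
      = zwres (-1) sC (conv p p') m n (r + 1) + zwres (-1) sC (conv p p') m (n + 1) r"
      using C.zwres_pascal[OF tp, of "-1" m n r] by simp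
    have q: "zwres (-1) sC (swap2 (conv q q')) (n + 1) m r
      = zwres (-1) sC (swap2 (conv q q')) n m (r + 1) + zwres (-1) sC (swap2 (conv q q')) n (m + 1) r"
      using C.zwres_pascal[OF tq, of "-1" n m r] by simp
    show ?thesis
      unfolding D_def sgn h p q by (simp add: C.scale_right_distrib)
  qed
  obtain R where R: "\<forall>r\<ge>R. \<forall>n. h r n = 0" using truncatedD1[OF tA(3)] by blast
  obtain R' where R': "\<forall>r\<ge>R'. \<forall>n. h' r n = 0" using truncatedD1[OF tB(3)] by blast
  obtain R2 where R2: "\<forall>r\<ge>R2. \<forall>n. conv h h' r n = 0" using truncatedD1[OF th] by blast
  have locA: "zwres (-1) sA p m n r = sA ((-1) powi r) (zwres (-1) sA (swap2 q) n m r)" if "r \<ge> R" for m n r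
    using eqA[of n r m] R that by (simp add: zwres_def)
  have locB: "zwres (-1) sB p' m n r = sB ((-1) powi r) (zwres (-1) sB (swap2 q') n m r)" if "r \<ge> R'" for m n r
    using eqB[of n r m] R' that by (simp add: zwres_def)
  have local: "D m n r = 0" if r: "r \<ge> max R2 (int (nat R) + int (nat R'))" for m n r
  proof -
    \<comment> \<open>The exponent r is split so that each factor receives at least its own order of
      locality, beyond which its third series vanishes.\<close>
    define r2 where "r2 = nat (r - int (nat R))"
    have rr: "r = int (nat R) + int r2" "int r2 \<ge> R'" "int (nat R) \<ge> R" using r unfolding r2_def by linarith+
    let ?fA = "\<lambda>k l. zwres (-1) sA (swap2 q) k l (int (nat R))"
    let ?fB = "\<lambda>k l. zwres (-1) sB (swap2 q') k l (int r2)"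
    have tf: "truncated ?fA" "truncated ?fB"
      by (rule A.truncated_zwres(1)[OF tA(2)], rule B.truncated_zwres(1)[OF tB(2)])
    have "zwres (-1) sC (conv p p') m n r
      = conv (\<lambda>k l. zwres (-1) sA p k l (int (nat R))) (\<lambda>k l. zwres (-1) sB p' k l (int r2)) m n"
      unfolding rr(1) by (rule conv_zwres_nat[OF tA(1) tB(1), symmetric])
    also have "\<dots> = conv (swap2 (\<lambda>k l. sA ((-1) powi int (nat R)) (?fA k l)))
        (swap2 (\<lambda>k l. sB ((-1) powi int r2) (?fB k l))) m n"
      using locA[OF rr(3)] locB[OF rr(2)] by simp
    also have "\<dots> = conv (\<lambda>k l. sA ((-1) powi int (nat R)) (?fA k l)) (\<lambda>k l. sB ((-1) powi int r2) (?fB k l)) n m"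
      by (rule conv_swap)
    also have "\<dots> = sC ((-1) powi int (nat R)) (conv ?fA (\<lambda>k l. sB ((-1) powi int r2) (?fB k l)) n m)"
      by (rule conv_scale_left[OF tf(1) truncated_hom[OF tf(2)]]) simp
    also have "conv ?fA (\<lambda>k l. sB ((-1) powi int r2) (?fB k l)) n m = sC ((-1) powi int r2) (conv ?fA ?fB n m)"
      by (rule conv_scale_right[OF tf])
    also have "conv ?fA ?fB n m = zwres (-1) sC (swap2 (conv q q')) n m r"
      unfolding rr(1) swap by (rule conv_zwres_nat[OF tA(2) tB(2)])
    also have "sC ((-1) powi int (nat R)) (sC ((-1) powi int r2) (zwres (-1) sC (swap2 (conv q q')) n m r))
      = sC ((-1) powi r) (zwres (-1) sC (swap2 (conv q q')) n m r)"
      unfolding rr(1) by (simp add: power_int_add)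
    finally have "zwres (-1) sC (conv p p') m n r = sC ((-1) powi r) (zwres (-1) sC (swap2 (conv q q')) n m r)" .
    moreover have "zwres 1 sC (swap2 (conv h h')) n r m = 0"
      using R2 r by (simp add: zwres_def)
    ultimately show ?thesis by (simp add: D_def)
  qed
  obtain M where M: "\<forall>m\<ge>M. \<forall>n. q m n = 0" using truncatedD1[OF tA(2)] by blast
  obtain M' where M': "\<forall>m\<ge>M'. \<forall>n. q' m n = 0" using truncatedD1[OF tB(2)] by blast
  obtain M2 where M2: "\<forall>m\<ge>M2. \<forall>n. conv q q' m n = 0" using truncatedD1[OF tq] by blast
  have assA: "zwres 1 sA (swap2 h) n r m = zwres (-1) sA p m n r" if "m \<ge> M" for m n r
    using eqA[of n r m] M that by (simp add: zwres_def)
  have assB: "zwres 1 sB (swap2 h') n r m = zwres (-1) sB p' m n r" if "m \<ge> M'" for m n r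
    using eqB[of n r m] M' that by (simp add: zwres_def)
  have assoc: "D m n r = 0" if m: "m \<ge> max M2 (int (nat M) + int (nat M'))" for m n r
  proof -
    \<comment> \<open>The same splitting for m: each factor receives an exponent for which the term
      with \<open>q\<close> drops out of its identity.\<close>
    define m2 where "m2 = nat (m - int (nat M))"
    have mm: "m = int (nat M) + int m2" "int m2 \<ge> M'" "int (nat M) \<ge> M" using m unfolding m2_def by linarith+
    have "zwres 1 sC (swap2 (conv h h')) n r m
      = conv (\<lambda>k l. zwres 1 sA (swap2 h) k l (int (nat M))) (\<lambda>k l. zwres 1 sB (swap2 h') k l (int m2)) n r"
      unfolding mm(1) swap by (rule conv_zwres_nat[OF tA(3) tB(3), symmetric])
    also have "\<dots> = conv (swap2 (\<lambda>l k. zwres (-1) sA p (int (nat M)) k l)) (swap2 (\<lambda>l k. zwres (-1) sB p' (int m2) k l)) n r"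
      using assA[OF mm(3)] assB[OF mm(2)] by simp
    also have "\<dots> = conv (\<lambda>l k. zwres (-1) sA p (int (nat M)) k l) (\<lambda>l k. zwres (-1) sB p' (int m2) k l) r n"
      by (rule conv_swap)
    also have "\<dots> = zwres (-1) sC (conv p p') m n r"
      unfolding mm(1) by (rule conv_zwres_first[OF tA(1) tB(1)])
    finally have "zwres 1 sC (swap2 (conv h h')) n r m = zwres (-1) sC (conv p p') m n r" .
    moreover have "zwres (-1) sC (swap2 (conv q q')) n m r = 0"
      using M2 m by (simp add: zwres_def)
    ultimately show ?thesis by (simp add: D_def)
  qed
  \<comment> \<open>Descent in r from the local range. Once D vanishes at r + 1, \<open>rec\<close>
    reads D (m + 1) n r = D m (n + 1) r, and an inner descent in m from the associative range
    settles level r.\<close>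
  have D0: "D m n r = 0" if "r \<ge> max R2 (int (nat R) + int (nat R')) - int t" for m n r t
    using that
  proof (induction t arbitrary: m n r)
    case 0
    then show ?case using local by simp
  next
    case (Suc t)
    have r1: "D m n (r + 1) = 0" for m n using Suc by (intro Suc.IH) auto
    have D0: "D m n r = 0" if "m \<ge> max M2 (int (nat M) + int (nat M')) - int t" for m n t
      using that
    proof (induction t arbitrary: m n)
      case 0
      then show ?case using assoc by simp
    next
      case (Suc t)
      then have "D (m + 1) (n - 1) r = 0" by (intro Suc.IH) auto
      then show ?case using rec[of m "n - 1" r] r1 by simp
    qed
    show ?case
      by (rule D0[where t = "nat (max M2 (int (nat M) + int (nat M')) - m)"]) linarith
  qed
  have "D m n r = 0" for m n r
    by (rule D0[where t = "nat (max R2 (int (nat R) + int (nat R')) - r)"]) linarith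
  then have "zwres 1 sC (swap2 (conv h h')) n r m =
        zwres (-1) sC (conv p p') m n r - sC ((-1) powi r) (zwres (-1) sC (swap2 (conv q q')) n m r)" for m n r
    using D_def[of m n r] by (simp add: algebra_simps)
  then show ?thesis unfolding borcherds_triple_def using tp tq th by blast
qed

end

context complex_space
begin

lemma borcherds_triple_zero: "borcherds_triple scale (\<lambda>m n. 0) (\<lambda>m n. 0) (\<lambda>m n. 0)"
  by (simp add: borcherds_triple_def truncated_zero zwres_def)

lemma zwres_add:
  assumes "truncated f" "truncated g"
  shows "zwres c scale (\<lambda>m n. f m n + g m n) m n r = zwres c scale f m n r + zwres c scale g m n r"
  unfolding zwres_def scale_right_distrib
  by (rule Sum_any.distrib[OF finite_zwres[OF assms(1)] finite_zwres[OF assms(2)]])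

lemma zwres_scale:
  assumes "truncated f"
  shows "zwres c scale (\<lambda>m n. scale d (f m n)) m n r = scale d (zwres c scale f m n r)"
  unfolding zwres_def
  by (subst scale_Sum_any[OF finite_zwres[OF assms]]) (simp add: mult.commute)

lemma borcherds_triple_add:
  assumes "borcherds_triple scale p q h" "borcherds_triple scale p' q' h'"
  shows "borcherds_triple scale (\<lambda>m n. p m n + p' m n) (\<lambda>m n. q m n + q' m n) (\<lambda>m n. h m n + h' m n)"
  using assms
  by (simp add: borcherds_triple_def truncated_add zwres_add scale_right_distrib)

lemma truncated_scale: "truncated f \<Longrightarrow> truncated (\<lambda>m n. scale c (f m n))"
  by (erule truncated_hom) simp

lemma borcherds_triple_scale:
  assumes "borcherds_triple scale p q h"
  shows "borcherds_triple scale (\<lambda>m n. scale c (p m n)) (\<lambda>m n. scale c (q m n)) (\<lambda>m n. scale c (h m n))"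
  using assms
  by (simp add: borcherds_triple_def truncated_scale zwres_scale scale_right_diff_distrib mult.commute)

lemma borcherds_triple_sum:
  assumes "finite S" "\<And>x. x \<in> S \<Longrightarrow> borcherds_triple scale (p x) (q x) (h x)"
  shows "borcherds_triple scale (\<lambda>m n. \<Sum>x\<in>S. p x m n) (\<lambda>m n. \<Sum>x\<in>S. q x m n) (\<lambda>m n. \<Sum>x\<in>S. h x m n)"
  using assms by (induction) (simp_all add: borcherds_triple_zero borcherds_triple_add)

text \<open>Bridge to the last clause of \<open>vertex_module\<close>. The sign for exchanging two
  odd fields becomes a scalar \<open>e\<close> on the second series, so that the convolution theorem
  need not know about parity.\<close>

lemma borcherds_triple_iff:
  assumes "truncated p" "truncated (swap2 q)" "truncated (swap2 h)"
  shows "borcherds_triple scale p (\<lambda>m n. scale e (q m n)) h \<longleftrightarrow>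
    (\<forall>m n r. (Sum_any (\<lambda>i. scale (of_int m gchoose i) (h (r + int i) (m + n - int i)))) =
      (Sum_any (\<lambda>i. scale ((-1) ^ i * (of_int r gchoose i))
        (p (m + r - int i) (n + int i) - scale ((-1) powi r * e) (q (m + int i) (n + r - int i))))))"
proof -
  have te: "truncated (swap2 (\<lambda>m n. scale e (q m n)))"
    using truncated_hom[OF assms(2), of "scale e"] by simp
  have 1: "zwres 1 scale (swap2 h) n r m = Sum_any (\<lambda>i. scale (of_int m gchoose i) (h (r + int i) (m + n - int i)))" for m n r
    by (simp add: zwres_def algebra_simps)
  have 2: "zwres (-1) scale p m n r - scale ((-1) powi r) (zwres (-1) scale (swap2 (\<lambda>m n. scale e (q m n))) n m r)
    = Sum_any (\<lambda>i. scale ((-1) ^ i * (of_int r gchoose i))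
        (p (m + r - int i) (n + int i) - scale ((-1) powi r * e) (q (m + int i) (n + r - int i))))" for m n r
  proof -
    let ?u = "\<lambda>i. scale ((-1) ^ i * (of_int r gchoose i)) (scale e (q (m + int i) (n + r - int i)))"
    have fu: "finite {i. ?u i \<noteq> 0}" using finite_zwres[OF te] by simp
    then have fu': "finite {i. scale ((-1) powi r) (?u i) \<noteq> 0}"
      by (rule rev_finite_subset) auto
    have "zwres (-1) scale p m n r - scale ((-1) powi r) (zwres (-1) scale (swap2 (\<lambda>m n. scale e (q m n))) n m r)
      = Sum_any (\<lambda>i. scale ((-1) ^ i * (of_int r gchoose i)) (p (m + r - int i) (n + int i)) - scale ((-1) powi r) (?u i))"
      unfolding zwres_def
      by (subst scale_Sum_any[OF fu], subst Sum_any_diff[OF finite_zwres[OF assms(1)] fu']) simp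
    also have "\<dots> = Sum_any (\<lambda>i. scale ((-1) ^ i * (of_int r gchoose i))
        (p (m + r - int i) (n + int i) - scale ((-1) powi r * e) (q (m + int i) (n + r - int i))))"
      by (rule Sum_any.cong) (simp add: scale_right_diff_distrib mult_ac)
    finally show ?thesis .
  qed
  show ?thesis
    unfolding borcherds_triple_def 1 2 using assms te by simp
qed

end

section \<open>Tensor products of modes\<close>

abbreviation lookup :: "('i \<Rightarrow>\<^sub>0 'm::zero) \<Rightarrow> 'i \<Rightarrow> 'm" where
  "lookup \<equiv> Poly_Mapping.lookup"

abbreviation single :: "'i \<Rightarrow> 'm \<Rightarrow> ('i \<Rightarrow>\<^sub>0 'm::zero)" where
  "single \<equiv> Poly_Mapping.single"

abbreviation keys :: "('i \<Rightarrow>\<^sub>0 'm::zero) \<Rightarrow> 'i set" where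
  "keys \<equiv> Poly_Mapping.keys"

lemma lookup_map: "f 0 = 0 \<Longrightarrow> lookup (Poly_Mapping.map f x) i = f (lookup x i)"
  by (simp add: Poly_Mapping.map.rep_eq when_def)

lemma lookup_sum_keys:
  assumes "\<And>i. lookup x i = 0 \<Longrightarrow> f i = 0"
  shows "lookup (\<Sum>i\<in>keys x. single i (f i)) k = f k"
proof -
  have "lookup (\<Sum>i\<in>keys x. single i (f i)) k = (\<Sum>i\<in>keys x. if k = i then f i else 0)"
    by (auto simp: lookup_sum lookup_single when_def intro!: sum.cong)
  then show ?thesis by (simp add: in_keys_iff assms)
qed

lemma sum_single_lookup: "(\<Sum>i\<in>keys x. single i (lookup x i)) = x"
  by (rule poly_mapping_eqI) (rule lookup_sum_keys)

lemma lookup_Sum_any: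
  assumes "finite {i. f i \<noteq> 0}"
  shows "lookup (Sum_any f) k = Sum_any (\<lambda>i. lookup (f i) k)"
  by (rule Sum_any_hom[OF _ _ assms]) (simp_all add: lookup_add)

context complex_space
begin

lemma lookup_fscale [simp]: "lookup (fscale scale c x) i = scale c (lookup x i)"
  by (simp add: fscale_def lookup_map)

lemma complex_space_fscale: "complex_space (fscale scale)"
  by unfold_locales (auto intro!: poly_mapping_eqI simp: lookup_add scale_right_distrib scale_left_distrib)

lemma lookup_tens [simp]: "lookup (tens scale a b) i = scale (lookup b i) a"
  by (simp add: tens_def lookup_map)

lemma tens_single [simp]: "tens scale a (single i c) = single i (scale c a)"
  by (rule poly_mapping_eqI) (simp add: lookup_single when_def)

lemma fscale_single [simp]: "fscale scale c (single i a) = single i (scale c a)"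
  by (rule poly_mapping_eqI) (simp add: lookup_single when_def)

end

lemma complex_space_mult: "complex_space ((*) :: complex \<Rightarrow> complex \<Rightarrow> complex)"
  by unfold_locales (auto simp: algebra_simps)

interpretation cmult: complex_space "(*) :: complex \<Rightarrow> complex \<Rightarrow> complex"
  by (rule complex_space_mult)

interpretation cscale: complex_space "cscale :: complex \<Rightarrow> ('i \<Rightarrow>\<^sub>0 complex) \<Rightarrow> ('i \<Rightarrow>\<^sub>0 complex)"
  by (rule cmult.complex_space_fscale)

lemma (in complex_space) pairing_tens:
  "pairing scale (cscale :: complex \<Rightarrow> ('i \<Rightarrow>\<^sub>0 complex) \<Rightarrow> ('i \<Rightarrow>\<^sub>0 complex)) (fscale scale) (tens scale)"
proof -
  interpret C: complex_space "fscale scale" by (rule complex_space_fscale)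
  show ?thesis
    by unfold_locales
      (auto intro!: poly_mapping_eqI simp: lookup_add scale_right_distrib scale_left_distrib mult.commute)
qed

text \<open>Agreement is asked only on basis vectors in the support of b: in \<open>TM_tens\<close>
  the parity is known only there.\<close>

lemma linear_ext_keys:
  fixes s :: "complex \<Rightarrow> 'm::ab_group_add \<Rightarrow> 'm"
  assumes "\<And>x y. \<phi> (x + y) = \<phi> x + \<phi> y" "\<And>c x. \<phi> (cscale c x) = s c (\<phi> x)"
    and "\<And>x y. \<psi> (x + y) = \<psi> x + \<psi> y" "\<And>c x. \<psi> (cscale c x) = s c (\<psi> x)"
    and eq: "\<And>i. i \<in> keys b \<Longrightarrow> \<phi> (single i 1) = \<psi> (single i 1)"
  shows "\<phi> b = \<psi> b"
proof -
  have 0: "\<phi> 0 = 0" "\<psi> 0 = 0" using assms(1)[of 0 0] assms(3)[of 0 0] by simp_all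
  have "\<phi> (\<Sum>i\<in>S. cscale (lookup b i) (single i 1)) = \<psi> (\<Sum>i\<in>S. cscale (lookup b i) (single i 1))"
    if "finite S" "S \<subseteq> keys b" for S
    using that by induction (simp_all add: 0 assms(1-4) eq del: cmult.fscale_single)
  from this[of "keys b"] show ?thesis
    by (simp add: sum_single_lookup)
qed

text \<open>For a subspace A of the left factor this is the tensor product of A with the whole right
  factor, in coordinates.\<close>

definition comp_space :: "'a::zero set \<Rightarrow> ('i \<Rightarrow>\<^sub>0 'a) set" where
  "comp_space A = {x. \<forall>i. lookup x i \<in> A}"

lemma (in complex_space) subspace_comp_space_of:
  assumes "subspace A"
  shows "module.subspace (fscale scale) (comp_space A)"
proof -
  interpret F: complex_space "fscale scale" by (rule complex_space_fscale)
  show ?thesis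
    unfolding F.subspace_def
    using subspace_0[OF assms] subspace_add[OF assms] subspace_scale[OF assms]
    by (auto simp: comp_space_def lookup_add)
qed

text \<open>Linearity of the action is confined to a in A, since the modes of a module over a
  subalgebra carry no information outside it. The additivity lemmas therefore require elements of
  \<open>comp_space A\<close>.\<close>

locale tensor_modes = VA: complex_space sA + VM: complex_space sM
  for sA :: "complex \<Rightarrow> 'a::ab_group_add \<Rightarrow> 'a" and sM :: "complex \<Rightarrow> 'm::ab_group_add \<Rightarrow> 'm" +
  fixes A :: "'a set" and YM :: "'a \<Rightarrow> int \<Rightarrow> 'm \<Rightarrow> 'm" and par :: "'m \<Rightarrow> 'm"
    and B :: "('i \<Rightarrow>\<^sub>0 complex) vsa"
  assumes subspace_A: "VA.subspace A"
    and YM_add_right: "a \<in> A \<Longrightarrow> YM a n (u + w) = YM a n u + YM a n w"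
    and YM_scale_right: "a \<in> A \<Longrightarrow> YM a n (sM c u) = sM c (YM a n u)"
    and YM_add_left: "a \<in> A \<Longrightarrow> b \<in> A \<Longrightarrow> YM (a + b) n u = YM a n u + YM b n u"
    and YM_scale_left: "a \<in> A \<Longrightarrow> YM (sA c a) n u = sM c (YM a n u)"
    and YM_truncated: "a \<in> A \<Longrightarrow> \<exists>N. \<forall>n\<ge>N. YM a n u = 0"
    and par_add: "par (u + w) = par u + par w"
    and par_scale: "par (sM c u) = sM c (par u)"
    and B_truncated: "\<exists>N. \<forall>n\<ge>N. vmode B (single i 1) n (single j 1) = 0"
begin

sublocale FT: complex_space "fscale sM" by (rule VM.complex_space_fscale)

sublocale P: pairing sM "cscale :: complex \<Rightarrow> ('i \<Rightarrow>\<^sub>0 complex) \<Rightarrow> ('i \<Rightarrow>\<^sub>0 complex)" "fscale sM" "tens sM"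
  by (rule VM.pairing_tens)

abbreviation TM :: "('i \<Rightarrow>\<^sub>0 'a) \<Rightarrow> int \<Rightarrow> ('i \<Rightarrow>\<^sub>0 'm) \<Rightarrow> ('i \<Rightarrow>\<^sub>0 'm)" where
  "TM \<equiv> tensor_mode YM sM par B"

definition odd_basis :: "'i \<Rightarrow> bool" where
  "odd_basis i = homogeneous B True (single i 1)"

definition par_if :: "bool \<Rightarrow> 'm \<Rightarrow> 'm" where
  "par_if p u = (if p then par u else u)"

definition tm :: "'a \<Rightarrow> 'i \<Rightarrow> int \<Rightarrow> 'm \<Rightarrow> 'i \<Rightarrow> ('i \<Rightarrow>\<^sub>0 'm)" where
  "tm a i n u j = Sum_any (\<lambda>k. tens sM (YM a k (par_if (odd_basis i) u))
     (vmode B (single i 1) (n - k - 1) (single j 1)))"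

lemma TM_tm: "TM x n y = (\<Sum>i\<in>keys x. \<Sum>j\<in>keys y. tm (lookup x i) i n (lookup y j) j)"
  unfolding tensor_mode_def tm_def odd_basis_def par_if_def by (intro sum.cong refl Sum_any.cong) simp

lemma zero_in_A: "0 \<in> A"
  by (rule VA.subspace_0[OF subspace_A])

lemma YM_zero_left [simp]: "YM 0 n u = 0"
  using YM_add_left[OF zero_in_A zero_in_A, of n u] by simp

lemma YM_zero_right [simp]: "a \<in> A \<Longrightarrow> YM a n 0 = 0"
  using YM_add_right[of a n 0 0] by simp

lemma par_zero [simp]: "par 0 = 0"
  using par_add[of 0 0] by simp

lemma par_if_add: "par_if p (u + w) = par_if p u + par_if p w"
  by (simp add: par_if_def par_add)

lemma par_if_scale: "par_if p (sM c u) = sM c (par_if p u)"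
  by (simp add: par_if_def par_scale)

lemma par_if_zero [simp]: "par_if p 0 = 0"
  by (simp add: par_if_def)

lemma finite_two_sided:
  fixes g :: "int \<Rightarrow> 'i \<Rightarrow>\<^sub>0 complex"
  assumes a: "a \<in> A" and g: "\<exists>N. \<forall>n\<ge>N. g n = 0"
  shows "finite {k. tens sM (YM a k u) (g (n - k - 1)) \<noteq> 0}"
proof -
  obtain N N' where N: "\<forall>n\<ge>N. YM a n u = 0" "\<forall>n\<ge>N'. g n = 0" using YM_truncated[OF a] g by blast
  show ?thesis
  proof (rule finite_subset)
    show "{k. tens sM (YM a k u) (g (n - k - 1)) \<noteq> 0} \<subseteq> {n - 1 - N'..N}"
    proof
      fix k assume "k \<in> {k. tens sM (YM a k u) (g (n - k - 1)) \<noteq> 0}"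
      then have "YM a k u \<noteq> 0" "g (n - k - 1) \<noteq> 0" by auto
      then have "\<not> k \<ge> N" "\<not> n - k - 1 \<ge> N'" using N by blast+
      then show "k \<in> {n - 1 - N'..N}" by simp
    qed
  qed simp
qed

lemmas finite_tm = finite_two_sided[OF _ B_truncated]

lemma tm_add_left: "a \<in> A \<Longrightarrow> a' \<in> A \<Longrightarrow> tm (a + a') i n u j = tm a i n u j + tm a' i n u j"
  unfolding tm_def by (subst Sum_any.distrib[symmetric])
    (simp_all add: finite_tm YM_add_left P.T_add_left)

lemma tm_scale_left: "a \<in> A \<Longrightarrow> tm (sA c a) i n u j = fscale sM c (tm a i n u j)"
  unfolding tm_def by (subst FT.scale_Sum_any)
    (simp_all add: finite_tm YM_scale_left P.T_scale_left)

lemma tm_add_right: "a \<in> A \<Longrightarrow> tm a i n (u + u') j = tm a i n u j + tm a i n u' j"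
  unfolding tm_def by (subst Sum_any.distrib[symmetric])
    (simp_all add: finite_tm YM_add_right P.T_add_left par_if_add)

lemma tm_scale_right: "a \<in> A \<Longrightarrow> tm a i n (sM c u) j = fscale sM c (tm a i n u j)"
  unfolding tm_def by (subst FT.scale_Sum_any)
    (simp_all add: finite_tm YM_scale_right P.T_scale_left par_if_scale)

lemma tm_zero_left [simp]: "tm 0 i n u j = 0"
  by (simp add: tm_def)

lemma tm_zero_right [simp]: "a \<in> A \<Longrightarrow> tm a i n 0 j = 0"
  by (simp add: tm_def)

lemma lookup_in_A: "x \<in> comp_space A \<Longrightarrow> lookup x i \<in> A"
  by (simp add: comp_space_def)

lemma TM_superset:
  assumes "x \<in> comp_space A" "finite I" "keys x \<subseteq> I" "finite J" "keys y \<subseteq> J"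
  shows "TM x n y = (\<Sum>i\<in>I. \<Sum>j\<in>J. tm (lookup x i) i n (lookup y j) j)"
proof -
  have "TM x n y = (\<Sum>i\<in>keys x. \<Sum>j\<in>J. tm (lookup x i) i n (lookup y j) j)"
    unfolding TM_tm using assms
    by (intro sum.cong refl sum.mono_neutral_left) (auto simp: in_keys_iff lookup_in_A)
  also have "\<dots> = (\<Sum>i\<in>I. \<Sum>j\<in>J. tm (lookup x i) i n (lookup y j) j)"
    using assms by (intro sum.mono_neutral_left) (auto simp: in_keys_iff)
  finally show ?thesis .
qed

lemma TM_add_left:
  assumes "x \<in> comp_space A" "x' \<in> comp_space A"
  shows "TM (x + x') n y = TM x n y + TM x' n y"
proof -
  have x: "x + x' \<in> comp_space A"
    using assms VA.subspace_add[OF subspace_A] by (simp add: comp_space_def lookup_add)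
  let ?I = "keys x \<union> keys x'" and ?J = "keys y"
  have *: "TM z n y = (\<Sum>i\<in>?I. \<Sum>j\<in>?J. tm (lookup z i) i n (lookup y j) j)"
    if "z \<in> comp_space A" "keys z \<subseteq> ?I" for z
    by (rule TM_superset) (use that in auto)
  have "TM (x + x') n y = (\<Sum>i\<in>?I. \<Sum>j\<in>?J. tm (lookup (x + x') i) i n (lookup y j) j)"
    by (rule *[OF x keys_add])
  also have "\<dots> = TM x n y + TM x' n y"
    using assms by (simp add: * lookup_add tm_add_left lookup_in_A sum.distrib)
  finally show ?thesis .
qed

lemma TM_add_right:
  assumes "x \<in> comp_space A"
  shows "TM x n (y + y') = TM x n y + TM x n y'"
proof -
  let ?I = "keys x" and ?J = "keys y \<union> keys y'"
  have *: "TM x n z = (\<Sum>i\<in>?I. \<Sum>j\<in>?J. tm (lookup x i) i n (lookup z j) j)"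
    if "keys z \<subseteq> ?J" for z
    by (rule TM_superset) (use assms that in auto)
  have "TM x n (y + y') = (\<Sum>i\<in>?I. \<Sum>j\<in>?J. tm (lookup x i) i n (lookup (y + y') j) j)"
    by (rule *[OF keys_add])
  also have "\<dots> = TM x n y + TM x n y'"
    using assms by (simp add: * lookup_add tm_add_right lookup_in_A sum.distrib)
  finally show ?thesis .
qed

lemma TM_scale_left:
  assumes "x \<in> comp_space A"
  shows "TM (fscale sA c x) n y = fscale sM c (TM x n y)"
proof -
  have x: "fscale sA c x \<in> comp_space A"
    using assms VA.subspace_scale[OF subspace_A] by (simp add: comp_space_def)
  have "TM (fscale sA c x) n y = (\<Sum>i\<in>keys x. \<Sum>j\<in>keys y. tm (lookup (fscale sA c x) i) i n (lookup y j) j)"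
    by (rule TM_superset[OF x]) (auto simp: in_keys_iff)
  also have "\<dots> = fscale sM c (TM x n y)"
    using assms by (simp add: TM_tm tm_scale_left lookup_in_A FT.scale_sum_right)
  finally show ?thesis .
qed

lemma TM_scale_right:
  assumes "x \<in> comp_space A"
  shows "TM x n (fscale sM c y) = fscale sM c (TM x n y)"
proof -
  have "TM x n (fscale sM c y) = (\<Sum>i\<in>keys x. \<Sum>j\<in>keys y. tm (lookup x i) i n (lookup (fscale sM c y) j) j)"
    by (rule TM_superset[OF assms]) (auto simp: in_keys_iff)
  also have "\<dots> = fscale sM c (TM x n y)"
    using assms by (simp add: TM_tm tm_scale_right lookup_in_A FT.scale_sum_right)
  finally show ?thesis .
qed

lemma TM_zero_left [simp]: "TM 0 n y = 0"
  by (simp add: TM_tm)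

lemma TM_zero_right [simp]: "TM x n 0 = 0"
  by (simp add: TM_tm)

lemma TM_single: "a \<in> A \<Longrightarrow> TM (single i a) n (single j u) = tm a i n u j"
  by (simp add: TM_tm)

lemma tm_truncated:
  assumes "a \<in> A"
  shows "\<exists>N. \<forall>n\<ge>N. tm a i n u j = 0"
proof -
  obtain N N' where N: "\<forall>n\<ge>N. YM a n (par_if (odd_basis i) u) = 0"
    "\<forall>n\<ge>N'. vmode B (single i 1) n (single j 1) = 0"
    using YM_truncated[OF assms] B_truncated by meson
  have "tm a i n u j = 0" if n: "n \<ge> N + N'" for n
  proof -
    have "tens sM (YM a k (par_if (odd_basis i) u)) (vmode B (single i 1) (n - k - 1) (single j 1)) = 0" for k
    proof (cases "k \<ge> N")
      case False
      then have "n - k - 1 \<ge> N'" using n by linarith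
      then show ?thesis using N by simp
    qed (use N in simp)
    then show ?thesis by (simp add: tm_def)
  qed
  then show ?thesis by blast
qed

lemma eventually_zero_sum:
  fixes f :: "'x \<Rightarrow> int \<Rightarrow> 'y::comm_monoid_add"
  assumes "finite S" "\<And>i. i \<in> S \<Longrightarrow> \<exists>N. \<forall>n\<ge>N. f i n = 0"
  shows "\<exists>N. \<forall>n\<ge>N. (\<Sum>i\<in>S. f i n) = 0"
  using assms
proof induction
  case (insert x S)
  obtain N N' where "\<forall>n\<ge>N. f x n = 0" "\<forall>n\<ge>N'. (\<Sum>i\<in>S. f i n) = 0"
    using insert by (metis insertI1 insertI2)
  then show ?case using insert by (intro exI[of _ "max N N'"]) auto
qed auto

lemma TM_truncated:
  assumes "x \<in> comp_space A"
  shows "\<exists>N. \<forall>n\<ge>N. TM x n y = 0"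
  unfolding TM_tm
  by (intro eventually_zero_sum tm_truncated) (use assms in \<open>auto simp: lookup_in_A\<close>)

lemma TM_sum_left:
  assumes "finite S" "\<And>i. i \<in> S \<Longrightarrow> x i \<in> comp_space A"
  shows "TM (sum x S) n y = (\<Sum>i\<in>S. TM (x i) n y)"
proof -
  have "sum x S \<in> comp_space A \<and> TM (sum x S) n y = (\<Sum>i\<in>S. TM (x i) n y)"
    using assms
  proof induction
    case empty
    then show ?case by (simp add: comp_space_def zero_in_A)
  next
    case (insert a S)
    then have "x a + sum x S \<in> comp_space A"
      using VA.subspace_add[OF subspace_A] by (simp add: comp_space_def lookup_add)
    then show ?case using insert by (simp add: TM_add_left)
  qed
  then show ?thesis ..
qed

lemma TM_sum_right:
  assumes "x \<in> comp_space A"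
  shows "TM x n (sum y S) = (\<Sum>j\<in>S. TM x n (y j))"
  by (induction S rule: infinite_finite_induct) (simp_all add: TM_add_right[OF assms])

lemma single_in_comp_space: "a \<in> A \<Longrightarrow> single i a \<in> comp_space A"
  by (simp add: comp_space_def lookup_single when_def zero_in_A)

lemma TM_expand:
  assumes "x \<in> comp_space A"
  shows "TM x n y = (\<Sum>i\<in>keys x. \<Sum>j\<in>keys y. TM (single i (lookup x i)) n (single j (lookup y j)))"
  using assms by (simp add: TM_single lookup_in_A) (simp add: TM_tm)

lemma subspace_comp_space: "module.subspace (fscale sA) (comp_space A)"
  by (rule VA.subspace_comp_space_of[OF subspace_A])

end

text \<open>Truncation on basis vectors is all that forming F \<otimes> M(0) takes. Bilinearity of
  the right factor enters when modes are composed, as for the lattice factor.\<close>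

locale tensor_modes_linear = tensor_modes +
  assumes B_add_left: "vmode B (b + b') n c = vmode B b n c + vmode B b' n c"
    and B_scale_left: "vmode B (cscale d b) n c = cscale d (vmode B b n c)"
    and B_add_right: "vmode B b n (c + c') = vmode B b n c + vmode B b n c'"
    and B_scale_right: "vmode B b n (cscale d c) = cscale d (vmode B b n c)"
    and B_truncated_all: "\<exists>N. \<forall>n\<ge>N. vmode B b n c = 0"
begin

lemma TM_tens:
  assumes a: "a \<in> A" and c: "\<And>i. i \<in> keys c \<Longrightarrow> odd_basis i = p"
  shows "TM (tens sA a c) n (tens sM u b) = Sum_any (\<lambda>k. tens sM (YM a k (par_if p u)) (vmode B c (n - k - 1) b))"
proof -
  note fin = finite_two_sided[OF a B_truncated_all]
  interpret PA: pairing sA cscale "fscale sA" "tens sA" by (rule VA.pairing_tens)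
  have tA: "tens sA a c \<in> comp_space A" for c
    using VA.subspace_scale[OF subspace_A a] by (simp add: comp_space_def)
  define R where "R c b = Sum_any (\<lambda>k. tens sM (YM a k (par_if p u)) (vmode B c (n - k - 1) b))" for c b
  have R: "R (c + c') b = R c b + R c' b" "R (cscale d c) b = fscale sM d (R c b)"
    "R c (b + b') = R c b + R c b'" "R c (cscale d b) = fscale sM d (R c b)" for c c' b b' d
    unfolding R_def
    by (simp_all add: B_add_left B_add_right B_scale_left B_scale_right P.T_add_right P.T_scale_right
      Sum_any.distrib[OF fin fin] FT.scale_Sum_any[OF fin])
  have "TM (tens sA a c) n (tens sM u b) = R c b"
  proof (rule linear_ext_keys[where s = "fscale sM" and \<phi> = "\<lambda>c. TM (tens sA a c) n (tens sM u b)" and \<psi> = "\<lambda>c. R c b"])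
    fix i assume i: "i \<in> keys c"
    show "TM (tens sA a (single i 1)) n (tens sM u b) = R (single i 1) b"
    proof (rule linear_ext_keys[where s = "fscale sM"])
      fix j
      show "TM (tens sA a (single i 1)) n (tens sM u (single j 1)) = R (single i 1) (single j 1)"
        using a c[OF i] by (simp add: TM_single tm_def R_def)
    qed (simp_all add: R TM_add_right TM_scale_right single_in_comp_space a P.T_add_right P.T_scale_right)
  qed (simp_all add: R TM_add_left[OF tA tA] TM_scale_left[OF tA] PA.T_add_right PA.T_scale_right)
  then show ?thesis by (simp add: R_def)
qed

end

section \<open>Module axioms and the tensor product of two modules\<close>

lemma vertex_moduleD:
  assumes "vertex_module V A sM YM M"
  shows "vector_space sM" "module.subspace sM M"
    and "\<And>a n u. a \<in> A \<Longrightarrow> u \<in> M \<Longrightarrow> YM a n u \<in> M"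
    and "\<And>a n u w. a \<in> A \<Longrightarrow> u \<in> M \<Longrightarrow> w \<in> M \<Longrightarrow> YM a n (u + w) = YM a n u + YM a n w"
    and "\<And>a n c u. a \<in> A \<Longrightarrow> u \<in> M \<Longrightarrow> YM a n (sM c u) = sM c (YM a n u)"
    and "\<And>a b n u. a \<in> A \<Longrightarrow> b \<in> A \<Longrightarrow> u \<in> M \<Longrightarrow> YM (a + b) n u = YM a n u + YM b n u"
    and "\<And>a n c u. a \<in> A \<Longrightarrow> u \<in> M \<Longrightarrow> YM (vscale V c a) n u = sM c (YM a n u)"
    and "\<And>a u. a \<in> A \<Longrightarrow> u \<in> M \<Longrightarrow> \<exists>N. \<forall>n\<ge>N. YM a n u = 0"
    and "\<And>n u. u \<in> M \<Longrightarrow> YM (vvac V) n u = (if n = -1 then u else 0)"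
    and "\<And>a b p q m n r u. a \<in> A \<Longrightarrow> b \<in> A \<Longrightarrow> homogeneous V p a \<Longrightarrow> homogeneous V q b \<Longrightarrow> u \<in> M \<Longrightarrow>
         (Sum_any (\<lambda>i. sM (of_int m gchoose i) (YM (vmode V a (r + int i) b) (m + n - int i) u))) =
         (Sum_any (\<lambda>i. sM ((-1) ^ i * (of_int r gchoose i))
             (YM a (m + r - int i) (YM b (n + int i) u)
              - sM ((-1) powi r * (if p \<and> q then -1 else 1)) (YM b (n + r - int i) (YM a (m + int i) u)))))"
  using assms unfolding vertex_module_def by simp_all

lemma vertex_module_restrict:
  assumes "vertex_module V A sM YM M" "A' \<subseteq> A" "M' \<subseteq> M" "module.subspace sM M'"
    and "\<And>a n u. a \<in> A' \<Longrightarrow> u \<in> M' \<Longrightarrow> YM a n u \<in> M'"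
  shows "vertex_module V A' sM YM M'"
  unfolding vertex_module_def using vertex_moduleD[OF assms(1)] assms(2-5)
  by (simp add: subset_iff)

lemma vertex_module_triple:
  fixes sM :: "complex \<Rightarrow> 'm::ab_group_add \<Rightarrow> 'm"
  assumes M: "vertex_module V A sM YM UNIV" and 0: "0 \<in> A"
    and tr: "\<exists>N. \<forall>n\<ge>N. vmode V a n b = 0" and cl: "\<And>n. vmode V a n b \<in> A"
    and ab: "a \<in> A" "b \<in> A" "homogeneous V p a" "homogeneous V q b"
  shows "borcherds_triple sM (\<lambda>m n. YM a m (YM b n w))
    (\<lambda>m n. sM (if p \<and> q then -1 else 1) (YM b n (YM a m w))) (\<lambda>r n. YM (vmode V a r b) n w)"
proof -
  note D = vertex_moduleD[OF M]
  interpret complex_space sM by (simp add: complex_space_def D(1))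
  have z: "YM a n 0 = 0" "YM b n 0 = 0" "YM 0 n u = 0" for n u
    using D(4)[OF ab(1), of 0 0 n] D(4)[OF ab(2), of 0 0 n] D(6)[OF 0 0, of u n] by simp_all
  have t: "\<exists>N. \<forall>n\<ge>N. YM c n u = 0" if "c \<in> A" for c u using D(8)[OF that] by simp
  have comp: "truncated (\<lambda>m n. YM c m (YM d n w))"
    if cd: "c \<in> A" "d \<in> A" "\<And>n. YM c n 0 = 0" for c d
    using cd t by (intro truncated_compose)
  have h: "truncated (\<lambda>n r. YM (vmode V a r b) n w)"
  proof -
    obtain N where "\<forall>n\<ge>N. vmode V a n b = 0" using tr by blast
    then have "\<forall>r\<ge>N. \<forall>n. YM (vmode V a r b) n w = 0" using z by simp
    then show ?thesis unfolding truncated_def using t[OF cl] by blast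
  qed
  show ?thesis
    unfolding borcherds_triple_iff[OF comp[OF ab(1,2) z(1)] comp[OF ab(2,1) z(2)] h]
    using D(10)[OF ab] by blast
qed

text \<open>The Borcherds identity is drawn from the module over A and from \<open>L\<close>. From
  \<open>V\<close> come the products on A, with their linearity, truncation, closure and
  parity.\<close>

locale tensor_module =
  M: tensor_modes_linear "vscale V" sM A YM par L +
  V: tensor_modes_linear "vscale V" "vscale V" A "vmode V" "vparity V" L
  for V :: "'a::ab_group_add vsa" and A :: "'a set"
    and sM :: "complex \<Rightarrow> 'm::ab_group_add \<Rightarrow> 'm" and YM par and L :: "('i \<Rightarrow>\<^sub>0 complex) vsa" +
  assumes module: "vertex_module V A sM YM UNIV"
    and vac_A: "vvac V \<in> A"
    and A_closed: "a \<in> A \<Longrightarrow> b \<in> A \<Longrightarrow> vmode V a n b \<in> A"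
    and A_parity: "a \<in> A \<Longrightarrow> vparity V a \<in> A"
    and par_par: "par (par u) = u"
    and par_YM: "a \<in> A \<Longrightarrow> par (YM a n u) = YM (vparity V a) n (par u)"
    and L_vsa: "vertex_superalgebra L" and L_scale: "vscale L = cscale"
    and L_parity: "lookup (vparity L c) k = (if homogeneous L True (single k 1) then - lookup c k else lookup c k)"
begin

definition sg :: "bool \<Rightarrow> bool \<Rightarrow> complex" where
  "sg p q = (if p \<and> q then -1 else 1)"

lemma homogeneous_V: "homogeneous V p a \<Longrightarrow> vparity V a = vscale V (sg True p) a"
  by (simp add: homogeneous_def sg_def)

lemma par_if_YM:
  assumes "b \<in> A" "homogeneous V q b"
  shows "M.par_if p (YM b n u) = sM (sg p q) (YM b n (M.par_if p u))"
  using assms by (simp add: M.par_if_def par_YM homogeneous_V M.YM_scale_left) (simp add: sg_def)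

lemma par_if_par_if: "M.par_if p (M.par_if q u) = M.par_if (p \<noteq> q) u"
  by (auto simp: M.par_if_def par_par)

lemma L_module: "vertex_module L UNIV cscale (vmode L) UNIV"
  using L_vsa unfolding vertex_superalgebra_def L_scale by blast

lemma homogeneous_L: "homogeneous L (M.odd_basis i) (single i 1)"
proof (cases "M.odd_basis i")
  case False
  have "vparity L (single i 1) = single i 1"
    using False by (intro poly_mapping_eqI) (auto simp: L_parity lookup_single when_def M.odd_basis_def)
  then show ?thesis using False by (simp add: homogeneous_def)
qed (simp add: M.odd_basis_def)

lemma odd_basis_keys:
  assumes "homogeneous L p c" "k \<in> keys c"
  shows "M.odd_basis k = p"
proof -
  have "lookup (vparity L c) k = (if p then - lookup c k else lookup c k)"
    using assms(1) by (simp add: homogeneous_def)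
  moreover have "lookup c k \<noteq> - lookup c k" using assms(2) by (simp add: in_keys_iff)
  ultimately show ?thesis using assms(2) unfolding M.odd_basis_def L_parity by (auto split: if_splits)
qed

lemma homogeneous_L_mode:
  assumes "homogeneous L p b" "homogeneous L q c"
  shows "homogeneous L (p \<noteq> q) (vmode L b n c)"
proof -
  note D = vertex_moduleD[OF L_module, unfolded L_scale]
  have s: "vmode L (- b) n c' = - vmode L b n c'" "vmode L b n (- c') = - vmode L b n c'" for b c'
    using D(7)[of b c' "-1" n] D(5)[of b c' n "-1"] by simp_all
  have "vparity L (vmode L b n c) = vmode L (vparity L b) n (vparity L c)"
    using L_vsa by (simp add: vertex_superalgebra_def)
  then show ?thesis using assms by (auto simp: homogeneous_def s)
qed

text \<open>Parities add in a tensor product; on booleans both addition and subtraction mod 2 are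
  \<open>\<noteq>\<close>.\<close>

lemma homogeneous_tensor:
  assumes "homogeneous (tensor_vsa V L) p x"
  shows "homogeneous V (p \<noteq> M.odd_basis i) (lookup x i)"
proof -
  have par0: "vparity V 0 = 0" using V.par_zero .
  have basis: "vparity L (single j 1) = single j (if M.odd_basis j then -1 else 1)" for j
    by (intro poly_mapping_eqI) (auto simp: L_parity lookup_single when_def M.odd_basis_def)
  have "vparity (tensor_vsa V L) x
      = (\<Sum>j\<in>keys x. single j (vscale V (if M.odd_basis j then -1 else 1) (vparity V (lookup x j))))"
    unfolding tensor_vsa_def tensor_op_def by (simp add: basis del: if_split_asm)
  then have eq: "lookup (vparity (tensor_vsa V L) x) i
      = vscale V (if M.odd_basis i then -1 else 1) (vparity V (lookup x i))"
    by (simp only: lookup_sum_keys par0 M.VA.scale_zero_right)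
  have "vparity V (lookup x i) = vscale V (if M.odd_basis i then -1 else 1)
      (vscale V (if M.odd_basis i then -1 else 1) (vparity V (lookup x i)))"
    by simp
  also have "\<dots> = vscale V (if M.odd_basis i then -1 else 1) (if p then - lookup x i else lookup x i)"
    unfolding eq[symmetric] using assms by (cases p) (simp_all add: homogeneous_def)
  finally show ?thesis by (cases p; cases "M.odd_basis i") (simp_all add: homogeneous_def)
qed

abbreviation e :: "'i \<Rightarrow> ('i \<Rightarrow>\<^sub>0 complex)" where "e i \<equiv> single i 1"

lemma TM_single_tens:
  assumes "a \<in> A"
  shows "M.TM (single i a) n (tens sM u c)
    = Sum_any (\<lambda>k. tens sM (YM a k (M.par_if (M.odd_basis i) u)) (vmode L (e i) (n - k - 1) c))"
  using M.TM_tens[OF assms, of "e i" "M.odd_basis i" n u c] by simp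

lemma truncated_YM:
  assumes "a \<in> A" "b \<in> A"
  shows "truncated (\<lambda>m n. YM a m (YM b n w))"
  using assms by (intro truncated_compose M.YM_truncated) auto

lemma truncated_L: "truncated (\<lambda>m n. vmode L a m (vmode L b n w))"
  by (intro truncated_compose M.B_truncated_all) (use M.B_add_right[of a _ 0 0] in simp)

text \<open>The basis vector \<open>e i\<close> must pass b, which costs the sign \<open>sg\<close>;
  the two parity twists on u then combine into one for the sum of the parities of i and j.\<close>

lemma TM_TM:
  assumes a: "a \<in> A" and b: "b \<in> A" "homogeneous V q b"
  shows "M.TM (single i a) m (M.TM (single j b) n (tens sM u c))
    = fscale sM (sg (M.odd_basis i) q)
       (M.P.conv (\<lambda>m n. YM a m (YM b n (M.par_if (M.odd_basis i \<noteq> M.odd_basis j) u)))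
         (\<lambda>m n. vmode L (e i) m (vmode L (e j) n c)) m n)"
proof -
  let ?p = "M.odd_basis i" and ?p' = "M.odd_basis j" 
  let ?w = "M.par_if (?p \<noteq> ?p') u"
  let ?t = "\<lambda>k l. tens sM (YM a k (YM b l ?w)) (vmode L (e i) (m - k - 1) (vmode L (e j) (n - l - 1) c))"
  have fin: "finite {q. case_prod ?t q \<noteq> 0}"
    using M.P.finite_conv[OF truncated_YM[OF a b(1), of ?w] truncated_L[of "e i" "e j" c], of m n] by simp
  have fin_k: "finite {k. ?t k l \<noteq> 0}" for l
    using finite_vimageI[OF fin, of "\<lambda>k. (k, l)"] by (simp add: vimage_def inj_def)
  have fin_l: "finite {l. Sum_any (\<lambda>k. ?t k l) \<noteq> 0}"
    by (rule finite_support_Sum_any(2)[OF fin])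
  have "M.TM (single i a) m (M.TM (single j b) n (tens sM u c))
    = M.TM (single i a) m (Sum_any (\<lambda>l. tens sM (YM b l (M.par_if ?p' u)) (vmode L (e j) (n - l - 1) c)))"
    by (simp add: TM_single_tens b)
  also have "\<dots> = Sum_any (\<lambda>l. M.TM (single i a) m (tens sM (YM b l (M.par_if ?p' u)) (vmode L (e j) (n - l - 1) c)))"
    using M.finite_two_sided[OF b(1) M.B_truncated_all]
    by (intro Sum_any_hom M.TM_add_right M.TM_zero_right M.single_in_comp_space a)
  also have "\<dots> = Sum_any (\<lambda>l. fscale sM (sg ?p q) (Sum_any (\<lambda>k. ?t k l)))"
  proof (rule Sum_any.cong)
    fix l
    show "M.TM (single i a) m (tens sM (YM b l (M.par_if ?p' u)) (vmode L (e j) (n - l - 1) c))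
      = fscale sM (sg ?p q) (Sum_any (\<lambda>k. ?t k l))"
      unfolding M.FT.scale_Sum_any[OF fin_k]
      by (simp add: TM_single_tens a par_if_YM[OF b] M.YM_scale_right par_if_par_if M.P.T_scale_left)
  qed
  also have "\<dots> = fscale sM (sg ?p q) (Sum_any (\<lambda>l. Sum_any (\<lambda>k. ?t k l)))"
    by (rule M.FT.scale_Sum_any[OF fin_l, symmetric])
  also have "Sum_any (\<lambda>l. Sum_any (\<lambda>k. ?t k l)) = M.P.conv (\<lambda>m n. YM a m (YM b n ?w)) (\<lambda>m n. vmode L (e i) m (vmode L (e j) n c)) m n"
    unfolding M.P.conv_def by (rule Sum_any_flatten_swap[OF fin])
  finally show ?thesis .
qed

lemma tens_in_comp_space: "a \<in> A \<Longrightarrow> tens (vscale V) a c \<in> comp_space A"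
  using M.VA.subspace_scale[OF M.subspace_A] by (simp add: comp_space_def)

lemma TM_Sum_any_left:
  assumes "finite {k. f k \<noteq> 0}" "\<And>k. f k \<in> comp_space A"
  shows "M.TM (Sum_any f) n y = Sum_any (\<lambda>k. M.TM (f k) n y)"
proof -
  have "Sum_any f = sum f {k. f k \<noteq> 0}" by (rule Sum_any.expand_set)
  moreover have "Sum_any (\<lambda>k. M.TM (f k) n y) = (\<Sum>k\<in>{k. f k \<noteq> 0}. M.TM (f k) n y)"
    using assms(1) by (intro Sum_any.expand_superset) auto
  ultimately show ?thesis using assms by (simp add: M.TM_sum_left)
qed

text \<open>The product in the algebra moves \<open>e i\<close> past b as well, so the sign is that
  of \<open>TM_TM\<close> and comes out of the identity as a common factor.\<close>

lemma TM_TV: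
  assumes a: "a \<in> A" and b: "b \<in> A" "homogeneous V q b"
  shows "M.TM (V.TM (single i a) r (single j b)) n (tens sM u c)
    = fscale sM (sg (M.odd_basis i) q)
       (M.P.conv (\<lambda>r n. YM (vmode V a r b) n (M.par_if (M.odd_basis i \<noteq> M.odd_basis j) u))
         (\<lambda>r n. vmode L (vmode L (e i) r (e j)) n c) r n)"
proof -
  let ?p = "M.odd_basis i" and ?p' = "M.odd_basis j" 
  let ?w = "M.par_if (?p \<noteq> ?p') u"
  let ?t = "\<lambda>k l. tens sM (YM (vmode V a k b) l ?w) (vmode L (vmode L (e i) (r - k - 1) (e j)) (n - l - 1) c)"
  obtain K where K: "\<forall>k\<ge>K. vmode V a k b = 0" using V.YM_truncated[OF a] by blast
  obtain K' where K': "\<forall>k\<ge>K'. vmode L (e i) k (e j) = 0" using M.B_truncated_all by blast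
  have L0: "vmode L 0 n c = 0" for n c using M.B_add_left[of 0 0 n c] by simp
  have ab: "vmode V a k b \<in> A" for k by (rule A_closed[OF a b(1)])
  have fin: "finite {q. case_prod ?t q \<noteq> 0}"
  proof (rule finite_support_slices(1))
    show "?t k l = 0" if "k \<notin> {r - 1 - K'..K}" for k l
    proof (cases "k \<ge> K")
      case False
      then have "r - k - 1 \<ge> K'" using that by auto
      then show ?thesis using K' by (simp add: L0)
    qed (use K in simp)
    show "finite {l. ?t k l \<noteq> 0}" for k by (rule M.finite_two_sided[OF ab M.B_truncated_all])
  qed simp
  have fin_k: "finite {k. Sum_any (?t k) \<noteq> 0}"
    by (rule finite_support_Sum_any(1)[OF fin])
  note fin_V = V.finite_two_sided[OF a M.B_truncated_all]
  have parb: "V.par_if ?p b = vscale V (sg ?p q) b"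
    using homogeneous_V[OF b(2)] by (auto simp: V.par_if_def sg_def)
  have inA: "V.par_if ?p b \<in> A" unfolding parb by (rule M.VA.subspace_scale[OF M.subspace_A b(1)])
  have "M.TM (V.TM (single i a) r (single j b)) n (tens sM u c)
    = M.TM (Sum_any (\<lambda>k. tens (vscale V) (vmode V a k (V.par_if ?p b)) (vmode L (e i) (r - k - 1) (e j)))) n (tens sM u c)"
    by (simp add: V.TM_single a V.tm_def)
  also have "\<dots> = Sum_any (\<lambda>k. M.TM (tens (vscale V) (vmode V a k (V.par_if ?p b)) (vmode L (e i) (r - k - 1) (e j))) n (tens sM u c))"
    by (rule TM_Sum_any_left[OF fin_V]) (intro tens_in_comp_space A_closed a inA)
  also have "\<dots> = Sum_any (\<lambda>k. fscale sM (sg ?p q) (Sum_any (?t k)))"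
  proof (rule Sum_any.cong)
    fix k
    have "M.TM (tens (vscale V) (vmode V a k (V.par_if ?p b)) (vmode L (e i) (r - k - 1) (e j))) n (tens sM u c)
      = Sum_any (\<lambda>l. tens sM (YM (vmode V a k (V.par_if ?p b)) l ?w) (vmode L (vmode L (e i) (r - k - 1) (e j)) (n - l - 1) c))"
      by (rule M.TM_tens[OF A_closed[OF a inA]], rule odd_basis_keys,
          rule homogeneous_L_mode[OF homogeneous_L homogeneous_L])
    also have "\<dots> = fscale sM (sg ?p q) (Sum_any (?t k))"
      unfolding M.FT.scale_Sum_any[OF M.finite_two_sided[OF ab M.B_truncated_all]]
      by (simp add: parb V.YM_scale_right a M.YM_scale_left ab M.P.T_scale_left)
    finally show "M.TM (tens (vscale V) (vmode V a k (V.par_if ?p b)) (vmode L (e i) (r - k - 1) (e j))) n (tens sM u c)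
      = fscale sM (sg ?p q) (Sum_any (?t k))" .
  qed
  also have "\<dots> = fscale sM (sg ?p q) (Sum_any (\<lambda>k. Sum_any (?t k)))"
    by (rule M.FT.scale_Sum_any[OF fin_k, symmetric])
  also have "Sum_any (\<lambda>k. Sum_any (?t k)) = M.P.conv (\<lambda>r n. YM (vmode V a r b) n ?w)
         (\<lambda>r n. vmode L (vmode L (e i) r (e j)) n c) r n"
    unfolding M.P.conv_def by (rule Sum_any_flatten[OF fin])
  finally show ?thesis .
qed

lemma borcherds_single:
  assumes a: "a \<in> A" "homogeneous V p a" and b: "b \<in> A" "homogeneous V q b"
  shows "borcherds_triple (fscale sM)
    (\<lambda>m n. M.TM (single i a) m (M.TM (single j b) n (tens sM u c)))
    (\<lambda>m n. fscale sM (sg (p \<noteq> M.odd_basis i) (q \<noteq> M.odd_basis j))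
       (M.TM (single j b) n (M.TM (single i a) m (tens sM u c))))
    (\<lambda>r n. M.TM (V.TM (single i a) r (single j b)) n (tens sM u c))"
proof -
  let ?p = "M.odd_basis i" and ?q = "M.odd_basis j" 
  define w where "w = M.par_if (?p \<noteq> ?q) u"
  have wq: "M.par_if (?q \<noteq> ?p) u = w"
  proof -
    have "(?q \<noteq> ?p) = (?p \<noteq> ?q)" by auto
    then show ?thesis unfolding w_def by (rule arg_cong)
  qed
  have tM: "borcherds_triple sM (\<lambda>m n. YM a m (YM b n w))
      (\<lambda>m n. sM (sg p q) (YM b n (YM a m w))) (\<lambda>r n. YM (vmode V a r b) n w)"
    unfolding sg_def
    by (rule vertex_module_triple[OF module M.zero_in_A V.YM_truncated[OF a(1)] A_closed[OF a(1) b(1)]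
        a(1) b(1) a(2) b(2)])
  have tL: "borcherds_triple cscale (\<lambda>m n. vmode L (e i) m (vmode L (e j) n c))
      (\<lambda>m n. cscale (sg ?p ?q) (vmode L (e j) n (vmode L (e i) m c))) (\<lambda>r n. vmode L (vmode L (e i) r (e j)) n c)"
    unfolding sg_def
    by (rule vertex_module_triple[OF L_module _ M.B_truncated_all _ _ _ homogeneous_L homogeneous_L]) auto
  let ?P = "M.P.conv (\<lambda>m n. YM a m (YM b n w)) (\<lambda>m n. vmode L (e i) m (vmode L (e j) n c))"
  let ?Q' = "M.P.conv (\<lambda>n m. YM b n (YM a m w)) (\<lambda>n m. vmode L (e j) n (vmode L (e i) m c))"
  let ?Q = "\<lambda>m n. fscale sM (sg p q * sg ?p ?q) (?Q' n m)"
  let ?H = "M.P.conv (\<lambda>r n. YM (vmode V a r b) n w) (\<lambda>r n. vmode L (vmode L (e i) r (e j)) n c)"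
  note tba = truncated_YM[OF b(1) a(1), of w] truncated_L[of "e j" "e i" c]
  have "M.P.conv (\<lambda>m n. sM (sg p q) (YM b n (YM a m w)))
      (\<lambda>m n. cscale (sg ?p ?q) (vmode L (e j) n (vmode L (e i) m c))) m n = ?Q m n" for m n
  proof -
    have "M.P.conv (\<lambda>m n. sM (sg p q) (YM b n (YM a m w)))
      (\<lambda>m n. cscale (sg ?p ?q) (vmode L (e j) n (vmode L (e i) m c))) m n
      = M.P.conv (\<lambda>n m. sM (sg p q) (YM b n (YM a m w)))
        (\<lambda>n m. cscale (sg ?p ?q) (vmode L (e j) n (vmode L (e i) m c))) n m"
      by (rule M.P.conv_swap[symmetric])
    then show ?thesis
      by (simp add: M.P.conv_scale_left[OF tba(1) cscale.truncated_scale[OF tba(2)]] M.P.conv_scale_right[OF tba])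
  qed
  then have "borcherds_triple (fscale sM) ?P ?Q ?H"
    using M.P.borcherds_triple_conv[OF tM tL] by presburger
  from M.FT.borcherds_triple_scale[OF this, of "sg ?p q"]
  have "borcherds_triple (fscale sM) (\<lambda>m n. fscale sM (sg ?p q) (?P m n))
     (\<lambda>m n. fscale sM (sg ?p q) (?Q m n)) (\<lambda>m n. fscale sM (sg ?p q) (?H m n))" .
  \<comment> \<open>Bilinearity of the exponent mod 2: (p + p')(q + q') = pq + pq' + p'q + p'q',
    where p' and q' are the parities of the basis vectors; the mixed term pq' cancels against
    \<open>sg ?q p\<close>.\<close>
  moreover have "sg ?p q * (sg p q * sg ?p ?q) = sg (p \<noteq> ?p) (q \<noteq> ?q) * sg ?q p"
    by (auto simp: sg_def)
  ultimately show ?thesis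
    unfolding TM_TM[OF a(1) b] TM_TM[OF b(1) a] TM_TV[OF a(1) b] wq w_def[symmetric] by simp
qed

lemma TV_closed:
  assumes "x \<in> comp_space A" "y \<in> comp_space A"
  shows "V.TM x n y \<in> comp_space A"
proof -
  have "V.tm (lookup x i) i n (lookup y j) j \<in> comp_space A" for i j
    unfolding V.tm_def V.par_if_def using assms
    by (intro V.FT.subspace_Sum_any M.subspace_comp_space tens_in_comp_space A_closed)
      (auto simp: comp_space_def A_parity)
  then show ?thesis
    unfolding V.TM_tm by (intro V.FT.subspace_sum M.subspace_comp_space)
qed

lemma TM_expand_left:
  assumes "x \<in> comp_space A"
  shows "M.TM x n y = (\<Sum>i\<in>keys x. M.TM (single i (lookup x i)) n y)"
  using M.TM_sum_left[of "keys x" "\<lambda>i. single i (lookup x i)" n y] assms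
  by (simp add: sum_single_lookup M.lookup_in_A M.single_in_comp_space)

lemma TM_expand_right:
  assumes "x \<in> comp_space A"
  shows "M.TM x n y = (\<Sum>j\<in>keys y. M.TM x n (single j (lookup y j)))"
  using M.TM_sum_right[OF assms, of n "\<lambda>j. single j (lookup y j)" "keys y"]
  by (simp add: sum_single_lookup)

lemma borcherds_tensor:
  assumes x: "x \<in> comp_space A" "homogeneous (tensor_vsa V L) p x"
    and y: "y \<in> comp_space A" "homogeneous (tensor_vsa V L) q y"
  shows "borcherds_triple (fscale sM) (\<lambda>m n. M.TM x m (M.TM y n u))
    (\<lambda>m n. fscale sM (sg p q) (M.TM y n (M.TM x m u))) (\<lambda>r n. M.TM (V.TM x r y) n u)"
proof -
  define x' y' u' where "x' i = single i (lookup x i)" and "y' i = single i (lookup y i)"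
    and "u' k = single k (lookup u k)" for i k
  have in_A: "lookup x i \<in> A" "lookup y i \<in> A" for i using x y by (simp_all add: comp_space_def)
  have xy': "x' i \<in> comp_space A" "y' i \<in> comp_space A" for i
    unfolding x'_def y'_def by (intro M.single_in_comp_space in_A)+
  have xor: "((p \<noteq> q) \<noteq> q) = p" for p q :: bool by auto
  have "borcherds_triple (fscale sM)
      (\<lambda>m n. M.TM (x' i) m (M.TM (y' j) n (u' k)))
      (\<lambda>m n. fscale sM (sg p q) (M.TM (y' j) n (M.TM (x' i) m (u' k))))
      (\<lambda>r n. M.TM (V.TM (x' i) r (y' j)) n (u' k))" for i j k
    using borcherds_single[OF in_A(1) homogeneous_tensor[OF x(2)] in_A(2) homogeneous_tensor[OF y(2)],
        of i i j j "lookup u k" "e k"]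
    unfolding x'_def y'_def u'_def xor by simp
  then have *: "borcherds_triple (fscale sM)
      (\<lambda>m n. \<Sum>i\<in>keys x. \<Sum>j\<in>keys y. \<Sum>k\<in>keys u. M.TM (x' i) m (M.TM (y' j) n (u' k)))
      (\<lambda>m n. \<Sum>i\<in>keys x. \<Sum>j\<in>keys y. \<Sum>k\<in>keys u. fscale sM (sg p q) (M.TM (y' j) n (M.TM (x' i) m (u' k))))
      (\<lambda>r n. \<Sum>i\<in>keys x. \<Sum>j\<in>keys y. \<Sum>k\<in>keys u. M.TM (V.TM (x' i) r (y' j)) n (u' k))"
    by (intro M.FT.borcherds_triple_sum) auto
  have expx: "M.TM x n v = (\<Sum>i\<in>keys x. M.TM (x' i) n v)" for n v
    unfolding x'_def by (rule TM_expand_left[OF x(1)])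
  have expy: "M.TM y n v = (\<Sum>i\<in>keys y. M.TM (y' i) n v)" for n v
    unfolding y'_def by (rule TM_expand_left[OF y(1)])
  have expu: "M.TM z n u = (\<Sum>k\<in>keys u. M.TM z n (u' k))" if "z \<in> comp_space A" for n z
    unfolding u'_def by (rule TM_expand_right[OF that])
  have P: "M.TM x m (M.TM y n u) = (\<Sum>i\<in>keys x. \<Sum>j\<in>keys y. \<Sum>k\<in>keys u. M.TM (x' i) m (M.TM (y' j) n (u' k)))" for m n
    by (simp add: expx expy expu xy' M.TM_sum_right)
  have Q: "fscale sM (sg p q) (M.TM y n (M.TM x m u))
      = (\<Sum>i\<in>keys x. \<Sum>j\<in>keys y. \<Sum>k\<in>keys u. fscale sM (sg p q) (M.TM (y' j) n (M.TM (x' i) m (u' k))))" for m n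
    by (subst sum.swap) (simp add: expx expy expu xy' M.TM_sum_right M.FT.scale_sum_right)
  have sum_in: "(\<Sum>j\<in>keys y. V.TM (x' i) r (y' j)) \<in> comp_space A" for i r
    by (intro V.FT.subspace_sum M.subspace_comp_space TV_closed xy')
  have "V.TM x r y = (\<Sum>i\<in>keys x. \<Sum>j\<in>keys y. V.TM (x' i) r (y' j))" for r
    unfolding x'_def y'_def by (rule V.TM_expand[OF x(1)])
  then have H1: "M.TM (V.TM x r y) n u = (\<Sum>i\<in>keys x. \<Sum>j\<in>keys y. M.TM (V.TM (x' i) r (y' j)) n u)" for r n
    by (simp add: M.TM_sum_left TV_closed xy' sum_in)
  have H: "M.TM (V.TM x r y) n u = (\<Sum>i\<in>keys x. \<Sum>j\<in>keys y. \<Sum>k\<in>keys u. M.TM (V.TM (x' i) r (y' j)) n (u' k))" for r n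
    unfolding H1 by (intro sum.cong refl expu TV_closed xy')
  show ?thesis using * unfolding P Q H .
qed

theorem vertex_module_tensor:
  "vertex_module (tensor_vsa V L) (comp_space A) (fscale sM) M.TM UNIV"
proof -
  have vac: "M.TM (vvac (tensor_vsa V L)) n u = (if n = -1 then u else 0)" for n u
  proof -
    have vacL: "homogeneous L False (vvac L)"
      using L_vsa by (simp add: vertex_superalgebra_def homogeneous_def)
    have "M.TM (tens (vscale V) (vvac V) (vvac L)) n (single k (lookup u k)) = (if n = -1 then single k (lookup u k) else 0)" for k
    proof -
      have "M.TM (tens (vscale V) (vvac V) (vvac L)) n (tens sM (lookup u k) (e k))
        = Sum_any (\<lambda>l. tens sM (YM (vvac V) l (M.par_if False (lookup u k))) (vmode L (vvac L) (n - l - 1) (e k)))"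
        by (rule M.TM_tens[OF vac_A]) (rule odd_basis_keys[OF vacL])
      also have "\<dots> = tens sM (lookup u k) (vmode L (vvac L) n (e k))"
        by (subst Sum_any_single[of "-1"])
          (simp_all add: vertex_moduleD(9)[OF module] M.par_if_def)
      also have "vmode L (vvac L) n (e k) = (if n = -1 then e k else 0)"
        by (simp add: vertex_moduleD(9)[OF L_module])
      finally show ?thesis by simp
    qed
    then show ?thesis
      using TM_expand_right[OF tens_in_comp_space[OF vac_A], of "vvac L" n u]
      by (simp add: tensor_vsa_def sum_single_lookup)
  qed
  have vs: "vscale (tensor_vsa V L) = fscale (vscale V)" "vmode (tensor_vsa V L) = V.TM"
    by (simp_all add: tensor_vsa_def)
  have B: "Sum_any (\<lambda>i. fscale sM (of_int m gchoose i) (M.TM (V.TM x (r + int i) y) (m + n - int i) u)) =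
         (Sum_any (\<lambda>i. fscale sM ((-1) ^ i * (of_int r gchoose i))
             (M.TM x (m + r - int i) (M.TM y (n + int i) u)
              - fscale sM ((-1) powi r * (if p \<and> q then -1 else 1)) (M.TM y (n + r - int i) (M.TM x (m + int i) u)))))"
    if "x \<in> comp_space A" "y \<in> comp_space A" "homogeneous (tensor_vsa V L) p x" "homogeneous (tensor_vsa V L) q y"
    for x y p q m n r u
  proof -
    have comp: "truncated (\<lambda>m n. M.TM a m (M.TM b n u))" if ab: "a \<in> comp_space A" "b \<in> comp_space A" for a b
      using ab by (intro truncated_compose M.TM_truncated) auto
    note bt = borcherds_tensor[OF that(1,3,2,4), of u]
    have th: "truncated (swap2 (\<lambda>r n. M.TM (V.TM x r y) n u))"
      using bt by (simp add: borcherds_triple_def)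
    from bt[unfolded sg_def M.FT.borcherds_triple_iff[OF comp[OF that(1,2)] comp[OF that(2,1)] th]]
    show ?thesis by blast
  qed
  show ?thesis
    unfolding vertex_module_def vs
    by (intro conjI ballI allI impI B vac)
      (simp_all add: M.FT.vector_space_axioms M.FT.subspace_UNIV M.TM_add_right M.TM_scale_right
        M.TM_add_left M.TM_scale_left M.TM_truncated)
qed

end

section \<open>Commutator formula, iterate formula, generated subalgebras\<close>

lemma vertex_module_commutator:
  fixes sM :: "complex \<Rightarrow> 'm::ab_group_add \<Rightarrow> 'm"
  assumes M: "vertex_module V A sM YM M"
    and ab: "a \<in> A" "b \<in> A" "homogeneous V p a" "homogeneous V q b" and u: "u \<in> M"
  shows "YM a m (YM b n u) - sM (if p \<and> q then -1 else 1) (YM b n (YM a m u))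
    = Sum_any (\<lambda>i. sM (of_int m gchoose i) (YM (vmode V a (int i) b) (m + n - int i) u))"
proof -
  interpret complex_space sM by (simp add: complex_space_def vertex_moduleD(1)[OF M])
  show ?thesis
    using vertex_moduleD(10)[OF M ab u, of m 0 n]
    by (subst (asm) (2) Sum_any_single[of 0]) (simp_all add: gbinomial_0_left)
qed

text \<open>The case m = 0 of the Borcherds identity, where only i = 0 survives on the left; the
  commutator formula is the case r = 0, with the same effect on the right.\<close>

lemma vertex_module_iterate:
  fixes sM :: "complex \<Rightarrow> 'm::ab_group_add \<Rightarrow> 'm"
  assumes M: "vertex_module V A sM YM M"
    and ab: "a \<in> A" "b \<in> A" "homogeneous V p a" "homogeneous V q b" and u: "u \<in> M"
  shows "YM (vmode V a r b) n u = Sum_any (\<lambda>i. sM ((-1) ^ i * (of_int r gchoose i))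
             (YM a (r - int i) (YM b (n + int i) u)
              - sM ((-1) powi r * (if p \<and> q then -1 else 1)) (YM b (n + r - int i) (YM a (int i) u))))"
proof -
  interpret complex_space sM by (simp add: complex_space_def vertex_moduleD(1)[OF M])
  show ?thesis
    using vertex_moduleD(10)[OF M ab u, of 0 r n]
    by (subst (asm) Sum_any_single[of 0]) (simp_all add: gbinomial_0_left)
qed

lemma generated_subalgebra_superset: "S \<subseteq> generated_subalgebra V S"
  by (auto simp: generated_subalgebra_def)

lemma generated_subalgebra_vac: "vvac V \<in> generated_subalgebra V S"
  by (auto simp: generated_subalgebra_def)

lemma generated_subalgebra_closed:
  "a \<in> generated_subalgebra V S \<Longrightarrow> b \<in> generated_subalgebra V S \<Longrightarrow> vmode V a n b \<in> generated_subalgebra V S"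
  by (auto simp: generated_subalgebra_def)

lemma generated_subalgebra_least:
  assumes "module.subspace (vscale V) A" "vvac V \<in> A" "S \<subseteq> A"
    and "\<And>a b n. a \<in> A \<Longrightarrow> b \<in> A \<Longrightarrow> vmode V a n b \<in> A"
  shows "generated_subalgebra V S \<subseteq> A"
  unfolding generated_subalgebra_def by (intro Inter_lower) (use assms in auto)

lemma subspace_generated_subalgebra:
  assumes "complex_space (vscale V)"
  shows "module.subspace (vscale V) (generated_subalgebra V S)"
proof -
  interpret complex_space "vscale V" by (rule assms)
  show ?thesis unfolding generated_subalgebra_def by (intro subspace_Inter) auto
qed

section \<open>Charge and parity on \<open>F \<otimes> M(0)\<close>\<close>

lemma m0_mode_nonneg: "n \<ge> 0 \<Longrightarrow> vmode m0_vsa a n b = 0"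
  by (simp add: m0_vsa_def)

lemma m0_truncated: "\<exists>N. \<forall>n\<ge>N. vmode m0_vsa a n b = 0"
  by (intro exI[of _ 0]) (simp add: m0_mode_nonneg)

lemma m0_deriv_zero: "m0_deriv 0 = 0"
  by (simp add: m0_deriv_def)

lemma m0_mode_one: "vmode m0_vsa 1 n b = (if n = -1 then b else 0)"
proof -
  have 0: "(m0_deriv ^^ k) 0 = 0" for k by (induction k) (simp_all add: m0_deriv_zero)
  have 1: "m0_deriv 1 = 0" by (simp add: m0_deriv_def zero_multiset_def[symmetric])
  have "(m0_deriv ^^ k) 1 = 0" if "k > 0" for k
    using that 0 1 by (cases k) (simp_all add: funpow_Suc_right del: funpow.simps)
  moreover have "cscale 1 (1 :: m0) = 1" by simp
  ultimately show ?thesis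
    by (cases "n = -1") (auto simp: m0_vsa_def)
qed

locale clifford =
  fixes F :: "'f::ab_group_add vsa" and Psi :: "pm \<Rightarrow> int \<Rightarrow> 'f \<Rightarrow> 'f"
  assumes clifford: "clifford_vsa F Psi"
begin

lemma F_vsa: "vertex_superalgebra F"
  using clifford by (simp add: clifford_vsa_def)

lemma F_module: "vertex_module F UNIV (vscale F) (vmode F) UNIV"
  using F_vsa by (simp add: vertex_superalgebra_def)

sublocale F: complex_space "vscale F"
  by (simp add: complex_space_def vertex_moduleD(1)[OF F_module])

abbreviation vac :: 'f where "vac \<equiv> vvac F"

lemma parity_linear:
  "vparity F (a + b) = vparity F a + vparity F b" "vparity F (vscale F c a) = vscale F c (vparity F a)"
proof -
  interpret P: Vector_Spaces.linear "vscale F" "vscale F" "vparity F"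
    using F_vsa by (simp add: vertex_superalgebra_def)
  show "vparity F (a + b) = vparity F a + vparity F b" "vparity F (vscale F c a) = vscale F c (vparity F a)"
    by (rule P.add, rule P.scale)
qed

lemma parity_F:
  "vparity F (vparity F a) = a" "vparity F (vmode F a n b) = vmode F (vparity F a) n (vparity F b)"
  "vparity F vac = vac"
  using F_vsa by (simp_all add: vertex_superalgebra_def)

sublocale FM: tensor_modes "vscale F" "vscale F" UNIV "vmode F" "vparity F" m0_vsa
  by unfold_locales
    (use vertex_moduleD(4-8)[OF F_module] m0_truncated parity_linear in auto)

lemma FM_simps [simp]:
  "vscale (FM F) = fscale (vscale F)" "vmode (FM F) = FM.TM" "vvac (FM F) = single {#} vac"
  by (simp_all add: tensor_vsa_def m0_vsa_def zero_multiset_def[symmetric] flip: single_one)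

lemma comp_space_UNIV [simp]: "x \<in> comp_space UNIV"
  by (simp add: comp_space_def)

lemma lookup_parity_FM [simp]: "lookup (vparity (FM F) x) k = vparity F (lookup x k)"
proof -
  have "vparity (FM F) x = (\<Sum>i\<in>keys x. single i (vparity F (lookup x i)))"
    by (simp add: tensor_vsa_def tensor_op_def m0_vsa_def)
  then show ?thesis by (simp add: lookup_sum_keys)
qed

lemma odd_basis_m0 [simp]: "\<not> FM.odd_basis i"
proof
  assume "FM.odd_basis i"
  then have "single i 1 = - single i (1::complex)"
    unfolding FM.odd_basis_def homogeneous_def by (simp add: m0_vsa_def)
  then have "lookup (single i 1) i = lookup (- single i (1::complex)) i" by (rule arg_cong)
  then show False by simp
qed

lemma par_if_False [simp]: "FM.par_if False u = u"
  by (simp add: FM.par_if_def)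

text \<open>The field of 1 in M(0) is the identity, concentrated in mode -1, so a \<otimes> 1 acts
  on each coordinate through a alone. This makes the charge operator coordinatewise.\<close>

lemma FM_mode_tens_one: "FM.TM (tens (vscale F) a 1) n v = (\<Sum>j\<in>keys v. single j (vmode F a n (lookup v j)))"
proof -
  have "FM.tm a {#} n u j = single j (vmode F a n u)" for u j
  proof -
    have one: "single {#} 1 = (1 :: m0)" by (simp add: zero_multiset_def[symmetric])
    have "FM.tm a {#} n u j = Sum_any (\<lambda>k. tens (vscale F) (vmode F a k u)
        (vmode m0_vsa 1 (n - k - 1) (single j 1)))"
      by (simp add: FM.tm_def one)
    also have "\<dots> = tens (vscale F) (vmode F a n u) (vmode m0_vsa 1 (n - n - 1) (single j 1))"
      by (rule Sum_any_single) (simp add: m0_mode_one)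
    finally show ?thesis by (simp add: m0_mode_one)
  qed
  moreover have "tens (vscale F) a (1 :: m0) = single {#} a"
    by (simp add: zero_multiset_def[symmetric] flip: single_one)
  ultimately show ?thesis
    using FM.TM_superset[of "single {#} a" "{{#}}" "keys v" v n] by (simp add: lookup_single)
qed

definition charge_vec :: 'f where
  "charge_vec = Psi Plus (-1) (Psi Minus (-1) vac)"

definition charge_op :: "'f \<Rightarrow> 'f" where
  "charge_op u = vmode F charge_vec 0 u"

lemma lookup_Jf0 [simp]: "lookup (Jf0 F Psi v) k = charge_op (lookup v k)"
proof -
  have "Jf0 F Psi v = (\<Sum>j\<in>keys v. single j (charge_op (lookup v j)))"
    by (simp add: Jf0_def FM_mode_tens_one charge_op_def charge_vec_def)
  moreover have "charge_op 0 = 0" by (simp add: charge_op_def)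
  ultimately show ?thesis by (simp add: lookup_sum_keys)
qed

abbreviation psi :: "pm \<Rightarrow> 'f" where "psi \<epsilon> \<equiv> Psi \<epsilon> (-1) vac"

lemma Psi_mode: "vmode F (psi \<epsilon>) n = Psi \<epsilon> n"
  using clifford by (simp add: clifford_vsa_def)

lemma psi_odd: "homogeneous F True (psi \<epsilon>)"
  using clifford by (simp add: clifford_vsa_def)

lemma Psi_vac: "n \<ge> 0 \<Longrightarrow> Psi \<epsilon> n vac = 0"
  using clifford by (simp add: clifford_vsa_def)

lemma Psi_anticommute: "Psi \<epsilon> m (Psi \<delta> n v) + Psi \<delta> n (Psi \<epsilon> m v) = (if \<epsilon> \<noteq> \<delta> \<and> m + n = -1 then v else 0)"
  using clifford unfolding clifford_vsa_def by blast

lemma Psi_0 [simp]: "Psi \<epsilon> n 0 = 0"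
  using FM.YM_zero_right[of "psi \<epsilon>" n] by (simp add: Psi_mode)

lemma charge_vec_mode: "charge_vec = vmode F (psi Plus) (-1) (psi Minus)"
  by (simp add: charge_vec_def Psi_mode)

lemma vmode_F_uminus: "vmode F (- a) n b = - vmode F a n b" "vmode F a n (- b) = - vmode F a n b"
  using FM.YM_scale_left[of a "-1" n b] FM.YM_scale_right[of a n "-1" b] by simp_all

lemma charge_vec_even: "homogeneous F False charge_vec"
  using psi_odd by (simp add: homogeneous_def charge_vec_mode parity_F vmode_F_uminus)

lemma Psi_psi: "n \<ge> 0 \<Longrightarrow> Psi \<epsilon> n (psi \<delta>) = (if \<epsilon> \<noteq> \<delta> \<and> n = 0 then vac else 0)"
  using Psi_anticommute[of \<epsilon> n \<delta> "-1" vac] by (simp add: Psi_vac)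

lemma charge_op_psi: "charge_op (psi Plus) = psi Plus" "charge_op (psi Minus) = - psi Minus"
proof -
  \<comment> \<open>Zero mode of the normally ordered product of the two fermions. All its
    coefficients are 1, since (-1)^i times (-1 choose i) is 1. The minus sign is left when the sign
    of two odd fields meets (-1)^r with r = -1.\<close>
  have *: "charge_op u = Sum_any (\<lambda>i. Psi Plus (-1 - int i) (Psi Minus (int i) u) - Psi Minus (-1 - int i) (Psi Plus (int i) u))" for u
  proof -
    have b: "(-1) ^ i * (- 1 gchoose i) = (1 :: complex)" for i
      using gbinomial_negated_upper[of "-1 :: complex" i] by (simp add: gbinomial_of_nat_symmetric flip: power_add)
    show ?thesis
      using vertex_module_iterate[OF F_module UNIV_I UNIV_I psi_odd[of Plus] psi_odd[of Minus] UNIV_I, of "-1" 0 u]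
      by (simp add: charge_op_def charge_vec_mode Psi_mode b)
  qed
  show "charge_op (psi Plus) = psi Plus"
    unfolding * by (subst Sum_any_single[of 0]) (simp_all add: Psi_psi)
  show "charge_op (psi Minus) = - psi Minus"
    unfolding * by (subst Sum_any_single[of 0]) (simp_all add: Psi_psi)
qed

lemma charge_op_linear:
  "charge_op (a + b) = charge_op a + charge_op b" "charge_op (vscale F c a) = vscale F c (charge_op a)"
  by (simp_all add: charge_op_def FM.YM_add_right FM.YM_scale_right)

text \<open>The commutator formula with m = 0 keeps only i = 0, so the zero mode of an even vector
  is a derivation of all products. A general a is split into its even and odd halves.\<close>

lemma charge_op_mode: "charge_op (vmode F a n b) = vmode F (charge_op a) n b + vmode F a n (charge_op b)"
proof -
  have hom: "charge_op (vmode F a n b) = vmode F (charge_op a) n b + vmode F a n (charge_op b)"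
    if "homogeneous F q a" for q a
    using vertex_module_commutator[OF F_module UNIV_I UNIV_I charge_vec_even that UNIV_I, of 0 n b]
    by (subst (asm) Sum_any_single[of 0]) (simp_all add: charge_op_def gbinomial_0_left algebra_simps)
  define a0 a1 where "a0 = vscale F (1/2) (a + vparity F a)" and "a1 = vscale F (1/2) (a - vparity F a)"
  have "homogeneous F False a0"
    by (simp add: homogeneous_def a0_def parity_linear parity_F add.commute)
  moreover have "homogeneous F True a1"
    using parity_linear(2)[of "-1"]
    by (simp add: homogeneous_def a1_def parity_linear parity_F diff_conv_add_uminus F.scale_right_distrib del: add_uminus_conv_diff)
  moreover have "a = a0 + a1"
    by (simp add: a0_def a1_def flip: F.scale_right_distrib F.scale_left_distrib) (simp flip: F.scale_left_distrib add: F.scale_right_distrib)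
  ultimately show ?thesis
    using hom by (simp add: FM.YM_add_left charge_op_linear)
qed

text \<open>Charge m and parity m mod 2 are carried together, so that on such vectors the charge
  grading alone decides every sign.\<close>

definition charged :: "int \<Rightarrow> 'f set" where
  "charged m = {a. charge_op a = vscale F (of_int m) a \<and> vparity F a = vscale F ((-1) powi m) a}"

lemma subspace_charged: "F.subspace (charged m)"
  unfolding F.subspace_def charged_def
  using FM.YM_zero_right[of charge_vec 0]
  by (auto simp: charge_op_linear parity_linear F.scale_right_distrib mult.commute FM.par_zero) (simp add: charge_op_def)

lemma charged_mode: "a \<in> charged m \<Longrightarrow> b \<in> charged m' \<Longrightarrow> vmode F a n b \<in> charged (m + m')"
  by (auto simp: charged_def charge_op_mode parity_F FM.YM_scale_left FM.YM_scale_right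
      F.scale_left_distrib power_int_add add.commute mult.commute)

lemma vac_charged: "vac \<in> charged 0"
proof -
  have "charge_op vac = 0"
    using F_vsa by (simp add: charge_op_def vertex_superalgebra_def)
  then show ?thesis by (simp add: charged_def parity_F)
qed

definition pm_sign :: "pm \<Rightarrow> int" where
  "pm_sign \<epsilon> = (case \<epsilon> of Plus \<Rightarrow> 1 | Minus \<Rightarrow> -1)"

lemma psi_charged: "psi \<epsilon> \<in> charged (pm_sign \<epsilon>)"
  using psi_odd[of \<epsilon>] charge_op_psi by (cases \<epsilon>) (auto simp: charged_def pm_sign_def homogeneous_def)

lemma Psi_vac_charged: "Psi \<epsilon> n vac \<in> charged (pm_sign \<epsilon>)"
  using charged_mode[OF psi_charged vac_charged, of \<epsilon> n] by (simp add: Psi_mode)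

lemma FM_mode_comp_space:
  assumes E: "F.subspace E" and closed: "\<And>a b n. a \<in> E' \<Longrightarrow> b \<in> E'' \<Longrightarrow> vmode F a n b \<in> E"
    and xy: "x \<in> comp_space E'" "y \<in> comp_space E''"
  shows "FM.TM x n y \<in> comp_space E"
proof -
  have "FM.tm (lookup x i) i n (lookup y j) j \<in> comp_space E" for i j
    unfolding FM.tm_def
    by (intro FM.FT.subspace_Sum_any F.subspace_comp_space_of E)
      (use xy in \<open>simp add: comp_space_def closed F.subspace_scale[OF E]\<close>)
  then show ?thesis unfolding FM.TM_tm by (intro FM.FT.subspace_sum F.subspace_comp_space_of E)
qed

lemma comp_space_charged_mode:
  assumes "x \<in> comp_space (charged m)" "y \<in> comp_space (charged m')"
  shows "FM.TM x n y \<in> comp_space (charged (m + m'))"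
  by (rule FM_mode_comp_space[OF subspace_charged _ assms]) (rule charged_mode)

text \<open>The vacuum of F acts only in mode k = -1, which leaves index n - k - 1 = n \<ge> 0 for
  the factor M(0), where it has no modes. Applied to j and \<nu>, this makes them central.\<close>

lemma FM_mode_vac_nonneg:
  assumes "\<And>i. \<exists>c. lookup x i = vscale F c vac" "n \<ge> 0"
  shows "FM.TM x n y = 0"
proof -
  have "FM.tm (lookup x i) i n u j = 0" for i u j
  proof -
    obtain c where c: "lookup x i = vscale F c vac" using assms(1) by blast
    have "tens (vscale F) (vmode F (lookup x i) k (FM.par_if (FM.odd_basis i) u))
        (vmode m0_vsa (single i 1) (n - k - 1) (single j 1)) = 0" for k
      using assms(2) by (cases "k = -1")
        (simp_all add: c FM.YM_scale_left vertex_moduleD(9)[OF F_module] m0_mode_nonneg)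
    then show ?thesis by (simp add: FM.tm_def)
  qed
  then show ?thesis by (simp add: FM.TM_tm)
qed

section \<open>The vertex algebra calV and its charge decomposition\<close>

abbreviation CV :: "'f fm set" where "CV \<equiv> calV F Psi"

abbreviation generators :: "'f fm set" where
  "generators \<equiv> {tau F Psi Plus, tau F Psi Minus, jvec F, nuvec F}"

lemma subspace_CV: "FM.FT.subspace CV"
  using subspace_generated_subalgebra[of "FM F"] FM.FT.complex_space_axioms by (simp add: calV_def)

lemma CV_mode: "a \<in> CV \<Longrightarrow> b \<in> CV \<Longrightarrow> FM.TM a n b \<in> CV"
  using generated_subalgebra_closed[of a "FM F"] by (simp add: calV_def)

lemma vac_CV: "single {#} vac \<in> CV"
  using generated_subalgebra_vac[of "FM F"] by (simp add: calV_def)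

lemma generators_CV: "generators \<subseteq> CV"
  unfolding calV_def by (rule generated_subalgebra_superset)

lemma CV_least:
  assumes "FM.FT.subspace A" "single {#} vac \<in> A" "generators \<subseteq> A"
    and "\<And>a b n. a \<in> A \<Longrightarrow> b \<in> A \<Longrightarrow> FM.TM a n b \<in> A"
  shows "CV \<subseteq> A"
  unfolding calV_def by (rule generated_subalgebra_least) (use assms in simp_all)

lemma tau_charged: "tau F Psi \<epsilon> \<in> comp_space (charged (pm_sign \<epsilon>))"
  unfolding tau_def
  by (auto simp: comp_space_def lookup_add intro!: F.subspace_add[OF subspace_charged] F.subspace_scale[OF subspace_charged] Psi_vac_charged)

lemma jvec_vac: "\<exists>c. lookup (jvec F) i = vscale F c vac"
  and nuvec_vac: "\<exists>c. lookup (nuvec F) i = vscale F c vac"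
  unfolding jvec_def nuvec_def F.lookup_tens by (rule exI, rule refl)+

lemma jvec_charged: "jvec F \<in> comp_space (charged 0)"
  and nuvec_charged: "nuvec F \<in> comp_space (charged 0)"
  by (auto simp: jvec_def nuvec_def comp_space_def intro!: F.subspace_scale[OF subspace_charged] vac_charged)

text \<open>Induction along the generation of calV through vectors of definite charge only. These
  are homogeneous, so the iterate formula is available in the step; general elements are recovered
  as sums.\<close>

lemma CV_span_induct:
  assumes P: "P (single {#} vac)" "\<And>g. g \<in> generators \<Longrightarrow> P g"
    and P_mode: "\<And>a b m m' n. a \<in> CV \<inter> comp_space (charged m) \<Longrightarrow> b \<in> CV \<inter> comp_space (charged m') \<Longrightarrow>
      P a \<Longrightarrow> P b \<Longrightarrow> P (FM.TM a n b)"
  shows "CV \<subseteq> FM.FT.span {a. P a \<and> (\<exists>m. a \<in> CV \<inter> comp_space (charged m))}" (is "_ \<subseteq> FM.FT.span ?G")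
proof (rule CV_least)
  have "generators \<subseteq> ?G"
    using generators_CV tau_charged jvec_charged nuvec_charged P(2) by blast
  then show "generators \<subseteq> FM.FT.span ?G" using FM.FT.span_superset by blast
  have "single {#} vac \<in> comp_space (charged 0)"
    using vac_charged F.subspace_0[OF subspace_charged] by (auto simp: comp_space_def lookup_single when_def)
  then show "single {#} vac \<in> FM.FT.span ?G" using vac_CV P(1) by (intro FM.FT.span_base) blast
  fix a b n assume a: "a \<in> FM.FT.span ?G" and b: "b \<in> FM.FT.span ?G"
  have 1: "FM.TM a n b \<in> FM.FT.span ?G" if a: "a \<in> ?G" for a
    using b
  proof (induction rule: FM.FT.span_induct_alt)
    case base
    then show ?case by (simp add: FM.FT.span_zero)
  next
    case (step c x y)
    have "FM.TM a n x \<in> ?G"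
    proof -
      obtain m m' where am: "a \<in> CV \<inter> comp_space (charged m)" "x \<in> CV \<inter> comp_space (charged m')" "P a" "P x"
        using a step by blast
      then have "FM.TM a n x \<in> CV \<inter> comp_space (charged (m + m'))"
        using CV_mode comp_space_charged_mode by blast
      then show ?thesis using P_mode[OF am] by blast
    qed
    then show ?case
      using step by (simp add: FM.TM_add_right FM.TM_scale_right FM.FT.span_add FM.FT.span_scale FM.FT.span_base)
  qed
  show "FM.TM a n b \<in> FM.FT.span ?G"
    using a
  proof (induction rule: FM.FT.span_induct_alt)
    case base
    then show ?case by (simp add: FM.FT.span_zero)
  next
    case (step c x y)
    then show ?case
      using 1 by (simp add: FM.TM_add_left FM.TM_scale_left FM.FT.span_add FM.FT.span_scale)
  qed
qed (rule FM.FT.subspace_span)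

lemma CV_span: "CV \<subseteq> FM.FT.span (\<Union>m. CV \<inter> comp_space (charged m))"
proof -
  have "{a. True \<and> (\<exists>m. a \<in> CV \<inter> comp_space (charged m))} = (\<Union>m. CV \<inter> comp_space (charged m))" by blast
  then show ?thesis using CV_span_induct[of "\<lambda>_. True"] by simp
qed

lemma parity_FM_charged: "x \<in> comp_space (charged m) \<Longrightarrow> vparity (FM F) x = fscale (vscale F) ((-1) powi m) x"
  by (rule poly_mapping_eqI) (auto simp: comp_space_def charged_def)

lemma parity_FM_linear:
  "vparity (FM F) (a + b) = vparity (FM F) a + vparity (FM F) b"
  "vparity (FM F) (fscale (vscale F) c a) = fscale (vscale F) c (vparity (FM F) a)"
  by (rule poly_mapping_eqI; simp add: lookup_add parity_linear)+

lemma CV_parity: "a \<in> CV \<Longrightarrow> vparity (FM F) a \<in> CV"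
proof -
  have "vparity (FM F) a \<in> CV" if "a \<in> FM.FT.span (\<Union>m. CV \<inter> comp_space (charged m))" for a
    using that
  proof (induction rule: FM.FT.span_induct_alt)
    case base
    have "vparity (FM F) 0 = 0" by (rule poly_mapping_eqI) simp
    then show ?case using FM.FT.subspace_0[OF subspace_CV] by simp
  next
    case (step c x y)
    then have "vparity (FM F) x \<in> CV"
      by (auto simp: parity_FM_charged intro: FM.FT.subspace_scale[OF subspace_CV])
    then show ?case
      using step by (simp add: parity_FM_linear FM.FT.subspace_add[OF subspace_CV] FM.FT.subspace_scale[OF subspace_CV])
  qed
  then show "a \<in> CV \<Longrightarrow> vparity (FM F) a \<in> CV" using CV_span by blast
qed

lemma calV_charge_iff: "v \<in> calV_charge F Psi m \<longleftrightarrow> v \<in> CV \<and> (\<forall>k. charge_op (lookup v k) = vscale F (of_int m) (lookup v k))"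
  by (auto simp: calV_charge_def poly_mapping_eq_iff fun_eq_iff)

lemma calV_charge_zero: "0 \<in> calV_charge F Psi m"
  using FM.YM_zero_right[of charge_vec 0] FM.FT.subspace_0[OF subspace_CV]
  by (simp add: calV_charge_iff) (simp add: charge_op_def)

lemma subspace_calV_charge: "FM.FT.subspace (calV_charge F Psi p)"
  using calV_charge_zero FM.FT.subspace_add[OF subspace_CV] FM.FT.subspace_scale[OF subspace_CV]
  by (auto simp: FM.FT.subspace_def calV_charge_iff lookup_add charge_op_linear F.scale_right_distrib mult.commute)

lemma charged_calV_charge: "v \<in> CV \<Longrightarrow> v \<in> comp_space (charged m) \<Longrightarrow> v \<in> calV_charge F Psi m"
  by (auto simp: calV_charge_iff comp_space_def charged_def)

lemma calV_charge_mode: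
  assumes "x \<in> calV_charge F Psi m" "y \<in> calV_charge F Psi m'"
  shows "FM.TM x n y \<in> calV_charge F Psi (m + m')"
proof -
  let ?E = "\<lambda>m. {a. charge_op a = vscale F (of_int m) a}"
  have E: "F.subspace (?E m)" for m
    using FM.YM_zero_right[of charge_vec 0]
    by (auto simp: F.subspace_def charge_op_linear F.scale_right_distrib mult.commute) (simp add: charge_op_def)
  have "vmode F a n b \<in> ?E (m + m')" if "a \<in> ?E m" "b \<in> ?E m'" for a b n
    using that by (simp add: charge_op_mode FM.YM_scale_left FM.YM_scale_right F.scale_left_distrib)
  then have "FM.TM x n y \<in> comp_space (?E (m + m'))"
    by (rule FM_mode_comp_space[OF E, of "?E m" "?E m'"])
      (use assms in \<open>simp_all add: calV_charge_iff comp_space_def\<close>)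
  then show ?thesis using assms CV_mode by (simp add: calV_charge_iff comp_space_def)
qed

lemma calV_charge_parity: "x \<in> calV_charge F Psi m \<Longrightarrow> vparity (FM F) x \<in> calV_charge F Psi m"
proof -
  have "charge_op (vparity F a) = vparity F (charge_op a)" for a
    using charge_vec_even by (simp add: charge_op_def parity_F homogeneous_def)
  then show "x \<in> calV_charge F Psi m \<Longrightarrow> vparity (FM F) x \<in> calV_charge F Psi m"
    by (simp add: calV_charge_iff CV_parity parity_linear)
qed

end

section \<open>The lattice vertex superalgebra\<close>

lemma lin_ext_single [simp]: "lin_ext f (single i c) = cscale c (f i)"
  by (cases "c = 0") (simp_all add: lin_ext_def)

lemma lookup_lin_ext_diag:
  assumes "\<And>i. f i = single i (d i)"
  shows "lookup (lin_ext f x) k = d k * lookup x k"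
proof -
  have "lin_ext f x = (\<Sum>i\<in>keys x. single i (d i * lookup x i))"
    by (simp add: lin_ext_def assms mult.commute)
  then show ?thesis by (simp add: lookup_sum_keys)
qed

locale lattice_fock =
  fixes L :: "lat vsa"
  assumes lattice_vsa: "lattice_vsa L"
begin

lemma L_vsa: "vertex_superalgebra L" and L_scale: "vscale L = cscale" and L_vac: "vvac L = lat_exp 0"
  and L_heis: "vmode L (heis (-1) (lat_exp 0)) n = heis n"
  and L_exp: "vmode L (lat_exp m) n = lat_exp_mode m n"
  using lattice_vsa by (simp_all add: lattice_vsa_def)

lemma L_module: "vertex_module L UNIV cscale (vmode L) UNIV"
  using L_vsa unfolding vertex_superalgebra_def L_scale by blast

lemma L_linear:
  "vmode L (b + b') n c = vmode L b n c + vmode L b' n c"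
  "vmode L (cscale d b) n c = cscale d (vmode L b n c)"
  "vmode L b n (c + c') = vmode L b n c + vmode L b n c'"
  "vmode L b n (cscale d c) = cscale d (vmode L b n c)"
  "\<exists>N. \<forall>n\<ge>N. vmode L b n c = 0"
  using vertex_moduleD(4-8)[OF L_module] by (auto simp: L_scale)

lemma vmode_L_zero [simp]: "vmode L 0 n c = 0" "vmode L b n 0 = 0"
  using L_linear(1)[of 0 0 n c] L_linear(3)[of b n 0 0] by simp_all

lemma lookup_parity_L: "lookup (vparity L c) k = (-1) powi (fst k) * lookup c k"
proof -
  have "vparity L = lin_ext (\<lambda>(m, \<mu>). single (m, \<mu>) ((-1) powi m))"
    using lattice_vsa by (simp add: lattice_vsa_def)
  then show ?thesis
    by (simp add: lookup_lin_ext_diag[where d = "\<lambda>k. (-1) powi (fst k)"] split_beta)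
qed

lemma minus_one_powi: "(-1 :: complex) powi m = (if even m then 1 else -1)"
  by (simp add: power_int_minus_left)

lemma homogeneous_single_L: "homogeneous L (odd (fst k)) (single k 1)"
proof -
  have "vparity L (single k 1) = single k ((-1) powi (fst k))"
    by (rule poly_mapping_eqI) (simp add: lookup_parity_L lookup_single when_def)
  then show ?thesis by (simp add: homogeneous_def minus_one_powi single_uminus)
qed

lemma homogeneous_basis_L: "homogeneous L True (single k 1) \<longleftrightarrow> odd (fst k)"
proof -
  have "vparity L (single k 1) = single k ((-1) powi (fst k))"
    by (rule poly_mapping_eqI) (simp add: lookup_parity_L lookup_single when_def)
  moreover have "- single k (1 :: complex) = single k (-1)" by (simp add: single_uminus)
  moreover have "single k c = single k c' \<longleftrightarrow> c = c'" for c c' :: complex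
    by (metis lookup_single_eq)
  ultimately show ?thesis by (simp add: homogeneous_def minus_one_powi)
qed

lemma L_parity: "lookup (vparity L c) k = (if homogeneous L True (single k 1) then - lookup c k else lookup c k)"
  by (simp add: homogeneous_basis_L lookup_parity_L minus_one_powi)

lemma lookup_heis_0: "lookup (heis 0 c) k = - of_int (fst k) * lookup c k"
  unfolding heis_def by (rule lookup_lin_ext_diag) (simp add: split_beta)

abbreviation beta :: lat where "beta \<equiv> single (0, {#0#}) 1"

lemma beta_eq: "heis (-1) (lat_exp 0) = beta"
  by (simp add: heis_def lat_exp_def)

lemma beta_mode: "vmode L beta n = heis n"
  using L_heis by (simp add: beta_eq)

lemma heis_linear: "heis n (b + c) = heis n b + heis n c" "heis n (cscale d b) = cscale d (heis n b)" "heis n 0 = 0"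
  by (simp_all add: L_linear flip: beta_mode)

lemma heis_0_mode: "heis 0 (vmode L (single i 1) n c) = vmode L (heis 0 (single i 1)) n c + vmode L (single i 1) n (heis 0 c)"
proof -
  have "homogeneous L False beta"
    using homogeneous_single_L[of "(0, {#0#})"] by simp
  then have "vmode L beta 0 (vmode L (single i 1) n c) - cscale 1 (vmode L (single i 1) n (vmode L beta 0 c))
    = Sum_any (\<lambda>k. cscale (of_int 0 gchoose k) (vmode L (vmode L beta (int k) (single i 1)) (0 + n - int k) c))"
    using vertex_module_commutator[OF L_module UNIV_I UNIV_I _ homogeneous_single_L UNIV_I,
        where a = beta and p = False and m = 0 and n = n and u = c] by simp
  also have "\<dots> = vmode L (vmode L beta 0 (single i 1)) n c"
    by (subst Sum_any_single[of 0]) (simp_all add: gbinomial_0_left)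
  finally show ?thesis by (simp add: beta_mode algebra_simps)
qed

text \<open>\<beta>(0) is a derivation with eigenvalue -m on the sector m, so lattice degrees add
  under every product.\<close>

lemma vmode_L_sector:
  assumes "k \<in> keys (vmode L (single i 1) n (single j 1))"
  shows "fst k = fst i + fst j"
proof -
  have h: "heis 0 (single i 1) = cscale (- of_int (fst i)) (single i 1)" for i
    by (rule poly_mapping_eqI) (simp add: lookup_heis_0 lookup_single when_def)
  let ?c = "vmode L (single i 1) n (single j 1)"
  have "heis 0 ?c = cscale (- of_int (fst i) + - of_int (fst j)) ?c"
    unfolding cscale.scale_left_distrib by (simp only: heis_0_mode h L_linear)
  then have "lookup (heis 0 ?c) k = (- of_int (fst i) + - of_int (fst j)) * lookup ?c k"
    by (simp only: cmult.lookup_fscale)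
  then have "- of_int (fst k) * lookup ?c k = (- of_int (fst i) + - of_int (fst j)) * lookup ?c k"
    unfolding lookup_heis_0 .
  moreover have "lookup ?c k \<noteq> 0" using assms by (simp add: in_keys_iff)
  ultimately have "- of_int (fst k) = (- of_int (fst i) + - of_int (fst j) :: complex)"
    using mult_right_cancel by blast
  then have "of_int (fst k) = (of_int (fst i + fst j) :: complex)" by (simp add: algebra_simps)
  then show ?thesis by (simp only: of_int_eq_iff)
qed

lemma heis_exp_zero: "heis_exp c d N 0 = 0"
proof (induction N rule: less_induct)
  case (less N)
  then show ?case by (cases N) (simp_all add: heis_linear)
qed

lemma heis_exp_lat_exp: "heis_exp c 1 N (lat_exp q) = (if N = 0 then lat_exp q else 0)"
proof (induction N rule: less_induct)
  case (less N)
  show ?case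
  proof (cases N)
    case (Suc N')
    have "heis (int (Suc k)) (heis_exp c 1 (N' - k) (lat_exp q)) = 0" if "k \<le> N'" for k
      using less[of "N' - k"] Suc by (simp add: heis_linear) (simp add: lat_exp_def heis_def)
    then show ?thesis using Suc by simp
  qed simp
qed

text \<open>The annihilating half of the exponential fixes the vacuum vector of each sector, so only
  the creating half remains. The largest mode with a nonzero value, n = a m - 1, gives the vacuum
  vector of sector a + m up to the cocycle sign.\<close>

lemma vmode_lat_exp:
  "vmode L (lat_exp a) n (lat_exp m) = cscale ((-1) powi (a * m))
     (if n + 1 \<le> a * m then heis_exp (of_int a) (-1) (nat (a * m - n - 1)) (lat_exp (a + m)) else 0)"
proof -
  have e: "single (a + m, {#}) 1 = lat_exp (a + m)" by (simp add: lat_exp_def)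
  have "Sum_any (\<lambda>M::nat. if n + 1 \<le> int M + a * m then heis_exp (of_int a) (-1) (nat (int M + a * m - n - 1))
      (heis_exp (- of_int a) 1 M (single (a + m, {#}) 1)) else 0)
    = (if n + 1 \<le> a * m then heis_exp (of_int a) (-1) (nat (a * m - n - 1)) (lat_exp (a + m)) else 0)"
    unfolding e by (subst Sum_any_single[of 0]) (simp_all add: heis_exp_lat_exp heis_exp_zero)
  then show ?thesis
    unfolding L_exp lat_exp_mode_def by (simp add: lat_exp_def)
qed

end


section \<open>Coordinatewise direct sums\<close>

text \<open>Replaces spans of pure tensors by conditions on coordinates, the form in which W(0) and
  the summands of L_s(U) are handled.\<close>

lemma (in complex_space) tensor_subspace_eq:
  assumes A: "subspace A"
  shows "tensor_subspace scale A {w. keys w \<subseteq> K} = {x. \<forall>k. lookup x k \<in> A \<and> (k \<notin> K \<longrightarrow> lookup x k = 0)}"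
    (is "_ = ?R")
proof -
  interpret F: complex_space "fscale scale" by (rule complex_space_fscale)
  have R: "F.subspace ?R"
    using subspace_0[OF A] subspace_add[OF A] subspace_scale[OF A]
    unfolding F.subspace_def by (simp add: lookup_add)
  show ?thesis
  proof
    show "tensor_subspace scale A {w. keys w \<subseteq> K} \<subseteq> ?R"
      unfolding tensor_subspace_def
      by (intro F.span_minimal R) (auto simp: in_keys_iff subset_iff intro: subspace_scale[OF A])
    show "?R \<subseteq> tensor_subspace scale A {w. keys w \<subseteq> K}"
    proof
      fix x assume x: "x \<in> ?R"
      have "(\<Sum>k\<in>keys x. single k (lookup x k)) \<in> tensor_subspace scale A {w. keys w \<subseteq> K}"
        unfolding tensor_subspace_def
      proof (intro F.span_sum F.span_base CollectI exI conjI)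
        fix k assume "k \<in> keys x"
        then show "lookup x k \<in> A" "keys (single k (1 :: complex)) \<subseteq> K"
          using x by (auto simp: in_keys_iff)
      qed simp
      then show "x \<in> tensor_subspace scale A {w. keys w \<subseteq> K}" by (simp add: sum_single_lookup)
    qed
  qed
qed

lemma decomposes_THE:
  assumes "direct_sum s S G" "v \<in> S"
  shows "decomposes G v (THE f. decomposes G v f)"
    and "decomposes G v f \<Longrightarrow> (THE f. decomposes G v f) = f"
  using assms theI'[of "decomposes G v"] the1_equality[of "decomposes G v" f]
  unfolding direct_sum_def by blast+

text \<open>The decomposition may vary with the coordinate k. One instance has a single nonzero
  piece at each k and yields the summands of L_s(U); the other is the gradation of U shifted by the
  lattice degree of k and yields the sum of all L_s(U).\<close>

lemma (in complex_space) direct_sum_lookup: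
  fixes W :: "'k \<Rightarrow> 't \<Rightarrow> 'm set"
  assumes ds: "\<And>k. direct_sum scale (S k) (W k)"
  shows "direct_sum (fscale scale) {x. \<forall>k. lookup x k \<in> S k} (\<lambda>t. {x. \<forall>k. lookup x k \<in> W k t})"
proof -
  interpret F: complex_space "fscale scale" by (rule complex_space_fscale)
  have subS: "subspace (S k)" and subW: "subspace (W k t)" and WS: "W k t \<subseteq> S k" for k t
    using ds[of k] by (auto simp: direct_sum_def)
  have 1: "F.subspace {x. \<forall>k. lookup x k \<in> S k}"
    using subspace_0[OF subS] subspace_add[OF subS] subspace_scale[OF subS]
    unfolding F.subspace_def by (simp add: lookup_add)
  have 2: "F.subspace {x. \<forall>k. lookup x k \<in> W k t}" for t
    using subspace_0[OF subW] subspace_add[OF subW] subspace_scale[OF subW]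
    unfolding F.subspace_def by (simp add: lookup_add)
  define D where "D k v = (THE f. decomposes (W k) v f)" for k v
  have D: "decomposes (W k) v (D k v)" if "v \<in> S k" for k v
    unfolding D_def by (rule decomposes_THE(1)[OF ds that])
  have D_unique: "D k v = f" if "v \<in> S k" "decomposes (W k) v f" for k v f
    unfolding D_def by (rule decomposes_THE(2)[OF ds that])
  have D0: "D k 0 = (\<lambda>t. 0)" for k
    by (rule D_unique) (simp_all add: subspace_0[OF subS] decomposes_def subspace_0[OF subW])
  have ex: "\<exists>!g. decomposes (\<lambda>t. {x. \<forall>k. lookup x k \<in> W k t}) x g" if x: "\<forall>k. lookup x k \<in> S k" for x
  proof -
    define g where "g t = (\<Sum>k\<in>keys x. single k (D k (lookup x k) t))" for t
    have g: "lookup (g t) k = D k (lookup x k) t" for t k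
      unfolding g_def by (rule lookup_sum_keys) (simp add: D0)
    have fin: "finite {t. g t \<noteq> 0}"
    proof (rule finite_subset)
      show "{t. g t \<noteq> 0} \<subseteq> (\<Union>k\<in>keys x. {t. D k (lookup x k) t \<noteq> 0})"
        by (auto simp: g_def elim!: sum.not_neutral_contains_not_neutral)
      show "finite (\<Union>k\<in>keys x. {t. D k (lookup x k) t \<noteq> 0})"
        using D x by (auto simp: decomposes_def)
    qed
    have sum_g: "lookup (Sum_any g) k = lookup x k" for k
      using D[of "lookup x k" k] x by (simp add: lookup_Sum_any[OF fin] g decomposes_def)
    have "decomposes (\<lambda>t. {x. \<forall>k. lookup x k \<in> W k t}) x g"
      unfolding decomposes_def using fin sum_g D x
      by (auto simp: g intro!: poly_mapping_eqI) (auto simp: decomposes_def)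
    moreover have "f = g" if f: "decomposes (\<lambda>t. {x. \<forall>k. lookup x k \<in> W k t}) x f" for f
    proof (intro ext poly_mapping_eqI)
      fix t k
      have ff: "finite {t. f t \<noteq> 0}" "x = Sum_any f" "\<And>t k. lookup (f t) k \<in> W k t"
        using f by (auto simp: decomposes_def)
      have "decomposes (W k) (lookup x k) (\<lambda>t. lookup (f t) k)"
        unfolding decomposes_def
      proof (intro conjI allI)
        show "finite {t. lookup (f t) k \<noteq> 0}" by (rule finite_subset[OF _ ff(1)]) auto
        show "lookup x k = Sum_any (\<lambda>t. lookup (f t) k)"
          unfolding ff(2) by (rule lookup_Sum_any[OF ff(1)])
      qed (rule ff(3))
      then show "lookup (f t) k = lookup (g t) k" using D_unique[of "lookup x k" k] x g by metis
    qed
    ultimately show ?thesis by blast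
  qed
  have 3: "{x. \<forall>k. lookup x k \<in> W k t} \<subseteq> {x. \<forall>k. lookup x k \<in> S k}" for t
    using WS by blast
  show ?thesis unfolding direct_sum_def using 1 2 3 ex by blast
qed

text \<open>One degree count for two closures: with W the shifted gradation of U it gives stability
  of L_s(U) under W(0), and with W the charge spaces it gives closure of W(0) under
  products.\<close>

lemma (in tensor_modes) TM_graded:
  fixes d :: "'i \<Rightarrow> int" and W :: "int \<Rightarrow> 'm set"
  assumes B_d: "\<And>i j n k. k \<in> keys (vmode B (single i 1) n (single j 1)) \<Longrightarrow> d k = d i + d j"
    and W: "\<And>p. VM.subspace (W p)" "\<And>p u. u \<in> W p \<Longrightarrow> par u \<in> W p"
    and CW: "\<And>p q a u n. a \<in> C p \<Longrightarrow> u \<in> W q \<Longrightarrow> YM a n u \<in> W (p + q)"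
    and x: "\<And>i. lookup x i \<in> C (d i)" and y: "\<And>j. lookup y j \<in> W (d j)"
  shows "lookup (TM x n y) k \<in> W (d k)"
proof -
  let ?S = "{z. \<forall>k. lookup z k \<in> W (d k)}"
  have S: "FT.subspace ?S"
    using VM.subspace_0[OF W(1)] VM.subspace_add[OF W(1)] VM.subspace_scale[OF W(1)]
    unfolding FT.subspace_def by (simp add: lookup_add)
  have "tm (lookup x i) i n (lookup y j) j \<in> ?S" for i j
    unfolding tm_def
  proof (intro FT.subspace_Sum_any S CollectI allI)
    fix l k
    have u: "par_if (odd_basis i) (lookup y j) \<in> W (d j)" using W(2) y by (simp add: par_if_def)
    let ?c = "vmode B (single i 1) (n - l - 1) (single j 1)"
    show "lookup (tens sM (YM (lookup x i) l (par_if (odd_basis i) (lookup y j))) ?c) k \<in> W (d k)"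
    proof (cases "k \<in> keys ?c")
      case True
      then show ?thesis using CW[OF x u] B_d[OF True] by (simp add: VM.subspace_scale[OF W(1)])
    next
      case False
      then show ?thesis using VM.subspace_0[OF W(1)] by (simp add: in_keys_iff)
    qed
  qed
  then have "TM x n y \<in> ?S" unfolding TM_tm by (intro FT.subspace_sum S)
  then show ?thesis by simp
qed


section \<open>The modules \<open>\<L>\<^sub>s(U)\<close>\<close>

locale graded_module = clifford F Psi + lattice_fock L
  for F :: "'f::ab_group_add vsa" and Psi :: "pm \<Rightarrow> int \<Rightarrow> 'f \<Rightarrow> 'f" and L :: "lat vsa" +
  fixes sU :: "complex \<Rightarrow> 'u::ab_group_add \<Rightarrow> 'u"
    and YU :: "'f fm \<Rightarrow> int \<Rightarrow> 'u \<Rightarrow> 'u"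
    and U :: "int \<Rightarrow> 'u set"
  assumes U_module: "vertex_module (FM F) (calV F Psi) sU YU UNIV"
    and U_sum: "direct_sum sU UNIV U"
    and U_graded: "\<And>i j. mode_span sU YU (calV_charge F Psi i) (U j) \<subseteq> U (i + j)"
begin

sublocale U: complex_space sU
  by (simp add: complex_space_def vertex_moduleD(1)[OF U_module])

lemma subspace_U: "U.subspace (U i)"
  using U_sum by (simp add: direct_sum_def)

lemma YU_graded:
  assumes "a \<in> calV_charge F Psi i" "u \<in> U j"
  shows "YU a n u \<in> U (i + j)"
proof -
  have "YU a n u \<in> mode_span sU YU (calV_charge F Psi i) (U j)"
    unfolding mode_span_def by (rule U.span_base) (use assms in blast)
  then show ?thesis using U_graded[of i j] by (rule subsetD[rotated])
qed

definition cmp :: "int \<Rightarrow> 'u \<Rightarrow> 'u" where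
  "cmp i v = (THE f. decomposes U v f) i"

lemma cmp: "decomposes U v (\<lambda>i. cmp i v)"
  using decomposes_THE(1)[OF U_sum, of v] by (simp add: cmp_def)

lemma cmp_unique: "decomposes U v f \<Longrightarrow> cmp i v = f i"
  using decomposes_THE(2)[OF U_sum, of v f] by (simp add: cmp_def)

lemma cmp_in_U: "cmp i v \<in> U i" and finite_cmp: "finite {i. cmp i v \<noteq> 0}" and Sum_any_cmp: "Sum_any (\<lambda>i. cmp i v) = v"
  using cmp[of v] by (auto simp: decomposes_def)

lemma cmp_add: "cmp i (v + w) = cmp i v + cmp i w"
proof (rule cmp_unique)
  have "finite {i. cmp i v + cmp i w \<noteq> 0}"
    by (rule finite_subset[OF _ finite_UnI[OF finite_cmp[of v] finite_cmp[of w]]]) auto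
  then show "decomposes U (v + w) (\<lambda>i. cmp i v + cmp i w)"
    by (simp add: decomposes_def U.subspace_add[OF subspace_U] cmp_in_U Sum_any.distrib finite_cmp Sum_any_cmp)
qed

lemma cmp_scale: "cmp i (sU c v) = sU c (cmp i v)"
proof (rule cmp_unique)
  have "finite {i. sU c (cmp i v) \<noteq> 0}"
    by (rule finite_subset[OF _ finite_cmp[of v]]) auto
  then show "decomposes U (sU c v) (\<lambda>i. sU c (cmp i v))"
    by (simp add: decomposes_def U.subspace_scale[OF subspace_U] cmp_in_U Sum_any_cmp finite_cmp flip: U.scale_Sum_any)
qed

lemma cmp_homogeneous: "v \<in> U j \<Longrightarrow> cmp i v = (if i = j then v else 0)"
proof (rule cmp_unique[where f = "\<lambda>i. if i = j then v else 0"])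
  assume "v \<in> U j"
  then show "decomposes U v (\<lambda>i. if i = j then v else 0)"
    using U.subspace_0[OF subspace_U] by (auto simp: decomposes_def)
qed

lemma cmp_zero [simp]: "cmp i 0 = 0"
  using cmp_add[of i 0 0] by simp

lemma cmp_Sum_any: "finite {x. f x \<noteq> 0} \<Longrightarrow> cmp i (Sum_any f) = Sum_any (\<lambda>x. cmp i (f x))"
  by (rule Sum_any_hom) (simp_all add: cmp_add)

lemma cmp_eqI:
  assumes "\<And>i. cmp i v = cmp i w"
  shows "v = w"
proof -
  have "v = Sum_any (\<lambda>i. cmp i v)" by (rule Sum_any_cmp[symmetric])
  also have "\<dots> = Sum_any (\<lambda>i. cmp i w)" by (rule Sum_any.cong) (rule assms)
  also have "\<dots> = w" by (rule Sum_any_cmp)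
  finally show ?thesis .
qed

abbreviation par :: "'u \<Rightarrow> 'u" where "par \<equiv> grade_sign sU U"

lemma cmp_par: "cmp i (par v) = sU ((-1) powi i) (cmp i v)"
proof -
  have fin: "finite {j. sU ((-1) powi j) (cmp j v) \<noteq> 0}"
    by (rule finite_subset[OF _ finite_cmp[of v]]) auto
  have "par v = Sum_any (\<lambda>j. sU ((-1) powi j) (cmp j v))"
    by (simp add: grade_sign_def cmp_def)
  then have "decomposes U (par v) (\<lambda>j. sU ((-1) powi j) (cmp j v))"
    using fin by (simp add: decomposes_def U.subspace_scale[OF subspace_U] cmp_in_U)
  then show ?thesis by (rule cmp_unique)
qed

lemma par_linear: "par (v + w) = par v + par w" "par (sU c v) = sU c (par v)"
  by (rule cmp_eqI; simp add: cmp_par cmp_add cmp_scale U.scale_right_distrib mult.commute)+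

lemma par_par: "par (par v) = v"
  by (rule cmp_eqI) (simp add: cmp_par minus_one_powi)

lemma par_U: "u \<in> U i \<Longrightarrow> par u = sU ((-1) powi i) u"
  by (rule cmp_eqI) (simp add: cmp_par cmp_scale cmp_homogeneous)

lemma YU_linear:
  "a \<in> CV \<Longrightarrow> YU a n (u + w) = YU a n u + YU a n w"
  "a \<in> CV \<Longrightarrow> YU a n (sU c u) = sU c (YU a n u)"
  "a \<in> CV \<Longrightarrow> b \<in> CV \<Longrightarrow> YU (a + b) n u = YU a n u + YU b n u"
  "a \<in> CV \<Longrightarrow> YU (fscale (vscale F) c a) n u = sU c (YU a n u)"
  "a \<in> CV \<Longrightarrow> \<exists>N. \<forall>n\<ge>N. YU a n u = 0"
  using vertex_moduleD(4-8)[OF U_module] by simp_all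

lemma YU_zero: "a \<in> CV \<Longrightarrow> YU a n 0 = 0"
  using YU_linear(1)[of a n 0 0] by simp

lemma calV_charge_CV: "a \<in> calV_charge F Psi i \<Longrightarrow> a \<in> CV"
  by (simp add: calV_charge_def)

lemma cmp_YU:
  assumes a: "a \<in> calV_charge F Psi i"
  shows "cmp j (YU a n u) = YU a n (cmp (j - i) u)"
proof -
  note aV = calV_charge_CV[OF a]
  have "YU a n u = YU a n (Sum_any (\<lambda>l. cmp l u))" by (simp add: Sum_any_cmp)
  also have "\<dots> = Sum_any (\<lambda>l. YU a n (cmp l u))"
    using aV by (intro Sum_any_hom finite_cmp) (simp_all add: YU_linear YU_zero)
  finally have "cmp j (YU a n u) = cmp j (Sum_any (\<lambda>l. YU a n (cmp l u)))" by simp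
  also have "\<dots> = Sum_any (\<lambda>l. cmp j (YU a n (cmp l u)))"
    by (intro cmp_Sum_any finite_subset[OF _ finite_cmp[of u]]) (use aV in \<open>auto simp: YU_zero\<close>)
  also have "\<dots> = Sum_any (\<lambda>l. if l = j - i then YU a n (cmp l u) else 0)"
    by (intro Sum_any.cong) (auto simp: cmp_homogeneous[OF YU_graded[OF a cmp_in_U]])
  finally show ?thesis by simp
qed

text \<open>A vector of charge m shifts degrees by m and has parity m mod 2, so the sign taken from
  the degree of U behaves as a parity. \<open>CV_span\<close> extends this to all of calV.\<close>

lemma par_YU:
  assumes "a \<in> CV"
  shows "par (YU a n u) = YU (vparity (FM F) a) n (par u)"
proof -
  have hom: "par (YU a n u) = YU (vparity (FM F) a) n (par u)"
    if a: "a \<in> CV" "a \<in> comp_space (charged m)" for a m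
  proof (rule cmp_eqI)
    fix i
    have "(-1 :: complex) powi i = (-1) powi m * (-1) powi (i - m)"
      by (simp add: power_int_diff)
    then show "cmp i (par (YU a n u)) = cmp i (YU (vparity (FM F) a) n (par u))"
      using a charged_calV_charge[OF a]
      by (simp add: cmp_par cmp_YU parity_FM_charged YU_linear cmp_scale)
  qed
  have "a \<in> CV \<and> par (YU a n u) = YU (vparity (FM F) a) n (par u)"
    if "a \<in> FM.FT.span (\<Union>m. CV \<inter> comp_space (charged m))"
    using that
  proof (induction rule: FM.FT.span_induct_alt)
    case base
    have "vparity (FM F) 0 = 0" by (rule poly_mapping_eqI) simp
    moreover have "YU 0 n w = 0" for w
      using YU_linear(4)[OF vac_CV, of 0 n w] by simp
    moreover have "par 0 = 0" using par_linear(1)[of 0 0] by simp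
    ultimately show ?case using FM.FT.subspace_0[OF subspace_CV] by simp
  next
    case (step c x y)
    then have x: "x \<in> CV" "par (YU x n u) = YU (vparity (FM F) x) n (par u)" using hom by blast+
    show ?case
      using x step
      by (simp add: YU_linear par_linear parity_FM_linear FM.FT.subspace_add[OF subspace_CV]
          FM.FT.subspace_scale[OF subspace_CV] CV_parity)
  qed
  then show ?thesis using assms CV_span by blast
qed

sublocale T: tensor_module "FM F" CV sU YU par L
proof (unfold_locales)
  show "vertex_module (FM F) CV sU YU UNIV" by (rule U_module)
  show "vertex_superalgebra L" by (rule L_vsa)
  show "vscale L = cscale" by (rule L_scale)
  show "par (par u) = u" for u by (rule par_par)
  show "lookup (vparity L c) k = (if homogeneous L True (single k 1) then - lookup c k else lookup c k)" for c k
    by (rule L_parity)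
qed (simp_all add: FM.FT.vector_space_assms subspace_CV FM.TM_add_left FM.TM_add_right FM.TM_scale_left FM.TM_scale_right
    FM.TM_truncated parity_FM_linear YU_linear par_linear L_linear vac_CV CV_mode CV_parity par_YU)

lemma UF_mode_eq: "UF_mode sU YU U L = T.M.TM"
  by (simp add: UF_mode_def)

abbreviation WL :: "(int \<times> nat multiset \<Rightarrow>\<^sub>0 'f fm) set" where
  "WL \<equiv> W0 F Psi"

text \<open>Since \<beta>(0) is -m on the sector m, H(0) acts on the coordinate (m, \<mu>) as the
  charge operator minus m.\<close>

lemma W0_iff: "x \<in> WL \<longleftrightarrow> (\<forall>k. lookup x k \<in> calV_charge F Psi (fst k))"
proof -
  have sub: "tensor_subspace (fscale (vscale F)) CV (UNIV :: lat set) = {x. \<forall>k. lookup x k \<in> CV}"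
    using FM.FT.tensor_subspace_eq[OF subspace_CV, of UNIV] by (simp del: split_paired_All)
  have J0: "Jf0 F Psi 0 = 0"
    by (rule poly_mapping_eqI) (simp add: charge_op_def)
  have 1: "lookup (tensor_op (fscale (vscale F)) (Jf0 F Psi) id x) k = Jf0 F Psi (lookup x k)" for k
    by (simp add: tensor_op_def lookup_sum_keys J0)
  have h: "heis 0 (single i 1) = single i (- of_int (fst i))" for i
    by (rule poly_mapping_eqI) (simp add: lookup_heis_0 lookup_single when_def)
  have 2: "lookup (tensor_op (fscale (vscale F)) id (heis 0) x) k = fscale (vscale F) (- of_int (fst k)) (lookup x k)" for k
    by (simp add: tensor_op_def h lookup_sum_keys)
  have "H0 F Psi x = 0 \<longleftrightarrow> (\<forall>k. Jf0 F Psi (lookup x k) = fscale (vscale F) (of_int (fst k)) (lookup x k))"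
  proof -
    have "H0 F Psi x = 0 \<longleftrightarrow> (\<forall>k. lookup (H0 F Psi x) k = 0)"
      by (metis lookup_zero poly_mapping_eqI)
    moreover have "lookup (H0 F Psi x) k = 0 \<longleftrightarrow> Jf0 F Psi (lookup x k) = fscale (vscale F) (of_int (fst k)) (lookup x k)" for k
      unfolding H0_def lookup_add FM_simps 1 2 by (simp add: FM.FT.scale_minus_left)
    ultimately show ?thesis by simp
  qed
  then show ?thesis by (auto simp: W0_def sub calV_charge_def simp del: split_paired_All)
qed

lemma W0_comp_space: "WL \<subseteq> comp_space CV"
proof
  fix x assume "x \<in> WL"
  then have "lookup x k \<in> CV" for k unfolding W0_iff by (blast intro: calV_charge_CV)
  then show "x \<in> comp_space CV" unfolding comp_space_def by blast
qed

lemma Lsummand_iff: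
  "Lsummand sU U s i = {x. \<forall>k. lookup x k \<in> (if i = fst k + s then U i else {0})}"
proof -
  have sec: "lat_sector m = {w. keys w \<subseteq> {k. fst k = m}}" for m
    by (auto simp: lat_sector_def)
  show ?thesis
    unfolding Lsummand_def sec U.tensor_subspace_eq[OF subspace_U]
    using U.subspace_0[OF subspace_U] by (fastforce split: if_splits)
qed

lemma U_direct_sum_if: "direct_sum sU (U j) (\<lambda>i. if i = j then U i else {0})"
proof -
  have "\<exists>!f. decomposes (\<lambda>i. if i = j then U i else {0}) v f" if v: "v \<in> U j" for v
  proof (rule ex1I[of _ "\<lambda>i. if i = j then v else 0"])
    show "decomposes (\<lambda>i. if i = j then U i else {0}) v (\<lambda>i. if i = j then v else 0)"
      using v by (auto simp: decomposes_def)
    fix f assume "decomposes (\<lambda>i. if i = j then U i else {0}) v f"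
    then have f: "\<And>i. i \<noteq> j \<Longrightarrow> f i = 0" "v = Sum_any f"
      by (auto simp: decomposes_def split: if_splits)
    have "Sum_any f = f j" by (rule Sum_any_single) (rule f(1))
    then show "f = (\<lambda>i. if i = j then v else 0)" using f by auto
  qed
  then show ?thesis
    using subspace_U U.subspace_0[OF subspace_U] U.subspace_single_0
    by (auto simp: direct_sum_def)
qed

lemma U_direct_sum_shift: "direct_sum sU UNIV (\<lambda>s. U (m + s))"
proof -
  have bij: "bij (\<lambda>s::int. m + s)"
    by (rule bij_betw_byWitness[where f' = "\<lambda>s. s - m"]) auto
  have "\<exists>!f. decomposes (\<lambda>s. U (m + s)) v f" for v
  proof (rule ex1I[of _ "\<lambda>s. cmp (m + s) v"])
    have "{s. cmp (m + s) v \<noteq> 0} = (\<lambda>s. m + s) -` {i. cmp i v \<noteq> 0}" by auto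
    then have "finite {s. cmp (m + s) v \<noteq> 0}"
      using finite_vimageI[OF finite_cmp[of v] bij_is_inj[OF bij]] by simp
    then show "decomposes (\<lambda>s. U (m + s)) v (\<lambda>s. cmp (m + s) v)"
      using Sum_any_reindex_bij[OF bij, of "\<lambda>i. cmp i v"] by (simp add: decomposes_def cmp_in_U Sum_any_cmp)
    fix f assume f: "decomposes (\<lambda>s. U (m + s)) v f"
    have "decomposes U v (\<lambda>i. f (i - m))"
      unfolding decomposes_def
    proof (intro conjI allI)
      have bij': "bij (\<lambda>i::int. i - m)"
        by (rule bij_betw_byWitness[where f' = "\<lambda>s. s + m"]) auto
      have "{i. f (i - m) \<noteq> 0} = (\<lambda>i. i - m) -` {s. f s \<noteq> 0}" by auto
      then show "finite {i. f (i - m) \<noteq> 0}"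
        using f finite_vimageI[OF _ bij_is_inj[OF bij'], of "{s. f s \<noteq> 0}"] by (simp add: decomposes_def)
      show "v = Sum_any (\<lambda>i. f (i - m))"
        using f Sum_any_reindex_bij[OF bij', of f] by (simp add: decomposes_def)
      fix i
      have "f (i - m) \<in> U (m + (i - m))" using f unfolding decomposes_def by blast
      then show "f (i - m) \<in> U i" by simp
    qed
    then show "f = (\<lambda>s. cmp (m + s) v)" by (auto simp: cmp_unique)
  qed
  then show ?thesis using subspace_U by (simp add: direct_sum_def U.subspace_UNIV)
qed

text \<open>\<open>Lmod\<close> in coordinates: the summand with index i sits in the sector m = -s +
  i, so the coordinate at (m, \<mu>) has degree i = m + s.\<close>

definition Ls :: "int \<Rightarrow> (int \<times> nat multiset \<Rightarrow>\<^sub>0 'u) set" where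
  "Ls s = {x. \<forall>k. lookup x k \<in> U (fst k + s)}"

lemma Ls_D: "x \<in> Ls s \<Longrightarrow> lookup x k \<in> U (fst k + s)"
  by (simp add: Ls_def del: split_paired_All)

lemma direct_sum_Lsummand: "direct_sum (fscale sU) (Ls s) (Lsummand sU U s)"
proof -
  have "direct_sum (fscale sU) {x. \<forall>k. lookup x k \<in> U (fst k + s)}
      (\<lambda>i. {x. \<forall>k. lookup x k \<in> (if i = fst k + s then U i else {0})})"
    by (rule U.direct_sum_lookup) (rule U_direct_sum_if)
  then show ?thesis unfolding Ls_def Lsummand_iff .
qed

lemma Lmod_eq: "Lmod sU U s = Ls s"
proof
  show "Lmod sU U s \<subseteq> Ls s"
    unfolding Lmod_def using direct_sum_Lsummand[of s]
    by (intro T.M.FT.span_minimal) (auto simp: direct_sum_def)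
  show "Ls s \<subseteq> Lmod sU U s"
  proof
    fix x assume "x \<in> Ls s"
    then obtain f where "decomposes (Lsummand sU U s) x f"
      using direct_sum_Lsummand[of s] unfolding direct_sum_def by blast
    then have f: "\<And>i. f i \<in> Lsummand sU U s i" "x = Sum_any f" by (auto simp: decomposes_def)
    show "x \<in> Lmod sU U s"
      unfolding f(2) Lmod_def
      by (rule T.M.FT.subspace_Sum_any[OF T.M.FT.subspace_span]) (use f(1) in \<open>auto intro: T.M.FT.span_base\<close>)
  qed
qed

lemma direct_sum_Ls: "direct_sum (fscale sU) UNIV Ls"
proof -
  have "direct_sum (fscale sU) {x. \<forall>k. lookup x k \<in> UNIV} (\<lambda>s. {x. \<forall>k. lookup x k \<in> U (fst k + s)})"
    by (rule U.direct_sum_lookup) (rule U_direct_sum_shift)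
  then show ?thesis by (simp add: Ls_def[abs_def])
qed

lemma subspace_Ls: "T.M.FT.subspace (Ls s)"
  using direct_sum_Ls by (simp add: direct_sum_def)

lemma W0_Ls_closed:
  assumes "x \<in> WL" "y \<in> Ls s"
  shows "T.M.TM x n y \<in> Ls s"
proof -
  have "lookup (T.M.TM x n y) k \<in> U (fst k + s)" for k
  proof (rule T.M.TM_graded[where C = "calV_charge F Psi" and W = "\<lambda>p. U (p + s)"])
    show "YU a n u \<in> U (p + q + s)" if "a \<in> calV_charge F Psi p" "u \<in> U (q + s)" for p q a u n
      using YU_graded[OF that] by (simp add: add.assoc)
    show "par u \<in> U (p + s)" if "u \<in> U (p + s)" for p u
      using that by (simp add: par_U U.subspace_scale[OF subspace_U])
  qed (use assms in \<open>simp_all add: vmode_L_sector subspace_U W0_iff Ls_def del: split_paired_All\<close>)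
  then show ?thesis unfolding Ls_def by blast
qed

lemma W0_closed:
  assumes "x \<in> WL" "y \<in> WL"
  shows "T.V.TM x n y \<in> WL"
proof -
  have "lookup (T.V.TM x n y) k \<in> calV_charge F Psi (fst k)" for k
    by (rule T.V.TM_graded[where C = "calV_charge F Psi" and W = "calV_charge F Psi"])
      (use assms in \<open>simp_all add: subspace_calV_charge vmode_L_sector W0_iff calV_charge_parity calV_charge_mode del: split_paired_All\<close>)
  then show ?thesis by (simp add: W0_iff)
qed

theorem Ls_W0_module: "vertex_module (tensor_vsa (FM F) L) WL (fscale sU) T.M.TM (Ls s)"
  by (rule vertex_module_restrict[OF T.vertex_module_tensor W0_comp_space])
    (simp_all add: subspace_Ls W0_Ls_closed)

end

section \<open>Schur's lemma for countably generated irreducible modules\<close>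

locale space_endo = complex_space scale
  for scale :: "complex \<Rightarrow> 'm::ab_group_add \<Rightarrow> 'm" +
  fixes T :: "'m \<Rightarrow> 'm"
  assumes T_add: "T (u + v) = T u + T v" and T_scale: "T (scale c u) = scale c (T u)"
begin

text \<open>The value of the polynomial p at the operator T, applied to u.\<close>

definition ev :: "complex poly \<Rightarrow> 'm \<Rightarrow> 'm" where
  "ev p u = (\<Sum>i\<le>degree p. scale (coeff p i) ((T ^^ i) u))"

lemma T_zero [simp]: "T 0 = 0"
  using T_add[of 0 0] by simp

lemma T_sum: "T (sum f S) = (\<Sum>i\<in>S. T (f i))"
  by (induction S rule: infinite_finite_induct) (simp_all add: T_add)

lemma funpow_T_linear: "(T ^^ i) (u + v) = (T ^^ i) u + (T ^^ i) v" "(T ^^ i) (scale c u) = scale c ((T ^^ i) u)"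
  by (induction i) (simp_all add: T_add T_scale)

lemma ev_bound: "degree p \<le> n \<Longrightarrow> ev p u = (\<Sum>i\<le>n. scale (coeff p i) ((T ^^ i) u))"
  unfolding ev_def by (rule sum.mono_neutral_left) (auto simp: coeff_eq_0)

lemma ev_add: "ev (p + q) u = ev p u + ev q u"
proof -
  let ?n = "max (degree p) (degree q)"
  have "ev (p + q) u = (\<Sum>i\<le>?n. scale (coeff (p + q) i) ((T ^^ i) u))"
    by (rule ev_bound) (rule degree_add_le_max)
  then show ?thesis
    by (simp add: ev_bound[of p ?n] ev_bound[of q ?n] scale_left_distrib sum.distrib)
qed

lemma ev_smult: "ev (smult c p) u = scale c (ev p u)"
proof -
  have "ev (smult c p) u = (\<Sum>i\<le>degree p. scale (coeff (smult c p) i) ((T ^^ i) u))"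
    by (rule ev_bound) (rule degree_smult_le)
  then show ?thesis by (simp add: ev_def scale_sum_right)
qed

lemma ev_0 [simp]: "ev 0 u = 0"
  by (simp add: ev_def)

lemma ev_linear: "ev p (u + v) = ev p u + ev p v" "ev p (scale c u) = scale c (ev p u)"
  by (simp_all add: ev_def funpow_T_linear scale_right_distrib sum.distrib scale_sum_right mult.commute)

lemma ev_sum: "ev (sum p S) u = (\<Sum>i\<in>S. ev (p i) u)"
  by (induction S rule: infinite_finite_induct) (simp_all add: ev_add)

lemma ev_zero_right [simp]: "ev p 0 = 0"
  using ev_linear(1)[of p 0 0] by simp

lemma ev_sum_right: "ev p (sum f S) = (\<Sum>i\<in>S. ev p (f i))"
  by (induction S rule: infinite_finite_induct) (simp_all add: ev_linear)

lemma ev_pCons0: "ev (pCons 0 p) u = T (ev p u)" "ev (pCons 0 p) u = ev p (T u)"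
proof -
  have "ev (pCons 0 p) u = (\<Sum>i\<le>Suc (degree p). scale (coeff (pCons 0 p) i) ((T ^^ i) u))"
    by (rule ev_bound) (rule degree_pCons_le)
  also have "\<dots> = (\<Sum>i\<le>degree p. scale (coeff p i) ((T ^^ Suc i) u))"
    by (subst sum.atMost_Suc_shift) simp
  finally have *: "ev (pCons 0 p) u = (\<Sum>i\<le>degree p. scale (coeff p i) ((T ^^ Suc i) u))" .
  show "ev (pCons 0 p) u = T (ev p u)"
    unfolding * by (simp add: ev_def T_sum T_scale)
  show "ev (pCons 0 p) u = ev p (T u)"
    unfolding * by (simp add: ev_def funpow_swap1)
qed

text \<open>A polynomial in T commutes with T - c. The first form peels off an outer factor for
  injectivity; the second lets T - c meet the resolvent vector first.\<close>

lemma ev_linear_factor: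
  "ev ([:- c, 1:] * p) u = T (ev p u) - scale c (ev p u)"
  "ev ([:- c, 1:] * p) u = ev p (T u - scale c u)"
proof -
  have eq: "[:- c, 1:] * p = smult (- c) p + pCons 0 p" by simp
  have *: "ev ([:- c, 1:] * p) u = scale (- c) (ev p u) + ev (pCons 0 p) u"
    unfolding eq ev_add ev_smult ..
  show "ev ([:- c, 1:] * p) u = T (ev p u) - scale c (ev p u)"
    unfolding * by (simp add: ev_pCons0(1))
  have "ev p (T u - scale c u) = ev p (T u + scale (- c) u)" by simp
  also have "\<dots> = ev p (T u) + scale (- c) (ev p u)" by (simp only: ev_linear)
  finally show "ev ([:- c, 1:] * p) u = ev p (T u - scale c u)"
    unfolding * ev_pCons0(2) by (simp add: add.commute)
qed

text \<open>Over the complex numbers p splits into linear factors, each of which is injective at T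
  when T has no eigenvectors.\<close>

lemma ev_injective:
  assumes inj: "\<forall>c u. T u = scale c u \<longrightarrow> u = 0"
  shows "p \<noteq> 0 \<Longrightarrow> ev p u = 0 \<Longrightarrow> u = 0"
proof (induction "degree p" arbitrary: p u rule: less_induct)
  case less
  show ?case
  proof (cases "degree p = 0")
    case True
    then obtain a where "p = [:a:]" by (auto elim: degree_eq_zeroE)
    then show ?thesis using less.prems by (simp add: ev_def)
  next
    case False
    then have "\<not> constant (poly p)" by (simp add: constant_degree)
    then obtain z where "poly p z = 0" using fundamental_theorem_of_algebra by blast
    then obtain q where q: "p = [:- z, 1:] * q" by (auto simp: poly_eq_0_iff_dvd elim: dvdE)
    have q0: "q \<noteq> 0" using q less.prems by auto
    have "degree p = Suc (degree q)" unfolding q using q0 by (subst degree_mult_eq) auto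
    moreover have "ev q u = 0"
      using less.prems(2) inj[rule_format, of "ev q u" z] by (simp add: q ev_linear_factor(1) del: mult_pCons_left)
    ultimately show ?thesis using less.hyps[of q u] q0 by simp
  qed
qed

text \<open>Applying the product of all T - d clears denominators: the relation becomes a polynomial
  in T that kills v, hence the zero polynomial. Evaluating it at c isolates \<open>a c\<close>, as
  in Lagrange interpolation.\<close>

lemma resolvent_independent:
  assumes inj: "\<forall>c u. T u = scale c u \<longrightarrow> u = 0"
    and w: "\<And>c. T (w c) - scale c (w c) = v" and v: "v \<noteq> 0" and S: "finite S"
    and sum0: "(\<Sum>c\<in>S. scale (a c) (w c)) = 0" and c: "c \<in> S"
  shows "a c = 0"
proof -
  define q where "q c = (\<Prod>d\<in>S - {c}. [:- d, 1:])" for c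
  have "ev (\<Prod>d\<in>S. [:- d, 1:]) (w c) = ev (q c) v" if "c \<in> S" for c
  proof -
    have "(\<Prod>d\<in>S. [:- d, 1:]) = [:- c, 1:] * q c"
      unfolding q_def by (rule prod.remove[OF S that])
    then show ?thesis by (simp only: ev_linear_factor(2) w)
  qed
  then have "ev (\<Sum>c\<in>S. smult (a c) (q c)) v = ev (\<Prod>d\<in>S. [:- d, 1:]) (\<Sum>c\<in>S. scale (a c) (w c))"
    by (simp add: ev_sum ev_smult ev_sum_right ev_linear)
  then have "ev (\<Sum>c\<in>S. smult (a c) (q c)) v = 0" using sum0 by simp
  then have "(\<Sum>c\<in>S. smult (a c) (q c)) = 0" using ev_injective[OF inj] v by blast
  then have "poly (\<Sum>d\<in>S. smult (a d) (q d)) c = 0" by simp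
  moreover have "poly (\<Sum>d\<in>S. smult (a d) (q d)) c = (\<Sum>d\<in>S. if d = c then a c * poly (q c) c else 0)"
    unfolding poly_sum
  proof (intro sum.cong refl)
    fix d assume "d \<in> S"
    have "poly (q d) c = 0" if "d \<noteq> c"
      unfolding q_def poly_prod using S c that by (intro prod_zero) auto
    then show "poly (smult (a d) (q d)) c = (if d = c then a c * poly (q c) c else 0)" by auto
  qed
  ultimately have "a c * poly (q c) c = 0" using S c by simp
  moreover have "poly (q c) c \<noteq> 0"
    unfolding q_def poly_prod using S by (simp add: prod_zero_iff)
  ultimately show ?thesis by simp
qed

text \<open>
  Otherwise \<open>T - c\<close> is invertible for all \<open>c\<close>, and the vectors \<open>(T - c)\<^sup>-\<^sup>1 v\<close> are uncountably many
  independent vectors in a space with a countable spanning set.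
\<close>

theorem schur_countable:
  assumes Ops: "countable Ops"
    and lin: "\<And>f u v c. f \<in> Ops \<Longrightarrow> f (u + v) = f u + f v" "\<And>f u c. f \<in> Ops \<Longrightarrow> f (scale c u) = scale c (f u)"
    and comm: "\<And>f u. f \<in> Ops \<Longrightarrow> T (f u) = f (T u)"
    and irr: "\<And>N. subspace N \<Longrightarrow> (\<And>f u. f \<in> Ops \<Longrightarrow> u \<in> N \<Longrightarrow> f u \<in> N) \<Longrightarrow> N = {0} \<or> N = UNIV"
  shows "\<exists>c. \<forall>u. T u = scale c u"
proof (rule ccontr)
  assume no: "\<nexists>c. \<forall>u. T u = scale c u"
  have inj: "\<forall>c u. T u = scale c u \<longrightarrow> u = 0"
  proof (intro allI impI)
    fix c u assume u: "T u = scale c u"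
    have "{u. T u = scale c u} = {0} \<or> {u. T u = scale c u} = UNIV"
      by (rule irr) (auto simp: subspace_def T_add T_scale scale_right_distrib mult.commute comm lin)
    then show "u = 0" using no u by blast
  qed
  have surj: "\<exists>u. T u - scale c u = v" for c v
  proof -
    have "range (\<lambda>u. T u - scale c u) = {0} \<or> range (\<lambda>u. T u - scale c u) = UNIV"
    proof (rule irr)
      show "subspace (range (\<lambda>u. T u - scale c u))"
        unfolding subspace_def
      proof (intro conjI ballI allI)
        show "0 \<in> range (\<lambda>u. T u - scale c u)" by (rule image_eqI[of _ _ 0]) auto
        fix x y assume "x \<in> range (\<lambda>u. T u - scale c u)" "y \<in> range (\<lambda>u. T u - scale c u)"
        then obtain u v where "x = T u - scale c u" "y = T v - scale c v" by blast
        then show "x + y \<in> range (\<lambda>u. T u - scale c u)"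
          by (intro image_eqI[of _ _ "u + v"]) (auto simp: T_add scale_right_distrib)
      next
        fix d x assume "x \<in> range (\<lambda>u. T u - scale c u)"
        then obtain u where "x = T u - scale c u" by blast
        then show "scale d x \<in> range (\<lambda>u. T u - scale c u)"
          by (intro image_eqI[of _ _ "scale d u"]) (auto simp: T_scale scale_right_diff_distrib mult.commute)
      qed
      fix f x assume f: "f \<in> Ops" and "x \<in> range (\<lambda>u. T u - scale c u)"
      then obtain u where "x = T u - scale c u" by blast
      moreover have "f (T u + scale (- c) u) = T (f u) + scale (- c) (f u)"
        using f by (simp only: lin comm)
      ultimately show "f x \<in> range (\<lambda>u. T u - scale c u)"
        by (intro image_eqI[of _ _ "f u"]) auto
    qed
    moreover have "range (\<lambda>u. T u - scale c u) \<noteq> {0}"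
    proof
      assume "range (\<lambda>u. T u - scale c u) = {0}"
      then have "T u - scale c u = 0" for u by blast
      then show False using no by simp
    qed
    ultimately have "v \<in> range (\<lambda>u. T u - scale c u)" by blast
    then obtain u where "v = T u - scale c u" by blast
    then show ?thesis by blast
  qed
  have "\<exists>v :: 'm. v \<noteq> 0"
  proof (rule ccontr)
    assume "\<nexists>v :: 'm. v \<noteq> 0"
    then have "T u = scale 0 u" for u by auto
    then show False using no by blast
  qed
  then obtain v :: 'm where v: "v \<noteq> 0" by blast
  define w where "w c = (SOME u. T u - scale c u = v)" for c
  have w: "T (w c) - scale c (w c) = v" for c
    unfolding w_def by (rule someI_ex[OF surj])
  \<comment> \<open>The images of v under words in the operators: countable because
    \<open>Ops\<close> is, and spanning by irreducibility.\<close>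
  define B where "B = (\<lambda>fs. foldr (\<lambda>f u. f u) fs v) ` lists Ops"
  have "v \<in> B" unfolding B_def by (rule image_eqI[of _ _ "[]"]) auto
  have f_span: "f u \<in> span B" if f: "f \<in> Ops" and "u \<in> span B" for f u
    using that(2)
  proof (induction rule: span_induct_alt)
    case base
    have "f 0 = 0" using lin(1)[OF f, of 0 0] by simp
    then show ?case by (simp add: span_zero)
  next
    case (step c x y)
    then obtain fs where "fs \<in> lists Ops" "x = foldr (\<lambda>f u. f u) fs v" by (auto simp: B_def)
    then have "f x \<in> B" unfolding B_def using f by (intro image_eqI[of _ _ "f # fs"]) auto
    then show ?case using step f by (simp add: lin span_add span_scale span_base)
  qed
  have "span B = {0} \<or> span B = UNIV" by (rule irr[OF subspace_span]) (rule f_span)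
  then have span_B: "span B = UNIV" using span_base[OF \<open>v \<in> B\<close>] v by blast
  have "countable B" unfolding B_def using Ops by simp
  then obtain b :: "nat \<Rightarrow> 'm" where b: "B = range b"
    using \<open>v \<in> B\<close> by (metis empty_iff range_from_nat_into)
  \<comment> \<open>The uncountably many resolvent vectors are distributed over countably many
    finite-dimensional spans. One span, with n generators, receives infinitely many of them, and n +
    1 of these are independent, a contradiction.\<close>
  have "\<exists>n. w c \<in> span (b ` {..<n})" for c
  proof -
    have "w c \<in> span B" using span_B by simp
    then obtain t r where t: "finite t" "t \<subseteq> B" "w c = (\<Sum>a\<in>t. scale (r a) a)"
      unfolding span_explicit by blast
    then obtain I where I: "finite I" "t = b ` I" using finite_subset_image[of t b UNIV] unfolding b by blast
    then obtain n where "I \<subseteq> {..<n}" using finite_nat_iff_bounded by blast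
    then have "t \<subseteq> b ` {..<n}" using I by auto
    then show ?thesis unfolding t(3) by (intro exI[of _ n] span_sum span_scale span_base) auto
  qed
  then have "(UNIV :: complex set) = (\<Union>n. {c. w c \<in> span (b ` {..<n})})" by blast
  moreover have "uncountable (UNIV :: complex set)" by (rule uncountable_UNIV_complex)
  ultimately have unc: "uncountable (\<Union>n. {c. w c \<in> span (b ` {..<n})})" by (rule subst)
  have "\<exists>n. infinite {c. w c \<in> span (b ` {..<n})}"
  proof (rule ccontr)
    assume "\<nexists>n. infinite {c. w c \<in> span (b ` {..<n})}"
    then have "countable (\<Union>n. {c. w c \<in> span (b ` {..<n})})"
      by (intro countable_UN) (auto intro: countable_finite)
    then show False using unc by blast
  qed
  then obtain n where "infinite {c. w c \<in> span (b ` {..<n})}" by blast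
  then obtain S where S: "S \<subseteq> {c. w c \<in> span (b ` {..<n})}" "finite S" "card S = Suc n"
    by (meson infinite_arbitrarily_large)
  have inj_w: "inj w"
  proof (rule injI)
    fix c d assume "w c = w d"
    then have "scale c (w c) = scale d (w c)" using w[of c] w[of d] by (metis diff_left_imp_eq)
    moreover have "w c \<noteq> 0" using w[of c] v by auto
    ultimately show "c = d" by simp
  qed
  have "independent (w ` S)"
  proof (rule independent_if_scalars_zero)
    show "finite (w ` S)" using S by simp
    fix f x assume sum: "(\<Sum>x\<in>w ` S. scale (f x) x) = 0" and "x \<in> w ` S"
    then obtain c where c: "c \<in> S" "x = w c" by blast
    have "(\<Sum>c\<in>S. scale (f (w c)) (w c)) = 0"
      using sum inj_w by (simp add: sum.reindex inj_on_subset)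
    from resolvent_independent[OF inj w v S(2) this c(1)] show "f x = 0" using c by simp
  qed
  moreover have "w ` S \<subseteq> span (b ` {..<n})" using S(1) by blast
  ultimately have "card (w ` S) \<le> card (b ` {..<n})"
    using independent_span_bound[of "b ` {..<n}" "w ` S"] by simp
  also have "\<dots> \<le> n" using card_image_le[of "{..<n}" b] by simp
  finally show False using S inj_w by (simp add: card_image inj_on_subset)
qed

end

section \<open>Irreducibility\<close>

context graded_module
begin

section \<open>Generators and central elements of calV acting on U\<close>

lemma homogeneous_charged: "a \<in> comp_space (charged m) \<Longrightarrow> homogeneous (FM F) (odd m) a"
  by (simp add: homogeneous_def parity_FM_charged minus_one_powi FM.FT.scale_minus_left)

lemma YU_vac: "YU (single {#} vac) n u = (if n = -1 then u else 0)"
  using vertex_moduleD(9)[OF U_module, of u n] by simp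

text \<open>The iterate formula writes the modes of a product through the modes of its two factors,
  so stability propagates from the four generators along \<open>CV_span_induct\<close>.\<close>

lemma closed_under_generators:
  assumes N: "U.subspace N" and gen: "\<And>g n u. g \<in> generators \<Longrightarrow> u \<in> N \<Longrightarrow> YU g n u \<in> N"
    and a: "a \<in> CV" and u: "u \<in> N"
  shows "YU a n u \<in> N"
proof -
  let ?P = "\<lambda>a. \<forall>n. \<forall>u\<in>N. YU a n u \<in> N"
  have "CV \<subseteq> FM.FT.span {a. ?P a \<and> (\<exists>m. a \<in> CV \<inter> comp_space (charged m))}"
  proof (rule CV_span_induct)
    show "?P (single {#} vac)" using U.subspace_0[OF N] by (simp add: YU_vac)
    show "?P g" if "g \<in> generators" for g using gen that by blast
    fix a b m m' k
    assume a: "a \<in> CV \<inter> comp_space (charged m)" "?P a" and b: "b \<in> CV \<inter> comp_space (charged m')" "?P b"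
    have "YU (FM.TM a k b) n u \<in> N" if u: "u \<in> N" for n u
    proof -
      have "YU (vmode (FM F) a k b) n u \<in> N"
        by (subst vertex_module_iterate[OF U_module _ _ homogeneous_charged homogeneous_charged])
          (use a b u in \<open>auto intro!: U.subspace_Sum_any N U.subspace_scale[OF N] U.subspace_diff[OF N] U.subspace_add[OF N]\<close>)
      then show ?thesis by simp
    qed
    then show "?P (FM.TM a k b)" by blast
  qed
  then have "a \<in> FM.FT.span {a. ?P a \<and> (\<exists>m. a \<in> CV \<inter> comp_space (charged m))}" using a by blast
  then have "a \<in> CV \<and> YU a n u \<in> N"
  proof (induction rule: FM.FT.span_induct_alt)
    case base
    have "YU 0 n u = 0" using YU_linear(4)[OF vac_CV, of 0 n u] by simp
    then show ?case using FM.FT.subspace_0[OF subspace_CV] U.subspace_0[OF N] by simp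
  next
    case (step c x y)
    then show ?case
      using u by (auto simp: YU_linear FM.FT.subspace_add[OF subspace_CV] FM.FT.subspace_scale[OF subspace_CV]
          intro!: U.subspace_add[OF N] U.subspace_scale[OF N])
  qed
  then show ?thesis ..
qed

lemma generator_charged:
  assumes "g \<in> generators"
  obtains m where "g \<in> comp_space (charged m)" "g \<in> CV"
  using assms tau_charged jvec_charged nuvec_charged generators_CV by blast

text \<open>The commutator formula involves only products of z with g of index \<ge> 0, and these
  vanish by \<open>FM_mode_vac_nonneg\<close>.\<close>

lemma central_commute:
  assumes z: "z \<in> {jvec F, nuvec F}" and g: "g \<in> generators"
  shows "YU z m (YU g n u) = YU g n (YU z m u)"
proof -
  obtain k where k: "g \<in> comp_space (charged k)" "g \<in> CV" by (rule generator_charged[OF g])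
  have zc: "z \<in> comp_space (charged 0)" "z \<in> CV" "\<And>i. \<exists>c. lookup z i = vscale F c vac"
    using z jvec_charged nuvec_charged generators_CV jvec_vac nuvec_vac by auto
  have z0: "YU 0 n u = 0" for n u using YU_linear(4)[OF vac_CV, of 0 n u] by simp
  have "YU z m (YU g n u) - YU g n (YU z m u)
    = Sum_any (\<lambda>i. sU (of_int m gchoose i) (YU (FM.TM z (int i) g) (m + n - int i) u))"
    using vertex_module_commutator[OF U_module zc(2) k(2) homogeneous_charged[OF zc(1)] homogeneous_charged[OF k(1)] UNIV_I,
        where m = m and n = n and u = u] by simp
  also have "\<dots> = 0" by (simp add: FM_mode_vac_nonneg[OF zc(3)] z0)
  finally show ?thesis by simp
qed

text \<open>Irreducibility is phrased through the generators because \<open>schur_countable\<close>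
  wants countably many operators: four generators with integer modes.\<close>

lemma central_scalar:
  assumes irr: "\<And>N. U.subspace N \<Longrightarrow> (\<And>g n u. g \<in> generators \<Longrightarrow> u \<in> N \<Longrightarrow> YU g n u \<in> N) \<Longrightarrow> N = {0} \<or> N = UNIV"
    and z: "z \<in> {jvec F, nuvec F}"
  shows "\<exists>c. \<forall>u. YU z m u = sU c u"
proof -
  have zC: "z \<in> CV" using z generators_CV by blast
  interpret E: space_endo sU "YU z m"
    by unfold_locales (simp_all add: YU_linear zC)
  show ?thesis
  proof (rule E.schur_countable[of "(\<lambda>p. YU (fst p) (snd p)) ` (generators \<times> UNIV)"])
    show "countable ((\<lambda>p. YU (fst p) (snd p)) ` (generators \<times> (UNIV :: int set)))"
      by (intro countable_image countable_SIGMA) (auto intro: countable_finite)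
    fix f assume "f \<in> (\<lambda>p. YU (fst p) (snd p)) ` (generators \<times> UNIV)"
    then obtain p where p: "f = YU (fst p) (snd p)" "p \<in> generators \<times> UNIV" by (rule imageE)
    define g n where "g = fst p" and "n = snd p"
    have f: "f = YU g n" unfolding g_def n_def by (rule p(1))
    have g: "g \<in> generators" unfolding g_def using p(2) unfolding mem_Times_iff by (rule conjunct1)
    have gC: "g \<in> CV" using g generators_CV by blast
    show "f (u + v) = f u + f v" "f (sU c u) = sU c (f u)" for u v c
      by (simp_all add: f YU_linear gC)
    show "YU z m (f u) = f (YU z m u)" for u
      unfolding f by (rule central_commute[OF z g])
  next
    fix N assume N: "U.subspace N" and cl: "\<And>f u. f \<in> (\<lambda>p. YU (fst p) (snd p)) ` (generators \<times> UNIV) \<Longrightarrow> u \<in> N \<Longrightarrow> f u \<in> N"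
    have "YU g n u \<in> N" if "g \<in> generators" "u \<in> N" for g n u
    proof (rule cl[OF _ that(2)])
      have "(g, n) \<in> generators \<times> UNIV" using that(1) by (rule SigmaI) (rule UNIV_I)
      then show "YU g n \<in> (\<lambda>p. YU (fst p) (snd p)) ` (generators \<times> UNIV)"
        by (intro image_eqI[of _ _ "(g, n)"]) (simp_all only: fst_conv snd_conv)
    qed
    then show "N = {0} \<or> N = UNIV" by (rule irr[OF N])
  qed
qed

section \<open>Heisenberg modes and vacuum vectors in the tensor product\<close>

definition hmode :: "int \<Rightarrow> (int \<times> nat multiset \<Rightarrow>\<^sub>0 'u) \<Rightarrow> (int \<times> nat multiset \<Rightarrow>\<^sub>0 'u)" where
  "hmode n = T.M.TM (single (0, {#0#}) (single {#} vac)) n"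

lemma hmode_tens: "hmode n (tens sU u c) = tens sU u (heis n c)"
proof -
  have "\<not> T.M.odd_basis (0, {#0#})"
    by (simp add: T.M.odd_basis_def homogeneous_basis_L)
  then have "hmode n (tens sU u c) = Sum_any (\<lambda>k. tens sU (YU (single {#} vac) k u) (vmode L beta (n - k - 1) c))"
    using T.TM_single_tens[OF vac_CV, of "(0, {#0#})" n u c] by (simp add: hmode_def T.M.par_if_def)
  also have "\<dots> = tens sU u (vmode L beta n c)"
    by (subst Sum_any_single[of "-1"]) (simp_all add: YU_vac)
  finally show ?thesis by (simp add: beta_mode)
qed

lemma single_comp_space: "a \<in> CV \<Longrightarrow> single k a \<in> comp_space CV"
  by (rule T.M.single_in_comp_space)

lemma lookup_hmode: "lookup (hmode n y) q = (\<Sum>k\<in>keys y. sU (lookup (heis n (single k 1)) q) (lookup y k))"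
proof -
  have "single k v = tens sU v (single k 1)" for k :: "int \<times> nat multiset" and v by simp
  moreover have "hmode n y = (\<Sum>k\<in>keys y. hmode n (single k (lookup y k)))"
    unfolding hmode_def by (rule T.TM_expand_right[OF single_comp_space[OF vac_CV]])
  ultimately have "hmode n y = (\<Sum>k\<in>keys y. tens sU (lookup y k) (heis n (single k 1)))"
    by (simp only: hmode_tens)
  then show ?thesis by (simp add: lookup_sum)
qed

lemma lookup_hmode_0: "lookup (hmode 0 y) k = sU (- of_int (fst k)) (lookup y k)"
proof -
  have "lookup (hmode 0 y) k = (\<Sum>i\<in>keys y. if k = i then sU (- of_int (fst i)) (lookup y i) else 0)"
    unfolding lookup_hmode by (intro sum.cong refl) (auto simp: lookup_heis_0 lookup_single when_def)
  then show ?thesis by (simp add: in_keys_iff)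
qed

text \<open>\<beta>(k + 1) is -(k + 1) times the derivative with respect to the variable \<beta>(-k
  - 1), whose exponent in \<open>add_mset k \<nu>\<close> is \<open>count \<nu> k + 1\<close>. The
  coefficient is never zero.\<close>

lemma lookup_hmode_pos:
  "lookup (hmode (int k + 1) y) (m, \<nu>)
    = sU (- of_nat ((k + 1) * (count \<nu> k + 1))) (lookup y (m, add_mset k \<nu>))"
proof -
  have h: "lookup (heis (int k + 1) (single q 1)) (m, \<nu>)
      = (if q = (m, add_mset k \<nu>) then - of_nat ((k + 1) * (count \<nu> k + 1)) else 0)" for q
  proof (cases q)
    case (Pair m' \<mu>)
    have "heis (int k + 1) (single q 1) = single (m', \<mu> - {#k#}) (- of_int (int k + 1) * of_nat (count \<mu> k))"
      by (simp add: heis_def Pair)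
    moreover have "(m', \<mu> - {#k#}) = (m, \<nu>) \<and> k \<in># \<mu> \<longleftrightarrow> q = (m, add_mset k \<nu>)"
      by (auto simp: Pair)
    ultimately show ?thesis
      by (cases "k \<in># \<mu>") (auto simp: lookup_single when_def Pair not_in_iff algebra_simps)
  qed
  show ?thesis
    unfolding lookup_hmode h by (simp add: if_distrib[of "\<lambda>c. sU c _"] in_keys_iff cong: if_cong)
qed

text \<open>
  Annihilation operators of the Heisenberg algebra and \<open>\<beta>(0)\<close> isolate a coefficient of an element
  of \<open>U \<otimes> F\<^sub>-\<^sub>1\<close> at a vacuum vector \<open>e^(m\<beta>)\<close>.
\<close>

lemma extract_vacuum:
  assumes N: "T.M.FT.subspace N" and h: "\<And>n y. y \<in> N \<Longrightarrow> hmode n y \<in> N"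
    and x: "x \<in> N" "x \<noteq> 0"
  shows "\<exists>m u. u \<noteq> 0 \<and> single (m, {#}) u \<in> N"
proof -
  \<comment> \<open>Each annihilator taken from \<nu> shortens all monomials by one. As \<nu> has
    maximal length, only vacuum coordinates are left at the end, and the one coming from (m, \<nu>)
    survives.\<close>
  have kill: "\<exists>y'\<in>N. lookup y' (m, {#}) \<noteq> 0 \<and> (\<forall>q\<in>keys y'. snd q = {#})"
    if "y \<in> N" "lookup y (m, \<nu>) \<noteq> 0" "\<And>q. q \<in> keys y \<Longrightarrow> size (snd q) \<le> size \<nu>" for y m \<nu>
    using that
  proof (induction \<nu> arbitrary: y)
    case empty
    then show ?case by auto
  next
    case (add k \<nu>)
    show ?case
    proof (rule add.IH)
      show "hmode (int k + 1) y \<in> N" by (rule h[OF add.prems(1)])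
      have "- of_nat ((k + 1) * (count \<nu> k + 1)) \<noteq> (0 :: complex)"
        by (simp del: of_nat_mult of_nat_add of_nat_Suc)
      then show "lookup (hmode (int k + 1) y) (m, \<nu>) \<noteq> 0"
        using add.prems(2) unfolding lookup_hmode_pos by simp
      fix q assume q: "q \<in> keys (hmode (int k + 1) y)"
      obtain m' \<mu> where qe: "q = (m', \<mu>)" by (cases q)
      have "lookup y (m', add_mset k \<mu>) \<noteq> 0"
        using q unfolding qe in_keys_iff lookup_hmode_pos by auto
      then show "size (snd q) \<le> size \<nu>"
        using add.prems(3)[of "(m', add_mset k \<mu>)"] by (simp add: qe in_keys_iff)
    qed
  qed
  \<comment> \<open>\<beta>(0) + m1 multiplies the sector m' by m1 - m': it deletes the sector m1
    and keeps the sector m up to a nonzero factor. Repetition leaves a single sector.\<close>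
  have separate: "\<exists>u. u \<noteq> 0 \<and> single (m, {#}) u \<in> N"
    if "finite S" "y \<in> N" "lookup y (m, {#}) \<noteq> 0" "\<And>q. q \<in> keys y \<Longrightarrow> snd q = {#} \<and> fst q \<in> insert m S" for S y m
    using that
  proof (induction S arbitrary: y)
    case empty
    have "lookup y q = lookup (single (m, {#}) (lookup y (m, {#}))) q" for q
    proof (cases "q = (m, {#})")
      case False
      then have "q \<notin> keys y" using empty.prems(3)[of q] by (cases q) auto
      then show ?thesis using False by (simp add: in_keys_iff lookup_single when_def)
    qed simp
    then have "y = single (m, {#}) (lookup y (m, {#}))" by (rule poly_mapping_eqI)
    then have "single (m, {#}) (lookup y (m, {#})) \<in> N" using empty.prems(1) by (rule subst)
    then show ?case using empty.prems(2) by blast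
  next
    case (insert m1 S)
    show ?case
    proof (cases "m1 = m")
      case True
      then show ?thesis using insert by auto
    next
      case False
      let ?y = "hmode 0 y + fscale sU (of_int m1) y"
      have l: "lookup ?y q = sU (of_int (m1 - fst q)) (lookup y q)" for q
        by (simp add: lookup_add lookup_hmode_0 U.scale_left_diff_distrib)
      show ?thesis
      proof (rule insert.IH)
        show "?y \<in> N"
          using insert.prems(1) h T.M.FT.subspace_add[OF N] T.M.FT.subspace_scale[OF N] by blast
        show "lookup ?y (m, {#}) \<noteq> 0"
          unfolding l using insert.prems(2) False by simp
        fix q assume "q \<in> keys ?y"
        then have "m1 \<noteq> fst q" "q \<in> keys y" unfolding in_keys_iff l by auto
        then show "snd q = {#} \<and> fst q \<in> insert m S" using insert.prems(3)[of q] by auto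
      qed
    qed
  qed
  have "keys x \<noteq> {}" using x by simp
  define M where "M = Max ((\<lambda>q. size (snd q)) ` keys x)"
  have "M \<in> (\<lambda>q. size (snd q)) ` keys x" unfolding M_def using \<open>keys x \<noteq> {}\<close> by (intro Max_in) auto
  then obtain m \<nu> where q: "(m, \<nu>) \<in> keys x" "M = size \<nu>" by force
  have "size (snd q) \<le> size \<nu>" if "q \<in> keys x" for q
    unfolding q(2)[symmetric] M_def using that by (intro Max_ge) auto
  then obtain y where y: "y \<in> N" "lookup y (m, {#}) \<noteq> 0" "\<forall>q\<in>keys y. snd q = {#}"
    using kill[of x m \<nu>] x q by (auto simp: in_keys_iff)
  have "\<exists>u. u \<noteq> 0 \<and> single (m, {#}) u \<in> N"
    by (rule separate[of "fst ` keys y" y]) (use y in auto)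
  then show ?thesis by blast
qed

lemma tens_lat_exp: "tens sU u (lat_exp m) = single (m, {#}) u"
  by (simp add: lat_exp_def)

lemma vmode_tau_single:
  assumes v: "v \<in> U i" and \<epsilon>: "\<epsilon> = 1 \<or> \<epsilon> = - 1" and a: "a \<in> CV"
  shows "\<exists>c. c \<noteq> 0 \<and> T.M.TM (single (\<epsilon>, {#}) a) n (single (m, {#}) v)
    = fscale sU c (Sum_any (\<lambda>k. tens sU (YU a k v)
        (if n - k \<le> \<epsilon> * m then heis_exp (of_int \<epsilon>) (-1) (nat (\<epsilon> * m - n + k)) (lat_exp (\<epsilon> + m)) else 0)))"
proof -
  let ?g = "\<lambda>n. if n + 1 \<le> \<epsilon> * m then heis_exp (of_int \<epsilon>) (-1) (nat (\<epsilon> * m - n - 1)) (lat_exp (\<epsilon> + m)) else 0"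
  \<comment> \<open>The sign of moving the odd lattice vector past v, of degree i, times the cocycle
    sign of \<epsilon> and m. The vector v must be homogeneous for the first to be a scalar.\<close>
  define c :: complex where "c = (if T.M.odd_basis (\<epsilon>, {#}) then (-1) powi i else 1) * (-1) powi (\<epsilon> * m)"
  have "T.M.par_if (T.M.odd_basis (\<epsilon>, {#})) v = sU (if T.M.odd_basis (\<epsilon>, {#}) then (-1) powi i else 1) v"
    by (simp add: T.M.par_if_def par_U[OF v])
  then have t: "tens sU (YU a k (T.M.par_if (T.M.odd_basis (\<epsilon>, {#})) v)) (vmode L (lat_exp \<epsilon>) (n - k - 1) (lat_exp m))
      = fscale sU c (tens sU (YU a k v) (?g (n - k - 1)))" for k
    using a by (simp add: YU_linear vmode_lat_exp c_def T.M.P.T_scale_left T.M.P.T_scale_right)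
  have "\<exists>N. \<forall>n\<ge>N. ?g n = 0" by (intro exI[of _ "\<epsilon> * m"]) auto
  from T.M.finite_two_sided[OF a this, of v n]
  have fin: "finite {k. tens sU (YU a k v) (?g (n - k - 1)) \<noteq> 0}" .
  have "T.M.TM (single (\<epsilon>, {#}) a) n (single (m, {#}) v)
    = Sum_any (\<lambda>k. tens sU (YU a k (T.M.par_if (T.M.odd_basis (\<epsilon>, {#})) v)) (vmode L (lat_exp \<epsilon>) (n - k - 1) (lat_exp m)))"
    using T.TM_single_tens[OF a, of "(\<epsilon>, {#})" n v "lat_exp m"] by (simp add: tens_lat_exp) (simp add: lat_exp_def)
  also have "\<dots> = fscale sU c (Sum_any (\<lambda>k. tens sU (YU a k v) (?g (n - k - 1))))"
    unfolding t by (rule T.M.FT.scale_Sum_any[OF fin, symmetric])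
  also have "(\<lambda>k. ?g (n - k - 1)) = (\<lambda>k. if n - k \<le> \<epsilon> * m then heis_exp (of_int \<epsilon>) (-1) (nat (\<epsilon> * m - n + k)) (lat_exp (\<epsilon> + m)) else 0)"
    by (auto simp: algebra_simps)
  finally have "T.M.TM (single (\<epsilon>, {#}) a) n (single (m, {#}) v)
    = fscale sU c (Sum_any (\<lambda>k. tens sU (YU a k v)
        (if n - k \<le> \<epsilon> * m then heis_exp (of_int \<epsilon>) (-1) (nat (\<epsilon> * m - n + k)) (lat_exp (\<epsilon> + m)) else 0)))"
    by (simp add: algebra_simps)
  moreover have "c \<noteq> 0" by (simp add: c_def)
  ultimately show ?thesis by blast
qed

text \<open>\<open>heis_exp\<close> is a polynomial in Heisenberg modes. This puts the non-extremal
  terms of a mode of e or f into N as soon as their vacuum parts are there.\<close>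

lemma tens_heis_exp:
  assumes N: "T.M.FT.subspace N" and h: "\<And>n y. y \<in> N \<Longrightarrow> hmode n y \<in> N" and w: "tens sU w b \<in> N"
  shows "tens sU w (heis_exp c d M b) \<in> N"
proof (induction M rule: less_induct)
  case (less M)
  show ?case
  proof (cases M)
    case 0
    then show ?thesis using w by simp
  next
    case (Suc M')
    have "tens sU w (heis (d * int (Suc k)) (heis_exp c d (M' - k) b)) \<in> N" if "k \<le> M'" for k
      using h[OF less[of "M' - k"], of "d * int (Suc k)"] Suc unfolding hmode_tens by simp
    then have "(\<Sum>k\<le>M'. tens sU w (heis (d * int (Suc k)) (heis_exp c d (M' - k) b))) \<in> N"
      by (intro T.M.FT.subspace_sum[OF N]) auto
    moreover have "tens sU w (sum f S) = (\<Sum>k\<in>S. tens sU w (f k))" for f :: "nat \<Rightarrow> lat" and S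
      by (induction S rule: infinite_finite_induct) (simp_all add: T.M.P.T_add_right)
    ultimately show ?thesis
      by (simp add: Suc T.M.P.T_scale_right T.M.FT.subspace_scale[OF N] del: of_nat_Suc)
  qed
qed

text \<open>
  In mode \<open>n = \<epsilon>m + k\<close> of \<open>a \<otimes> e^(\<epsilon>\<beta>)\<close> applied to \<open>v \<otimes> e^(m\<beta>)\<close>, the term with \<open>a\<^sub>k v\<close> is, up to sign,
  \<open>a\<^sub>k v \<otimes> e^((m+\<epsilon>)\<beta>)\<close>, and all other terms contain some \<open>a\<^sub>l v\<close> with \<open>l > k\<close>: downward
  induction on \<open>k\<close>.
\<close>

lemma tau_modes_closed:
  assumes N: "T.M.FT.subspace N" and h: "\<And>n y. y \<in> N \<Longrightarrow> hmode n y \<in> N"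
    and \<epsilon>: "\<epsilon> = 1 \<or> \<epsilon> = - 1" and a: "a \<in> CV"
    and aN: "\<And>n y. y \<in> N \<Longrightarrow> T.M.TM (single (\<epsilon>, {#}) a) n y \<in> N"
    and v: "v \<in> U i" "single (m, {#}) v \<in> N"
  shows "single (m + \<epsilon>, {#}) (YU a k v) \<in> N"
proof -
  obtain K where K: "\<forall>k\<ge>K. YU a k v = 0" using YU_linear(5)[OF a] by blast
  have *: "single (m + \<epsilon>, {#}) (YU a k v) \<in> N" if "k \<ge> K - int t" for t k
    using that
  proof (induction t arbitrary: k)
    case 0
    then show ?case using K T.M.FT.subspace_0[OF N] by simp
  next
    case (Suc t)
    let ?n = "\<epsilon> * m + k"
    let ?f = "\<lambda>l. tens sU (YU a l v)
        (if ?n - l \<le> \<epsilon> * m then heis_exp (of_int \<epsilon>) (-1) (nat (\<epsilon> * m - ?n + l)) (lat_exp (\<epsilon> + m)) else 0)"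
    obtain c where c: "c \<noteq> 0" "T.M.TM (single (\<epsilon>, {#}) a) ?n (single (m, {#}) v) = fscale sU c (Sum_any ?f)"
      using vmode_tau_single[OF v(1) \<epsilon> a, of ?n m] by blast
    have fk: "?f k = single (m + \<epsilon>, {#}) (YU a k v)"
      by (simp add: tens_lat_exp add.commute)
    have other: "?f l \<in> N" if "l \<noteq> k" for l
    proof (cases "l < k")
      case True
      then show ?thesis using T.M.FT.subspace_0[OF N] by simp
    next
      case False
      then have "single (m + \<epsilon>, {#}) (YU a l v) \<in> N" using that Suc by (intro Suc.IH) auto
      then have "tens sU (YU a l v) (lat_exp (\<epsilon> + m)) \<in> N" by (simp add: tens_lat_exp add.commute)
      from tens_heis_exp[OF N h this] show ?thesis using False by simp
    qed
    have sumN: "Sum_any ?f \<in> N"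
    proof -
      have "fscale sU (inverse c) (T.M.TM (single (\<epsilon>, {#}) a) ?n (single (m, {#}) v)) \<in> N"
        by (intro T.M.FT.subspace_scale[OF N] aN v(2))
      then show ?thesis using c by simp
    qed
    have fin: "finite {l. ?f l \<noteq> 0}"
    proof (rule finite_subset[of _ "{k..K}"])
      show "{l. ?f l \<noteq> 0} \<subseteq> {k..K}"
      proof
        fix l assume "l \<in> {l. ?f l \<noteq> 0}"
        then have "\<not> l \<ge> K" "\<not> l < k" using K by auto
        then show "l \<in> {k..K}" by simp
      qed
    qed simp
    show ?case
      using T.M.FT.subspace_summand[where f = ?f and k = k, OF N fin sumN other] unfolding fk .
  qed
  show ?thesis by (rule *[of "nat (K - k)" k]) linarith
qed

end

context graded_module
begin

section \<open>V inside W(0), and irreducibility of L_s(U)\<close>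

lemma single_W0: "a \<in> calV_charge F Psi m \<Longrightarrow> single (m, \<mu>) a \<in> WL"
  unfolding W0_iff by (auto simp: lookup_single when_def calV_charge_zero)

lemma evec_eq: "evec F Psi = single (1, {#}) (tau F Psi Plus)"
  and fvec_eq: "fvec F Psi = single (-1, {#}) (tau F Psi Minus)"
  by (simp_all add: evec_def fvec_def lat_exp_def)

lemma hvec_eq: "hvec F = fscale (vscale (FM F)) (-2)
    (single (0, {#0#}) (single {#} vac) - single (0, {#}) (jvec F))"
  unfolding hvec_def beta_eq by (simp add: lat_exp_def)

lemma generators_calV_charge:
  "tau F Psi Plus \<in> calV_charge F Psi 1" "tau F Psi Minus \<in> calV_charge F Psi (-1)"
  "jvec F \<in> calV_charge F Psi 0" "single {#} vac \<in> calV_charge F Psi 0"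
proof -
  show "tau F Psi Plus \<in> calV_charge F Psi 1" "tau F Psi Minus \<in> calV_charge F Psi (-1)"
    using generators_CV tau_charged[of Plus] tau_charged[of Minus]
    by (auto intro!: charged_calV_charge simp: pm_sign_def)
  show "jvec F \<in> calV_charge F Psi 0"
    using generators_CV jvec_charged by (auto intro!: charged_calV_charge)
  have "single {#} vac \<in> comp_space (charged 0)"
    using vac_charged F.subspace_0[OF subspace_charged] by (auto simp: comp_space_def lookup_single when_def)
  then show "single {#} vac \<in> calV_charge F Psi 0" by (intro charged_calV_charge vac_CV)
qed

lemma subspace_W0: "T.V.FT.subspace WL"
  unfolding T.V.FT.subspace_def W0_iff
  using FM.FT.subspace_0[OF subspace_calV_charge] FM.FT.subspace_add[OF subspace_calV_charge]
    FM.FT.subspace_scale[OF subspace_calV_charge]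
  by (auto simp: W0_iff lookup_add simp del: split_paired_All)

abbreviation VL :: "(int \<times> nat multiset \<Rightarrow>\<^sub>0 'f fm) set" where
  "VL \<equiv> Vsl2 F Psi L"

lemma tensor_vsa_simps:
  "vscale (tensor_vsa (FM F) L) = fscale (vscale (FM F))"
  "vmode (tensor_vsa (FM F) L) = T.V.TM"
  "vvac (tensor_vsa (FM F) L) = single (0, {#}) (single {#} vac)"
proof -
  show "vscale (tensor_vsa (FM F) L) = fscale (vscale (FM F))" "vmode (tensor_vsa (FM F) L) = T.V.TM"
    unfolding tensor_vsa_def[of "FM F" L] by (simp_all only: vsa.simps)
  have "vvac (tensor_vsa (FM F) L) = tens (vscale (FM F)) (vvac (FM F)) (vvac L)"
    unfolding tensor_vsa_def[of "FM F" L] by (simp only: vsa.simps)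
  then show "vvac (tensor_vsa (FM F) L) = single (0, {#}) (single {#} vac)"
    by (simp add: L_vac lat_exp_def)
qed

lemma VL_W0: "VL \<subseteq> WL"
  unfolding Vsl2_def
proof (rule generated_subalgebra_least, unfold tensor_vsa_simps)
  show "T.V.FT.subspace WL" by (rule subspace_W0)
  show "single (0, {#}) (single {#} vac) \<in> WL"
    by (intro single_W0 generators_calV_charge)
  have "hvec F \<in> WL"
    unfolding hvec_eq
    by (intro T.V.FT.subspace_scale T.V.FT.subspace_diff subspace_W0 single_W0 generators_calV_charge)
  moreover have "evec F Psi \<in> WL" "fvec F Psi \<in> WL"
    unfolding evec_eq fvec_eq by (intro single_W0 generators_calV_charge)+
  ultimately show "{evec F Psi, fvec F Psi, hvec F} \<subseteq> WL" by blast
  show "T.V.TM a n b \<in> WL" if "a \<in> WL" "b \<in> WL" for a b n by (rule W0_closed[OF that])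
qed

lemma VL_generators: "evec F Psi \<in> VL" "fvec F Psi \<in> VL" "hvec F \<in> VL"
  unfolding Vsl2_def by (rule subsetD[OF generated_subalgebra_superset], simp)+

lemma TM_jvec:
  assumes c: "\<And>u. YU (jvec F) n u = sU c u"
  shows "T.M.TM (single (0, {#}) (jvec F)) n y = fscale sU c y"
proof -
  have jC: "jvec F \<in> CV" using generators_CV by blast
  have "\<not> T.M.odd_basis (0, {#})"
    by (simp add: T.M.odd_basis_def homogeneous_basis_L)
  then have "T.M.TM (single (0, {#}) (jvec F)) n (tens sU u (single k 1)) = tens sU (sU c u) (single k 1)" for u k
  proof -
    have vacL: "vmode L (single (0, {#}) 1) q b = (if q = -1 then b else 0)" for q b
      using vertex_moduleD(9)[OF L_module, of b q] by (simp add: L_vac lat_exp_def)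
    have "T.M.TM (single (0, {#}) (jvec F)) n (tens sU u (single k 1))
      = Sum_any (\<lambda>l. tens sU (YU (jvec F) l u) (vmode L (single (0, {#}) 1) (n - l - 1) (single k 1)))"
      using T.TM_single_tens[OF jC, of "(0, {#})" n u "single k 1"] \<open>\<not> T.M.odd_basis (0, {#})\<close>
      by (simp add: T.M.par_if_def)
    also have "\<dots> = tens sU (YU (jvec F) n u) (single k 1)"
      by (subst Sum_any_single[of n]) (simp_all add: vacL)
    finally show ?thesis by (simp add: c)
  qed
  then have *: "T.M.TM (single (0, {#}) (jvec F)) n (single k u) = single k (sU c u)" for u k
    by simp
  have "T.M.TM (single (0, {#}) (jvec F)) n y = (\<Sum>k\<in>keys y. T.M.TM (single (0, {#}) (jvec F)) n (single k (lookup y k)))"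
    by (rule T.TM_expand_right[OF single_comp_space[OF jC]])
  also have "\<dots> = (\<Sum>k\<in>keys y. fscale sU c (single k (lookup y k)))"
    unfolding * by simp
  also have "\<dots> = fscale sU c y"
    unfolding T.M.FT.scale_sum_right[symmetric] sum_single_lookup ..
  finally show ?thesis .
qed

theorem Ls_irreducible:
  assumes irr: "irreducible_vertex_module (FM F) CV sU YU UNIV"
  shows "irreducible_vertex_module (tensor_vsa (FM F) L) VL (fscale sU) T.M.TM (Ls s)"
proof -
  have irr_gen: "N = {0} \<or> N = UNIV"
    if N: "U.subspace N" and "\<And>g n u. g \<in> generators \<Longrightarrow> u \<in> N \<Longrightarrow> YU g n u \<in> N" for N
  proof -
    have "\<forall>a\<in>CV. \<forall>n. \<forall>u\<in>N. YU a n u \<in> N"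
      using closed_under_generators[OF N] that(2) by blast
    then show ?thesis using irr N unfolding irreducible_vertex_module_def by blast
  qed
  have scalar: "\<exists>c. \<forall>u. YU z n u = sU c u" if "z \<in> {jvec F, nuvec F}" for z n
    using central_scalar[OF irr_gen that] .
  have "Ls s \<noteq> {0}"
  proof -
    have "(UNIV :: 'u set) \<noteq> {0}" using irr by (simp add: irreducible_vertex_module_def)
    then obtain u :: 'u where "u \<noteq> 0" by blast
    then obtain i where i: "cmp i u \<noteq> 0" using cmp_eqI[of u 0] by auto
    have "single (i - s, {#}) (cmp i u) \<in> Ls s"
      using cmp_in_U[of i u] U.subspace_0[OF subspace_U]
      unfolding Ls_def by (auto simp: lookup_single when_def)
    moreover have "single (i - s, {#}) (cmp i u) \<noteq> 0"
      using i by (metis lookup_single_eq lookup_zero)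
    ultimately show ?thesis by blast
  qed
  moreover have "N = {0} \<or> N = Ls s"
    if N: "T.M.FT.subspace N" "N \<subseteq> Ls s" and closed: "\<forall>a\<in>VL. \<forall>n. \<forall>y\<in>N. T.M.TM a n y \<in> N" for N
  proof (cases "N = {0}")
    case False
    \<comment> \<open>From h = -2(\<beta> - j), the mode \<beta>(n) is -1/2 times the mode h(n) plus
      that of j, and the latter is the scalar c by Schur's lemma.\<close>
    have h: "hmode n y \<in> N" if y: "y \<in> N" for n y
    proof -
      obtain c where c: "\<And>u. YU (jvec F) n u = sU c u" using scalar[of "jvec F" n] by auto
      let ?H = "single (0, {#0#}) (single {#} vac) :: int \<times> nat multiset \<Rightarrow>\<^sub>0 'f fm"
      let ?J = "single (0, {#}) (jvec F) :: int \<times> nat multiset \<Rightarrow>\<^sub>0 'f fm"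
      have jC: "jvec F \<in> CV" using generators_CV by blast
      note CS = single_comp_space[OF vac_CV, of "(0, {#0#})"] single_comp_space[OF jC, of "(0, {#})"]
      have HJ: "?H - ?J = ?H + fscale (vscale (FM F)) (-1) ?J"
        by (simp only: T.V.FT.scale_minus_left T.V.FT.scale_one) simp
      have mJ: "fscale (vscale (FM F)) (-1) ?J \<in> comp_space CV"
        by (rule T.V.FT.subspace_scale[OF T.M.subspace_comp_space CS(2)])
      have HJC: "?H - ?J \<in> comp_space CV"
        by (rule T.V.FT.subspace_diff[OF T.M.subspace_comp_space CS])
      have "T.M.TM (hvec F) n y = fscale sU (-2) (T.M.TM (?H - ?J) n y)"
        unfolding hvec_eq using T.M.TM_scale_left[OF HJC, of "-2" n y] by simp
      also have "T.M.TM (?H - ?J) n y = hmode n y + fscale sU (-1) (fscale sU c y)"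
        unfolding HJ T.M.TM_add_left[OF CS(1) mJ]
        using T.M.TM_scale_left[OF CS(2), of "-1" n y] TM_jvec[OF c, of y] by (simp add: hmode_def)
      finally have "hmode n y = fscale sU (- 1 / 2) (T.M.TM (hvec F) n y) + fscale sU c y"
        by (simp add: T.M.FT.scale_right_distrib flip: T.M.FT.scale_left_distrib)
      moreover have "T.M.TM (hvec F) n y \<in> N" using closed VL_generators(3) y by blast
      ultimately show ?thesis
        using y by (simp add: T.M.FT.subspace_diff[OF N(1)] T.M.FT.subspace_scale[OF N(1)])
    qed
    \<comment> \<open>The part of U visible in N at vacuum vectors. In L_s(U) a component of degree
      i sits over the sector i - s. Testing all components makes the set a subspace of U to which
      irreducibility can be applied.\<close>
    let ?K = "{u. \<forall>i. single (i - s, {#}) (cmp i u) \<in> N}"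
    have K: "U.subspace ?K"
      unfolding U.subspace_def
      using T.M.FT.subspace_0[OF N(1)] T.M.FT.subspace_add[OF N(1)] T.M.FT.subspace_scale[OF N(1)]
      by (auto simp: cmp_add cmp_scale single_add simp flip: U.fscale_single)
    have "?K = {0} \<or> ?K = UNIV"
    proof (rule irr_gen[OF K])
      fix g n u assume g: "g \<in> generators" and u: "u \<in> ?K"
      have tau: "YU a n u \<in> ?K"
        if \<epsilon>: "\<epsilon> = 1 \<or> \<epsilon> = - 1" and a: "a \<in> calV_charge F Psi \<epsilon>"
          and aN: "\<And>n y. y \<in> N \<Longrightarrow> T.M.TM (single (\<epsilon>, {#}) a) n y \<in> N" for a \<epsilon>
      proof (rule CollectI, rule allI)
        fix i
        have "single (i - \<epsilon> - s, {#}) (cmp (i - \<epsilon>) u) \<in> N" using u by blast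
        from tau_modes_closed[OF N(1) h \<epsilon> calV_charge_CV[OF a] aN cmp_in_U this, of n]
        show "single (i - s, {#}) (cmp i (YU a n u)) \<in> N"
          by (simp add: cmp_YU[OF a] algebra_simps)
      qed
      consider "g = tau F Psi Plus" | "g = tau F Psi Minus" | "g \<in> {jvec F, nuvec F}" using g by blast
      then show "YU g n u \<in> ?K"
      proof cases
        case 1
        then show ?thesis
          using tau[of 1 "tau F Psi Plus"] generators_calV_charge(1) closed VL_generators(1)
          unfolding evec_eq by blast
      next
        case 2
        then show ?thesis
          using tau[of "-1" "tau F Psi Minus"] generators_calV_charge(2) closed VL_generators(2)
          unfolding fvec_eq by blast
      next
        \<comment> \<open>No element of V supplies these modes; stability holds because they act as
          scalars.\<close>
        case 3
        then obtain c where "YU g n u = sU c u" using scalar by blast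
        then show ?thesis using U.subspace_scale[OF K u] by simp
      qed
    qed
    moreover have "?K \<noteq> {0}"
    proof -
      obtain x where "x \<in> N" "x \<noteq> 0" using False T.M.FT.subspace_0[OF N(1)] by blast
      then obtain m u where u: "u \<noteq> 0" "single (m, {#}) u \<in> N"
        using extract_vacuum[OF N(1) h] by blast
      have "single (m, {#}) u \<in> Ls s" using u(2) N(2) by blast
      from Ls_D[OF this, of "(m, {#})"] have um: "u \<in> U (m + s)" by simp
      have "u \<in> ?K"
        using u T.M.FT.subspace_0[OF N(1)] by (auto simp: cmp_homogeneous[OF um])
      then show ?thesis using u by blast
    qed
    ultimately have K_UNIV: "?K = UNIV" by blast
    have vacuum: "single (m, {#}) u \<in> N" if "u \<in> U (m + s)" for m u
    proof -
      have "single (m + s - s, {#}) (cmp (m + s) u) \<in> N" using K_UNIV by blast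
      then show ?thesis by (simp add: cmp_homogeneous[OF that])
    qed
    \<comment> \<open>From the vacuum of its sector every monomial is reached by creation operators:
      \<beta>(-k - 1) adds k to \<mu>.\<close>
    have basis: "single (m, \<mu>) u \<in> N" if u: "u \<in> U (m + s)" for m \<mu> u
    proof (induction \<mu>)
      case empty
      show ?case by (rule vacuum[OF u])
    next
      case (add k \<mu>)
      have "hmode (- int k - 1) (tens sU u (single (m, \<mu>) 1)) \<in> N" by (rule h) (simp add: add)
      moreover have "heis (- int k - 1) (single (m, \<mu>) 1) = single (m, add_mset k \<mu>) 1"
        by (simp add: heis_def)
      ultimately show ?case unfolding hmode_tens by simp
    qed
    have "y \<in> N" if y: "y \<in> Ls s" for y
    proof -
      have "(\<Sum>k\<in>keys y. single k (lookup y k)) \<in> N"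
      proof (rule T.M.FT.subspace_sum[OF N(1)])
        fix k
        have "lookup y k \<in> U (fst k + s)" by (rule Ls_D[OF y])
        then show "single k (lookup y k) \<in> N" using basis[of "lookup y k" "fst k" "snd k"] by simp
      qed
      then show ?thesis by (simp add: sum_single_lookup)
    qed
    then show ?thesis using N(2) by blast
  qed simp
  moreover have "vertex_module (tensor_vsa (FM F) L) VL (fscale sU) T.M.TM (Ls s)"
    by (rule vertex_module_restrict[OF Ls_W0_module VL_W0])
      (use VL_W0 W0_Ls_closed subspace_Ls in auto)
  ultimately show ?thesis unfolding irreducible_vertex_module_def by blast
qed

end

theorem theorem6p2:
  fixes F :: "'f::ab_group_add vsa"
    and Psi :: "pm \<Rightarrow> int \<Rightarrow> 'f \<Rightarrow> 'f"
    and L :: "lat vsa"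
    and sU :: "complex \<Rightarrow> 'u::ab_group_add \<Rightarrow> 'u"
    and YU :: "'f fm \<Rightarrow> int \<Rightarrow> 'u \<Rightarrow> 'u"
    and U :: "int \<Rightarrow> 'u set"
  assumes "clifford_vsa F Psi"
    and "lattice_vsa L"
    and "vertex_module (FM F) (calV F Psi) sU YU UNIV"
    and "direct_sum sU UNIV U"
    and "\<And>i j. mode_span sU YU (calV_charge F Psi i) (U j) \<subseteq> U (i + j)"
  shows "direct_sum (fscale sU) UNIV (Lmod sU U)
    \<and> (\<forall>s. direct_sum (fscale sU) (Lmod sU U s) (Lsummand sU U s))
    \<and> (\<forall>s. vertex_module (tensor_vsa (FM F) L) (W0 F Psi)
             (fscale sU) (UF_mode sU YU U L) (Lmod sU U s))
    \<and> (irreducible_vertex_module (FM F) (calV F Psi) sU YU UNIV \<longrightarrow>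
         (\<forall>s. irreducible_vertex_module (tensor_vsa (FM F) L) (Vsl2 F Psi L)
                (fscale sU) (UF_mode sU YU U L) (Lmod sU U s)))"
proof -
  interpret graded_module F Psi L sU YU U
    by (intro graded_module.intro clifford.intro lattice_fock.intro graded_module_axioms.intro assms)
  have Lmod: "Lmod sU U = Ls" by (rule ext) (rule Lmod_eq)
  show ?thesis
    unfolding Lmod UF_mode_eq
    using direct_sum_Ls direct_sum_Lsummand Ls_W0_module Ls_irreducible by blast
qed

end
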